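(* Let $x>1$ be an arbitrary but fixed real number. Then, for every real $\theta<\Theta$, the partial sums $\Sigma R^{triv}_T(x)$ are not $O(T^\theta)$ as $T\to\infty$. In particular, $\limsup_{N\to\infty}\left|\sum_{1\le k\le N}\operatorname{ERi}(-2k\log x)\right|=\infty$, and hence the series $\sum_{k\ge1}\operatorname{ERi}(-2k\log x)$ does not converge.
   Context: $\zeta$ is the Riemann zeta function. $\operatorname{ERi}$ is the entire function $\operatorname{ERi}(s)=1+\sum_{k=1}^\infty \frac{s^k}{k\,k!\,\zeta(k+1)}$; equivalently, $\operatorname{ERi}(0)=1$ and $\operatorname{ERi}(s)=\sum_{n\ge1}\frac{\mu(n)}{n}\operatorname{Ei}(s/n)$ for $s\neq0$, where $\mu$ is the Möbius function and $\operatorname{Ei}$ is the exponential integral ($\operatorname{Ei}(s)=\int_{-\infty}^s \frac{e^z}{z}\,dz$ along any path avoiding $[0,\infty)$ for $s\in\mathbb C\setminus[0,\infty)$, and the average of the two boundary values from above and below for $s\in(0,\infty)$). The quantity $\operatorname{ERi}(-2k\log x)$ is also denoted $R(x^{-2k})$. For real $x>1$ and $T>1$, $\Sigma R^{triv}_T(x):=\sum_{1\le k\le T}\operatorname{ERi}(-2k\log x)$ (sum over integers $k$). $\Theta:=\sup\{\operatorname{Re}(\rho):\ \zeta(\rho)=0,\ 0<\operatorname{Re}(\rho)<1\}$. *)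

theory Defs
  imports
    "HOL-Complex_Analysis.Complex_Analysis"
    "HOL-Library.Landau_Symbols"
begin

section \<open>The Riemann zeta function\<close>

text \<open>
  The zeta function is defined as the analytic continuation of its Dirichlet series to the
  punctured plane. Existence and uniqueness of the continuation are proved below; the value at
  the pole \<open>1\<close> is set to \<open>0\<close> and is never used.
\<close>

definition zeta_continuation :: "(complex \<Rightarrow> complex) \<Rightarrow> bool" where
  "zeta_continuation f \<longleftrightarrow>
     f holomorphic_on (-{1}) \<and> (\<forall>s. Re s > 1 \<longrightarrow> (\<lambda>n. 1 / of_nat (Suc n) powr s) sums f s)"

definition riemann_zeta :: "complex \<Rightarrow> complex" where
  "riemann_zeta s = (if s = 1 then 0 else (SOME f. zeta_continuation f) s)"

subsection \<open>Existence and uniqueness of the continuation\<close>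

lemma holomorphic_on_suminf:
  fixes f :: "nat \<Rightarrow> complex \<Rightarrow> complex"
  assumes "open S" "\<And>n. f n holomorphic_on S"
    and "\<And>z. z \<in> S \<Longrightarrow> \<exists>d M. 0 < d \<and> cball z d \<subseteq> S \<and> summable M \<and>
               (\<forall>n. \<forall>w\<in>cball z d. norm (f n w) \<le> M n)"
  shows "(\<lambda>z. \<Sum>n. f n z) holomorphic_on S"
proof (rule holomorphic_uniform_sequence[where f = "\<lambda>n z. \<Sum>i<n. f i z"])
  show "(\<lambda>z. \<Sum>i<n. f i z) holomorphic_on S" for n
    by (intro holomorphic_intros assms)
  show "\<exists>d>0. cball z d \<subseteq> S \<and>
          uniform_limit (cball z d) (\<lambda>n z. \<Sum>i<n. f i z) (\<lambda>z. \<Sum>n. f n z) sequentially"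
    if z: "z \<in> S" for z
  proof -
    obtain d M where "0 < d" "cball z d \<subseteq> S" "summable M"
        "\<And>n w. w \<in> cball z d \<Longrightarrow> norm (f n w) \<le> M n"
      using assms(3)[OF z] by blast
    thus ?thesis using Weierstrass_m_test[of "cball z d" f M] by blast
  qed
qed fact

lemma norm_Suc_powr: "norm ((of_nat (Suc n) :: complex) powr s) = real (Suc n) powr Re s"
  by (subst norm_powr_real_powr) (auto simp: add_nonneg_nonneg)

lemma summable_Suc_powr: "a < -1 \<Longrightarrow> summable (\<lambda>n. real (Suc n) powr a)"
  using summable_real_powr_iff[of a] by (subst summable_Suc_iff) auto

lemma zeta_sums:
  assumes "Re s > 1"
  shows "summable (\<lambda>n. 1 / (of_nat (Suc n) :: complex) powr s)"
proof (rule summable_norm_cancel)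
  have "norm (1 / (of_nat (Suc n) :: complex) powr s) = real (Suc n) powr (- Re s)" for n
    using norm_Suc_powr[of n s] by (simp add: norm_divide powr_minus divide_simps del: of_nat_Suc)
  thus "summable (\<lambda>n. norm (1 / (of_nat (Suc n) :: complex) powr s))"
    using summable_Suc_powr[of "- Re s"] assms by (simp del: of_nat_Suc)
qed

definition falling_fact :: "complex \<Rightarrow> nat \<Rightarrow> complex" where
  "falling_fact a j = (\<Prod>i<j. a - of_nat i)"

lemma falling_fact_Suc: "falling_fact a (Suc j) = falling_fact a j * (a - of_nat j)"
  by (simp add: falling_fact_def mult.commute)

definition taylor_rem :: "nat \<Rightarrow> nat \<Rightarrow> complex \<Rightarrow> complex" where
  "taylor_rem N n s = of_nat (Suc (Suc n)) powr (1 - s)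
     - (\<Sum>j\<le>N. falling_fact (1 - s) j * of_nat (Suc n) powr (1 - s - of_nat j) / fact j)"

lemma norm_taylor_rem_le:
  assumes "Re s \<ge> - real N"
  shows "norm (taylor_rem N n s) \<le>
           norm (falling_fact (1 - s) (Suc N)) * real (Suc n) powr (- Re s - real N)"
proof -
  define a where "a = 1 - s"
  define f where "f = (\<lambda>j (x::complex). falling_fact a j * x powr (a - of_nat j))"
  define S where "S = closed_segment (of_nat (Suc n) :: complex) (of_nat (Suc (Suc n)))"
  define B where "B = norm (falling_fact a (Suc N)) * real (Suc n) powr (- Re s - real N)"
  have S_eq: "S = of_real ` {real (Suc n)..real (Suc (Suc n))}"
    unfolding S_def using closed_segment_of_real[of "real (Suc n)" "real (Suc (Suc n))"]
    by (simp add: closed_segment_eq_real_ivl del: of_nat_Suc)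
  have "norm (f 0 (of_nat (Suc (Suc n))) -
          (\<Sum>i\<le>N. f i (of_nat (Suc n)) * (of_nat (Suc (Suc n)) - of_nat (Suc n)) ^ i / fact i))
        \<le> B * norm (of_nat (Suc (Suc n)) - of_nat (Suc n) :: complex) ^ Suc N / fact N"
  proof (rule complex_Taylor)
    show "convex S" by (simp add: S_def)
    show "(f i has_field_derivative f (Suc i) x) (at x within S)" if "x \<in> S" for i x
    proof -
      have "x \<notin> \<real>\<^sub>\<le>\<^sub>0" using that by (auto simp: S_eq)
      hence "((\<lambda>x. falling_fact a i * x powr (a - of_nat i)) has_field_derivative
               falling_fact a i * ((a - of_nat i) * x powr (a - of_nat i - 1))) (at x)"
        by (intro DERIV_cmult has_field_derivative_powr)
      moreover have "a - of_nat i - 1 = a - of_nat (Suc i)" by simp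
      ultimately show ?thesis
        unfolding f_def falling_fact_Suc mult.assoc
        by (simp only: has_field_derivative_at_within)
    qed
    show "norm (f (Suc N) x) \<le> B" if x: "x \<in> S" for x
    proof -
      obtain t where t: "x = of_real t" "t \<ge> real (Suc n)" using x by (auto simp: S_eq)
      have "norm (x powr (a - of_nat (Suc N))) = t powr (- Re s - real N)"
        using t by (subst norm_powr_real_powr) (auto simp: a_def)
      also have "\<dots> \<le> real (Suc n) powr (- Re s - real N)"
        using t assms by (intro powr_mono2') auto
      finally show ?thesis by (auto simp: f_def B_def norm_mult intro!: mult_left_mono)
    qed
  qed (auto simp: S_def)
  hence "norm (taylor_rem N n s) \<le> B / fact N"
    by (simp add: f_def taylor_rem_def a_def falling_fact_def)
  also have "\<dots> \<le> B"
    using divide_left_mono[OF fact_ge_1[of N], of B] by (simp add: B_def)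
  finally show ?thesis by (simp add: B_def a_def)
qed

lemma holomorphic_taylor_rem: "taylor_rem N n holomorphic_on A"
  unfolding taylor_rem_def falling_fact_def
  by (intro holomorphic_intros) auto

lemma holomorphic_suminf_taylor_rem:
  "(\<lambda>s. \<Sum>n. taylor_rem N n s) holomorphic_on {s. Re s > 1 - real N}"
proof (rule holomorphic_on_suminf)
  fix z assume "z \<in> {s. Re s > 1 - real N}"
  hence z: "Re z > 1 - real N" by simp
  define d where "d = (Re z - (1 - real N)) / 2"
  have d: "d > 0" using z by (simp add: d_def)
  have re: "Re w \<ge> 1 - real N + d" if "w \<in> cball z d" for w
  proof -
    have "\<bar>Re (z - w)\<bar> \<le> d" using that abs_Re_le_cmod[of "z - w"] by (simp add: dist_norm)
    moreover have "Re z = 1 - real N + 2 * d" by (simp add: d_def field_simps)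
    ultimately show ?thesis by simp
  qed
  have "compact ((\<lambda>s. falling_fact (1 - s) (Suc N)) ` cball z d)"
    unfolding falling_fact_def by (intro compact_continuous_image continuous_intros) auto
  then obtain C where C: "\<And>w. w \<in> cball z d \<Longrightarrow> norm (falling_fact (1 - w) (Suc N)) \<le> C"
    by (metis bounded_iff compact_imp_bounded image_eqI)
  have bd: "norm (taylor_rem N n w) \<le> C * real (Suc n) powr (- 1 - d)" if w: "w \<in> cball z d" for n w
  proof -
    have "norm (taylor_rem N n w) \<le>
            norm (falling_fact (1 - w) (Suc N)) * real (Suc n) powr (- Re w - real N)"
      using re[OF w] d by (intro norm_taylor_rem_le) auto
    also have "\<dots> \<le> C * real (Suc n) powr (- 1 - d)"
      using re[OF w] C[OF w] order.trans[OF norm_ge_zero C[OF w]]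
      by (intro mult_mono powr_mono) auto
    finally show ?thesis .
  qed
  have "summable (\<lambda>n. C * real (Suc n) powr (- 1 - d))"
    using d by (intro summable_mult summable_Suc_powr) auto
  moreover have "cball z d \<subseteq> {s. Re s > 1 - real N}" using re d by force
  ultimately show "\<exists>d M. 0 < d \<and> cball z d \<subseteq> {s. Re s > 1 - real N} \<and> summable M \<and>
               (\<forall>n. \<forall>w\<in>cball z d. norm (taylor_rem N n w) \<le> M n)"
    using d bd by blast
qed (auto simp: open_halfspace_Re_gt holomorphic_taylor_rem)

abbreviation zeta_series :: "complex \<Rightarrow> complex" where
  "zeta_series s \<equiv> (\<Sum>n. 1 / of_nat (Suc n) powr s)"

lemma holomorphic_zeta_series: "zeta_series holomorphic_on {s. Re s > 1}"
proof (rule holomorphic_on_suminf)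
  fix z assume "z \<in> {s. Re s > 1}"
  hence z: "Re z > 1" by simp
  define d where "d = (Re z - 1) / 2"
  have d: "d > 0" using z by (simp add: d_def)
  have re: "Re w \<ge> 1 + d" if "w \<in> cball z d" for w
  proof -
    have "\<bar>Re (z - w)\<bar> \<le> d" using that abs_Re_le_cmod[of "z - w"] by (simp add: dist_norm)
    moreover have "Re z = 1 + 2 * d" by (simp add: d_def field_simps)
    ultimately show ?thesis by simp
  qed
  have bd: "norm (1 / of_nat (Suc n) powr w :: complex) \<le> real (Suc n) powr (- 1 - d)"
    if w: "w \<in> cball z d" for n w
  proof -
    have "norm (1 / of_nat (Suc n) powr w :: complex) = real (Suc n) powr (- Re w)"
      using norm_Suc_powr[of n w] by (simp add: norm_divide powr_minus divide_simps del: of_nat_Suc)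
    also have "\<dots> \<le> real (Suc n) powr (- 1 - d)"
      using re[OF w] by (intro powr_mono) auto
    finally show ?thesis .
  qed
  have "summable (\<lambda>n. real (Suc n) powr (- 1 - d))"
    using d by (intro summable_Suc_powr) auto
  moreover have "cball z d \<subseteq> {s. Re s > 1}" using re d by force
  ultimately show "\<exists>d M. 0 < d \<and> cball z d \<subseteq> {s. Re s > 1} \<and> summable M \<and>
               (\<forall>n. \<forall>w\<in>cball z d. norm (1 / of_nat (Suc n) powr w :: complex) \<le> M n)"
    using d bd by blast
qed (auto simp: open_halfspace_Re_gt intro!: holomorphic_intros simp del: of_nat_Suc)

text \<open>
  Summing the Taylor expansions of \<open>(n + 1) powr (1 - s)\<close> around \<open>n\<close> telescopes and expresses
  the series at \<open>s\<close> through its values at \<open>s + 1, s + 2, \<dots>\<close>.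
\<close>

lemma zeta_series_recurrence:
  assumes s: "Re s > 1"
  shows "(s - 1) * zeta_series s = 1
           - (\<Sum>j<N. falling_fact (1 - s) (Suc j) / fact (j + 2)
                * ((s + of_nat (Suc j) - 1) * zeta_series (s + of_nat (Suc j))))
           + (\<Sum>n. taylor_rem (Suc N) n s)"
proof -
  define t where "t = (\<lambda>j n. falling_fact (1 - s) j * of_nat (Suc n) powr (1 - s - of_nat j) / fact j)"
  define c where "c = (\<lambda>j. falling_fact (1 - s) j / fact j * zeta_series (s + of_nat j - 1))"
  have t_sums: "(t (Suc j)) sums c (Suc j)" for j
  proof -
    have "(\<lambda>n. falling_fact (1 - s) (Suc j) / fact (Suc j) * (1 / of_nat (Suc n) powr (s + of_nat (Suc j) - 1)))
            sums c (Suc j)"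
      unfolding c_def using s by (intro sums_mult summable_sums zeta_sums) auto
    moreover have "1 - s - of_nat (Suc j) = - (s + of_nat (Suc j) - 1)"
      by simp
    ultimately show ?thesis
      unfolding t_def by (simp only: powr_minus) (simp add: field_simps del: of_nat_Suc)
  qed
  have lim: "(\<lambda>n. of_nat (Suc n) powr (1 - s) :: complex) \<longlonglongrightarrow> 0"
  proof (rule tendsto_norm_zero_cancel)
    have "(\<lambda>n. real (Suc n) powr Re (1 - s)) \<longlonglongrightarrow> 0"
      using s by (intro tendsto_neg_powr filterlim_compose[OF filterlim_real_sequentially filterlim_Suc]) auto
    thus "(\<lambda>n. norm (of_nat (Suc n) powr (1 - s) :: complex)) \<longlonglongrightarrow> 0"
      by (simp only: norm_Suc_powr)
  qed
  have "(\<lambda>n. of_nat (Suc (Suc n)) powr (1 - s) - of_nat (Suc n) powr (1 - s)) sums (0 - of_nat (Suc 0) powr (1 - s) :: complex)"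
    by (rule telescope_sums[OF lim])
  hence tele: "(\<lambda>n. of_nat (Suc (Suc n)) powr (1 - s) - of_nat (Suc n) powr (1 - s)) sums (- 1 :: complex)"
    by simp
  have rem: "taylor_rem (Suc N) n s =
     (of_nat (Suc (Suc n)) powr (1 - s) - of_nat (Suc n) powr (1 - s)) - (\<Sum>j\<le>N. t (Suc j) n)" for n
    unfolding taylor_rem_def by (subst sum.atMost_Suc_shift) (simp add: t_def falling_fact_def)
  have "(\<lambda>n. taylor_rem (Suc N) n s) sums (- 1 - (\<Sum>j\<le>N. c (Suc j)))"
    unfolding rem by (intro sums_diff tele sums_sum t_sums)
  hence "(\<Sum>n. taylor_rem (Suc N) n s) = - 1 - (\<Sum>j\<le>N. c (Suc j))"
    by (simp add: sums_iff)
  also have "(\<Sum>j\<le>N. c (Suc j)) = c 1 + (\<Sum>j<N. c (Suc (Suc j)))"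
    by (simp add: lessThan_Suc_atMost[symmetric] sum.lessThan_Suc_shift del: sum.lessThan_Suc)
  also have "c 1 = (1 - s) * zeta_series s"
    by (simp add: c_def falling_fact_def)
  also have "(\<Sum>j<N. c (Suc (Suc j))) = - (\<Sum>j<N. falling_fact (1 - s) (Suc j) / fact (j + 2)
                * ((s + of_nat (Suc j) - 1) * zeta_series (s + of_nat (Suc j))))"
    unfolding sum_negf[symmetric]
  proof (rule sum.cong)
    fix j
    have "s + of_nat (Suc (Suc j)) - 1 = s + of_nat (Suc j)" by simp
    moreover have "falling_fact (1 - s) (Suc (Suc j)) = - (falling_fact (1 - s) (Suc j) * (s + of_nat (Suc j) - 1))"
      by (subst falling_fact_Suc) (simp add: algebra_simps)
    ultimately show "c (Suc (Suc j)) = - (falling_fact (1 - s) (Suc j) / fact (j + 2)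
                * ((s + of_nat (Suc j) - 1) * zeta_series (s + of_nat (Suc j))))"
      unfolding c_def by (simp only: add_2_eq_Suc') simp
  qed simp
  finally show ?thesis by (simp add: algebra_simps)
qed

lemma zeta_halfplane_continuation:
  "\<exists>E. E holomorphic_on {s. Re s > 1 - real m} \<and> (\<forall>s. Re s > 1 \<longrightarrow> E s = (s - 1) * zeta_series s)"
proof (induction m)
  case 0
  have "(\<lambda>s. (s - 1) * zeta_series s) holomorphic_on {s. Re s > 1}"
    by (intro holomorphic_intros holomorphic_zeta_series)
  thus ?case by auto
next
  case (Suc m)
  then obtain E where E: "E holomorphic_on {s. Re s > 1 - real m}"
    "\<And>s. Re s > 1 \<Longrightarrow> E s = (s - 1) * zeta_series s" by blast
  define F where "F = (\<lambda>s. 1 - (\<Sum>j<m. falling_fact (1 - s) (Suc j) / fact (j + 2) * E (s + of_nat (Suc j)))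
           + (\<Sum>n. taylor_rem (Suc m) n s))"
  have "(\<lambda>s. E (s + of_nat (Suc j))) holomorphic_on {s. Re s > 1 - real (Suc m)}" for j
    using holomorphic_on_compose_gen[OF _ E(1), of "\<lambda>s. s + of_nat (Suc j)" "{s. Re s > 1 - real (Suc m)}"]
    by (force simp: o_def intro!: holomorphic_intros)
  hence "F holomorphic_on {s. Re s > 1 - real (Suc m)}"
    unfolding F_def falling_fact_def
    by (intro holomorphic_intros holomorphic_suminf_taylor_rem) auto
  moreover have "F s = (s - 1) * zeta_series s" if "Re s > 1" for s
    unfolding zeta_series_recurrence[OF that, of m] F_def using that by (simp add: E(2))
  ultimately show ?case by blast
qed

lemma zeta_continuation_exists: "\<exists>f. zeta_continuation f"
proof -
  obtain E where E: "\<And>m. E m holomorphic_on {s. Re s > 1 - real m}"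
    "\<And>m s. Re s > 1 \<Longrightarrow> E m s = (s - 1) * zeta_series s"
    using zeta_halfplane_continuation by metis
  have agree: "E m s = E n s" if "Re s > 1 - real m" "m \<le> n" for m n s
  proof (rule analytic_continuation_open[where s = "{s. Re s > 1}" and
      s' = "{s. Re s > 1 - real m}" and f = "E m" and g = "E n" and z = s])
    show "{s. Re s > 1} \<noteq> {}" by (auto intro!: exI[of _ 2])
    show "E n holomorphic_on {s. Re s > 1 - real m}"
      by (rule holomorphic_on_subset[OF E(1)]) (use that in auto)
  qed (use that E in \<open>auto simp: open_halfspace_Re_gt convex_connected convex_halfspace_Re_gt\<close>)
  define k where "k = (\<lambda>s. nat \<lceil>2 - Re s\<rceil>)"
  have k: "Re s > 1 - real (k s)" for s unfolding k_def by linarith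
  define G where "G = (\<lambda>s. E (k s) s)"
  have G_eq: "G s = E m s" if "Re s > 1 - real m" for s m
    unfolding G_def using agree k that by (metis linear)
  have "G holomorphic_on UNIV"
  proof -
    have "G field_differentiable at z" for z
    proof -
      have "G holomorphic_on {s. Re s > 1 - real (k z)}"
        by (rule holomorphic_transform[OF E(1)[of "k z"]]) (simp add: G_eq)
      thus ?thesis using k[of z]
        by (intro holomorphic_on_imp_differentiable_at) (auto simp: open_halfspace_Re_gt)
    qed
    thus ?thesis by (simp add: holomorphic_on_def field_differentiable_at_within)
  qed
  hence "(\<lambda>s. G s / (s - 1)) holomorphic_on (-{1})"
    by (intro holomorphic_on_divide holomorphic_intros) (auto intro: holomorphic_on_subset)
  moreover have "(\<lambda>n. 1 / of_nat (Suc n) powr s) sums (G s / (s - 1))" if s: "Re s > 1" for s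
  proof -
    have "s \<noteq> 1" using s by auto
    moreover have "G s = (s - 1) * zeta_series s"
      unfolding G_def by (rule E(2)[OF s])
    ultimately have "G s / (s - 1) = zeta_series s"
      by (metis nonzero_mult_div_cancel_left right_minus_eq)
    thus ?thesis using summable_sums[OF zeta_sums[OF s]] by metis
  qed
  ultimately have "zeta_continuation (\<lambda>s. G s / (s - 1))"
    unfolding zeta_continuation_def by blast
  thus ?thesis by blast
qed

lemma zeta_continuation_unique:
  assumes "zeta_continuation f" "zeta_continuation g" "s \<noteq> 1"
  shows "f s = g s"
proof (rule analytic_continuation_open[where s = "{s. Re s > 1}" and s' = "-{1}" and
      f = f and g = g and z = s])
  show "{s. Re s > 1} \<noteq> {}" by (auto intro!: exI[of _ 2])
  show "connected (-{1::complex})" by (rule connected_punctured_universe) simp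
  show "f z = g z" if "z \<in> {s. Re s > 1}" for z
    using assms that sums_unique2 unfolding zeta_continuation_def by blast
qed (use assms in \<open>auto simp: open_halfspace_Re_gt zeta_continuation_def\<close>)

theorem zeta_continuation_riemann_zeta: "zeta_continuation riemann_zeta"
proof -
  define f where "f = (SOME f. zeta_continuation f)"
  have f: "zeta_continuation f" unfolding f_def by (rule someI_ex[OF zeta_continuation_exists])
  have eq: "riemann_zeta s = f s" if "s \<noteq> 1" for s
    using that by (simp add: riemann_zeta_def f_def)
  have "riemann_zeta holomorphic_on (-{1})"
    using f eq by (subst holomorphic_cong[OF refl, where g = f]) (auto simp: zeta_continuation_def)
  moreover have "(\<lambda>n. 1 / of_nat (Suc n) powr s) sums riemann_zeta s" if "Re s > 1" for s
  proof -
    have "s \<noteq> 1" using that by auto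
    thus ?thesis using f that unfolding eq[OF \<open>s \<noteq> 1\<close>] zeta_continuation_def by blast
  qed
  ultimately show ?thesis by (simp add: zeta_continuation_def)
qed

section \<open>The function ERi and its partial sums\<close>

text \<open>The summation index \<open>k \<ge> 1\<close> of the defining series is written as \<open>Suc k\<close>.\<close>

definition ERi :: "complex \<Rightarrow> complex" where
  "ERi s = 1 + (\<Sum>k. s ^ Suc k / (of_nat (Suc k) * fact (Suc k) * riemann_zeta (of_nat (Suc k) + 1)))"

definition SigmaRtriv :: "real \<Rightarrow> real \<Rightarrow> complex" where
  "SigmaRtriv T x = (\<Sum>k | 1 \<le> k \<and> real k \<le> T. ERi (of_real (- 2 * real k * ln x)))"

text \<open>
  The set is bounded by \<open>1\<close> and nonempty because nontrivial zeros exist, so the real supremum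
  is the genuine one.
\<close>

definition zeta_Theta :: real where
  "zeta_Theta = Sup {Re \<rho> | \<rho>. riemann_zeta \<rho> = 0 \<and> 0 < Re \<rho> \<and> Re \<rho> < 1}"

lemma Re_riemann_zeta_ge_1: "Re (riemann_zeta (of_nat (Suc k) + 1)) \<ge> 1"
proof -
  let ?s = "of_nat (Suc k) + 1 :: complex"
  have s: "?s = of_nat (k + 2)" by simp
  have "(\<lambda>n. 1 / of_nat (Suc n) powr ?s) sums riemann_zeta ?s"
    using zeta_continuation_riemann_zeta by (auto simp: zeta_continuation_def)
  moreover have "1 / of_nat (Suc n) powr ?s = of_real (1 / real (Suc n) ^ (k + 2))" for n
    unfolding s by (subst powr_complexpow) (simp_all del: of_nat_Suc)
  ultimately have "(\<lambda>n. of_real (1 / real (Suc n) ^ (k + 2))) sums riemann_zeta ?s"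
    by (simp only:)
  hence "(\<lambda>n. 1 / real (Suc n) ^ (k + 2)) sums Re (riemann_zeta ?s)"
    using sums_Re by fastforce
  moreover have "(\<Sum>n<1. 1 / real (Suc n) ^ (k + 2)) \<le> (\<Sum>n. 1 / real (Suc n) ^ (k + 2))"
    using calculation by (intro sum_le_suminf) (auto simp: sums_iff simp del: power_Suc of_nat_Suc)
  ultimately have "(\<Sum>n<1. 1 / real (Suc n) ^ (k + 2)) \<le> Re (riemann_zeta ?s)"
    by (simp only: sums_iff)
  thus ?thesis by simp
qed

lemma summable_ERi:
  "summable (\<lambda>k. s ^ Suc k / (of_nat (Suc k) * fact (Suc k) * riemann_zeta (of_nat (Suc k) + 1)))"
proof (rule summable_comparison_test')
  show "summable (\<lambda>k. norm s ^ Suc k / fact (Suc k))"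
    using summable_exp_generic[of "norm s"] by (subst summable_Suc_iff) (simp add: field_simps)
  fix k :: nat
  define z where "z = riemann_zeta (of_nat (Suc k) + 1)"
  have z: "norm z \<ge> 1"
    unfolding z_def using Re_riemann_zeta_ge_1[of k] complex_Re_le_cmod order.trans by blast
  have "1 * 1 \<le> real (Suc k) * norm z"
    using z by (intro mult_mono) auto
  hence "fact (Suc k) * 1 \<le> fact (Suc k) * (real (Suc k) * norm z)"
    by (intro mult_left_mono) auto
  hence "norm s ^ Suc k / (real (Suc k) * fact (Suc k) * norm z) \<le> norm s ^ Suc k / fact (Suc k)"
    by (intro frac_le) (simp_all add: mult_ac del: fact_Suc of_nat_Suc)
  thus "norm (s ^ Suc k / (of_nat (Suc k) * fact (Suc k) * riemann_zeta (of_nat (Suc k) + 1)))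
        \<le> norm s ^ Suc k / fact (Suc k)"
    unfolding z_def[symmetric] by (simp only: norm_divide norm_mult norm_power norm_of_nat norm_fact)
qed

end

theory Submission
  imports Defs "HOL-Computational_Algebra.Squarefree" "HOL-Real_Asymp.Real_Asymp"
begin

text \<open>
  Put \<open>f u = ERi (- a u)\<close> with \<open>a = 2 ln x\<close>. Expanding \<open>1 / \<zeta>(k + 1)\<close> as a Moebius series gives
  \<open>- (u f'(u))' = a (\<Sum>n. \<mu>(n) / n\<^sup>2 * exp (- a u / n))\<close>, whose Mellin transform at \<open>2 - s\<close> is
  \<open>a powr (s - 1) * \<Gamma>(2 - s) / \<zeta>(s)\<close> for \<open>1 < s < 2\<close>, and \<open>u f'(u) = O(u powr d)\<close> for every \<open>d > 0\<close>. If the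
  partial sums of \<open>f(k)\<close> were \<open>O(N powr d)\<close>, then two integrations by parts and a comparison of integral
  and sum would continue this transform holomorphically to \<open>Re s > d\<close>. Multiplying by \<open>\<zeta>(s)\<close> and
  evaluating at a zero \<open>\<rho>\<close> with \<open>Re \<rho> > d\<close> gives \<open>\<Gamma>(2 - \<rho>) = 0\<close>, which is absurd.

  For unboundedness one nontrivial zero is needed. It is located near \<open>1/2 + 14.135 i\<close> by evaluating
  the Euler-Maclaurin formula with rational error bounds and comparing \<open>|\<zeta>|\<close> at the centre and on the
  boundary of a small disk.
\<close>

section \<open>Euler-Maclaurin summation for zeta\<close>

text \<open>The density is preferred to \<open>f\<close> itself because u d/du turns the exponential
  integrals in ERi into exponentials, and one more derivative brings a factor 1/n. The Moebius
  weights mu(n)/n^2 then make sum and Mellin integral interchangeable by absolute convergence. The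
  analytic identity is proved for real s with 1 + d < s < 2. The upper limit comes from the density
  having the nonzero value a / zeta(2) at u = 0; the lower one makes the boundary terms of the
  integrations by parts, of size u^(d+1-s), vanish. Complex s enters only through the series that
  represent the separate pieces, and the identity theorem carries the real identity into the strip d
  < Re s < 2 without the point 1. In that strip Gamma(2 - s) has neither poles nor zeros. The
  exponent d has to lie strictly between 0 and Re \<rho>, so an exponent \<theta> that is too small
  is first replaced by a larger one. A nontrivial zero is also what makes \<open>zeta_Theta\<close>
  the supremum of a nonempty set.\<close>

lemma riemann_zeta_sums:
  "Re s > 1 \<Longrightarrow> (\<lambda>n. 1 / of_nat (Suc n) powr s) sums riemann_zeta s"
  using zeta_continuation_riemann_zeta by (simp add: zeta_continuation_def)

lemma holomorphic_riemann_zeta: "riemann_zeta holomorphic_on (-{1})"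
  using zeta_continuation_riemann_zeta by (simp add: zeta_continuation_def)

text \<open>With y = x(1 - x) the Bernoulli polynomial B_5 factors as y (x - 1/2) (y + 1/3). The
  product of the first two factors stays below 1/20 and the last one below 7/12.\<close>

lemma abs_bernoulli_poly_5_le:
  fixes x :: real
  assumes "0 \<le> x" "x \<le> 1"
  shows "\<bar>x ^ 5 - 5/2 * x ^ 4 + 5/3 * x ^ 3 - x / 6\<bar> \<le> 3 / 100"
proof -
  define y where "y = x * (1 - x)"
  have y0: "0 \<le> y" using assms by (simp add: y_def)
  have y4: "1/4 - y = (x - 1/2)\<^sup>2" by (simp add: y_def power2_eq_square field_simps)
  hence y1: "y \<le> 1/4" using zero_le_power2[of "x - 1/2"] by linarith
  have "(y * (x - 1/2))\<^sup>2 = y\<^sup>2 * (1/4 - y)" by (simp add: y4 power_mult_distrib)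
  also have "\<dots> \<le> (1/20)\<^sup>2"
  proof -
    \<comment> \<open>On y >= 0 the cubic y^2 (1/4 - y) has its maximum 1/432 at y = 1/6, hence the
      double root there; 1/432 < 1/400.\<close>
    have "0 \<le> (y - 1/6)\<^sup>2 * (y + 1/12)" using y0 by simp
    also have "\<dots> = y ^ 3 - y\<^sup>2 / 4 + 1 / 432"
      by (simp add: power2_eq_square power3_eq_cube field_simps)
    finally show ?thesis by (simp add: right_diff_distrib power2_eq_square power3_eq_cube)
  qed
  finally have "\<bar>y * (x - 1/2)\<bar> \<le> 1/20" by (simp add: power2_le_iff_abs_le)
  moreover have "\<bar>y + 1/3\<bar> \<le> 7/12" using y0 y1 by simp
  ultimately have "\<bar>y * (x - 1/2)\<bar> * \<bar>y + 1/3\<bar> \<le> 1/20 * (7/12)"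
    by (intro mult_mono) auto
  also have "\<bar>y * (x - 1/2)\<bar> * \<bar>y + 1/3\<bar> = \<bar>x ^ 5 - 5/2 * x ^ 4 + 5/3 * x ^ 3 - x / 6\<bar>"
    unfolding abs_mult[symmetric] y_def
    by (rule arg_cong[where f = abs]) (simp add: field_simps power_numeral_reduce)
  finally show ?thesis by simp
qed

text \<open>
  The sums of Bernoulli polynomials times derivatives below telescope under differentiation, so
  the mean value inequality replaces the usual repeated integration by parts.
\<close>

lemma euler_maclaurin_step:
  fixes D :: "nat \<Rightarrow> complex \<Rightarrow> complex" and m :: real
  defines "S \<equiv> closed_segment (of_real m) (of_real (m + 1))"
  assumes D: "\<And>j z. z \<in> S \<Longrightarrow> (D j has_field_derivative D (Suc j) z) (at z)"
    and M: "\<And>z. z \<in> S \<Longrightarrow> norm (D 6 z) \<le> M"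
  shows "norm (D 0 (of_real (m + 1)) - D 0 (of_real m)
      - (D 1 (of_real m) + D 1 (of_real (m + 1))) / 2
      + (D 2 (of_real (m + 1)) - D 2 (of_real m)) / 12
      - (D 4 (of_real (m + 1)) - D 4 (of_real m)) / 720) \<le> M / 4000"
proof -
  define w where "w = (\<lambda>z::complex. z - of_real m)"
  \<comment> \<open>\<open>b k\<close> is B_k(w) / k!, so each entry of the list is the derivative
    of the next.\<close>
  define b where "b = (\<lambda>k z. [1, w z - 1/2, ((w z)^2 - w z + 1/6) / 2,
     ((w z)^3 - 3/2 * (w z)^2 + w z / 2) / 6, ((w z)^4 - 2 * (w z)^3 + (w z)^2 - 1/30) / 24,
     ((w z)^5 - 5/2 * (w z)^4 + 5/3 * (w z)^3 - w z / 6) / 120] ! k)"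
  define H where "H = (\<lambda>z. b 0 z * D 0 z - b 1 z * D 1 z + b 2 z * D 2 z - b 3 z * D 3 z + b 4 z * D 4 z - b 5 z * D 5 z)"
  define H' where "H' = (\<lambda>z. - (b 5 z * D 6 z))"
  have "norm (H (of_real (m + 1)) - H (of_real m)) \<le> M / 4000 * norm (of_real (m + 1) - of_real m :: complex)"
  proof (rule field_differentiable_bound)
    show "convex S" by (simp add: S_def)
    show "(H has_field_derivative H' z) (at z within S)" if z: "z \<in> S" for z
    proof -
      have db: "(b 0 has_field_derivative 0) (at z)" "(b 1 has_field_derivative b 0 z) (at z)"
        "(b 2 has_field_derivative b 1 z) (at z)" "(b 3 has_field_derivative b 2 z) (at z)"
        "(b 4 has_field_derivative b 3 z) (at z)" "(b 5 has_field_derivative b 4 z) (at z)"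
        unfolding b_def w_def
        by (auto intro!: derivative_eq_intros simp: field_simps eval_nat_numeral)
      have dD: "(D 0 has_field_derivative D 1 z) (at z)" "(D 1 has_field_derivative D 2 z) (at z)"
        "(D 2 has_field_derivative D 3 z) (at z)" "(D 3 has_field_derivative D 4 z) (at z)"
        "(D 4 has_field_derivative D 5 z) (at z)" "(D 5 has_field_derivative D 6 z) (at z)"
        using D[OF z, of 0] D[OF z, of 1] D[OF z, of 2] D[OF z, of 3] D[OF z, of 4] D[OF z, of 5]
        by (simp_all add: eval_nat_numeral)
      have "b 0 z = 1" by (simp add: b_def)
      hence "(H has_field_derivative H' z) (at z)"
        unfolding H_def H'_def
        by (auto intro!: derivative_eq_intros db dD simp: algebra_simps simp del: One_nat_def)
      thus ?thesis by (rule has_field_derivative_at_within)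
    qed
    show "norm (H' z) \<le> M / 4000" if z: "z \<in> S" for z
    proof -
      obtain u where u: "0 \<le> u" "u \<le> 1" "z = (1 - u) *\<^sub>R of_real m + u *\<^sub>R of_real (m + 1)"
        using z unfolding S_def closed_segment_def by blast
      hence w: "w z = of_real u"
        by (simp add: w_def scaleR_conv_of_real algebra_simps)
      have "b 5 z = of_real (u ^ 5 - 5/2 * u ^ 4 + 5/3 * u ^ 3 - u / 6) / 120"
        unfolding b_def w by simp
      hence "norm (H' z) = \<bar>u ^ 5 - 5/2 * u ^ 4 + 5/3 * u ^ 3 - u / 6\<bar> / 120 * norm (D 6 z)"
        unfolding H'_def by (simp only: norm_minus_cancel norm_mult norm_divide norm_of_real) simp
      \<comment> \<open>The bound 3/100 for B_5, divided by 5! = 120, is the origin of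
        1/4000.\<close>
      also have "\<dots> \<le> 3 / 100 / 120 * M"
        using abs_bernoulli_poly_5_le[OF u(1,2)] M[OF z]
        by (intro mult_mono divide_right_mono) auto
      finally show ?thesis by simp
    qed
  qed (auto simp: S_def)
  \<comment> \<open>B_3 and B_5 vanish at both endpoints, so the terms in \<open>D 3\<close> and
    \<open>D 5\<close> disappear; 1/12 and -1/720 are the common endpoint values of
    \<open>b 2\<close> and \<open>b 4\<close>.\<close>
  moreover have "H (of_real (m + 1)) - H (of_real m) = D 0 (of_real (m + 1)) - D 0 (of_real m)
      - (D 1 (of_real m) + D 1 (of_real (m + 1))) / 2
      + (D 2 (of_real (m + 1)) - D 2 (of_real m)) / 12
      - (D 4 (of_real (m + 1)) - D 4 (of_real m)) / 720"
    unfolding H_def b_def w_def by (simp add: field_simps)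
  ultimately show ?thesis by simp
qed

text \<open>This is the j-th derivative in z of z^(1-s) / (1-s), an antiderivative of
  z^(-s).\<close>

definition em_deriv :: "complex \<Rightarrow> nat \<Rightarrow> complex \<Rightarrow> complex" where
  "em_deriv s j z = falling_fact (1 - s) j / (1 - s) * z powr (1 - s - of_nat j)"

text \<open>The Euler-Maclaurin approximation to the sum of k^(-s) over k >= n. The first term k = n
  is included, whence the plus sign of the half term.\<close>

definition em_tail :: "complex \<Rightarrow> nat \<Rightarrow> complex" where
  "em_tail s n = - em_deriv s 0 (of_nat n) + em_deriv s 1 (of_nat n) / 2
     - em_deriv s 2 (of_nat n) / 12 + em_deriv s 4 (of_nat n) / 720"

text \<open>An exact tail would drop by n^(-s) from n to n + 1; this is the failure of
  \<open>em_tail\<close> to do so.\<close>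

definition em_err :: "complex \<Rightarrow> nat \<Rightarrow> complex" where
  "em_err s n = em_tail s n - em_tail s (Suc n) - of_nat n powr (- s)"

text \<open>The modulus of the coefficient of z^(-s-5) in the sixth derivative of z^(1-s) /
  (1-s).\<close>

definition em_const :: "complex \<Rightarrow> real" where
  "em_const s = norm (s * (s + 1) * (s + 2) * (s + 3) * (s + 4))"

text \<open>Since \<open>em_deriv s 1\<close> is z^(-s), the expression estimated by
  \<open>euler_maclaurin_step\<close> on [n, n+1] is exactly \<open>em_err s n\<close>, and the
  sixth derivative is largest in modulus at the left endpoint.\<close>

lemma norm_em_err_le:
  assumes n: "n > 0" and s: "Re s > 0" "s \<noteq> 1"
  shows "norm (em_err s n) \<le> em_const s / 4000 * real n powr (- Re s - 5)"
proof -
  define S where "S = closed_segment (of_real (real n) :: complex) (of_real (real n + 1))"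
  have S: "\<exists>t. z = of_real t \<and> t \<ge> real n" if "z \<in> S" for z
    using that closed_segment_of_real[of "real n" "real n + 1"]
    unfolding S_def by (fastforce simp: closed_segment_eq_real_ivl simp del: of_real_of_nat_eq of_real_add)
  have "norm (em_deriv s 0 (of_real (real n + 1)) - em_deriv s 0 (of_real (real n))
      - (em_deriv s 1 (of_real (real n)) + em_deriv s 1 (of_real (real n + 1))) / 2
      + (em_deriv s 2 (of_real (real n + 1)) - em_deriv s 2 (of_real (real n))) / 12
      - (em_deriv s 4 (of_real (real n + 1)) - em_deriv s 4 (of_real (real n))) / 720)
      \<le> (em_const s * real n powr (- Re s - 5)) / 4000"
  proof (rule euler_maclaurin_step)
    fix z assume "z \<in> closed_segment (of_real (real n) :: complex) (of_real (real n + 1))"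
    then obtain t where t: "z = of_real t" "t \<ge> real n" using S unfolding S_def by blast
    have "z \<notin> \<real>\<^sub>\<le>\<^sub>0" using t n by auto
    hence deriv: "((\<lambda>z. falling_fact (1 - s) j / (1 - s) * z powr (1 - s - of_nat j)) has_field_derivative
       falling_fact (1 - s) j / (1 - s) * ((1 - s - of_nat j) * z powr (1 - s - of_nat j - 1))) (at z)" for j
      by (intro DERIV_cmult has_field_derivative_powr)
    have "1 - s - of_nat (Suc j) = 1 - s - of_nat j - 1" for j by simp
    hence eq: "em_deriv s (Suc j) z =
        falling_fact (1 - s) j / (1 - s) * ((1 - s - of_nat j) * z powr (1 - s - of_nat j - 1))" for j
      unfolding em_deriv_def falling_fact_Suc by simp
    show "(em_deriv s j has_field_derivative em_deriv s (Suc j) z) (at z)" for j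
      unfolding eq using deriv[of j] unfolding em_deriv_def[abs_def] .
    have "falling_fact (1 - s) 6 = (1 - s) * (- (s * (s + 1) * (s + 2) * (s + 3) * (s + 4)))"
    proof -
      have "1 - s - of_nat (Suc j) = - (s + of_nat j)" for j by simp
      hence "falling_fact (1 - s) (Suc (Suc j)) = - (falling_fact (1 - s) (Suc j) * (s + of_nat j))" for j
        by (subst falling_fact_Suc) (simp add: algebra_simps)
      note this[of 0] this[of 1] this[of 2] this[of 3] this[of 4]
      moreover have "falling_fact (1 - s) 1 = 1 - s" by (simp add: falling_fact_def)
      ultimately show ?thesis by (simp add: numeral_eq_Suc mult.assoc)
    qed
    hence "falling_fact (1 - s) 6 / (1 - s) = - (s * (s + 1) * (s + 2) * (s + 3) * (s + 4))"
      using s(2) by simp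
    hence "norm (em_deriv s 6 z) = em_const s * norm (z powr (1 - s - of_nat 6))"
      unfolding em_deriv_def em_const_def by (simp only: norm_mult norm_minus_cancel)
    also have "norm (z powr (1 - s - of_nat 6)) = t powr (- Re s - 5)"
      using t n by (subst norm_powr_real_powr) (auto simp: algebra_simps)
    also have "\<dots> \<le> real n powr (- Re s - 5)" using t n s by (intro powr_mono2') auto
    finally show "norm (em_deriv s 6 z) \<le> em_const s * real n powr (- Re s - 5)"
      by (simp add: em_const_def mult_left_mono)
  qed
  also have "em_deriv s 1 (of_real (real n)) = of_nat n powr (- s)"
    using s by (simp add: em_deriv_def falling_fact_def)
  hence "em_deriv s 0 (of_real (real n + 1)) - em_deriv s 0 (of_real (real n))
      - (em_deriv s 1 (of_real (real n)) + em_deriv s 1 (of_real (real n + 1))) / 2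
      + (em_deriv s 2 (of_real (real n + 1)) - em_deriv s 2 (of_real (real n))) / 12
      - (em_deriv s 4 (of_real (real n + 1)) - em_deriv s 4 (of_real (real n))) / 720 = em_err s n"
    unfolding em_err_def em_tail_def by (simp add: field_simps)
  finally show ?thesis by simp
qed

text \<open>Integral test in telescoping form: 1/m^5 <= 1/(4 (m-1)^4) - 1/(4 m^4), where m = N +
  k.\<close>

lemma sum_inverse_fifth_powers_le:
  assumes "N \<ge> 2"
  shows "summable (\<lambda>k. 1 / real (N + k) ^ 5)" "(\<Sum>k. 1 / real (N + k) ^ 5) \<le> 1 / (4 * real (N - 1) ^ 4)"
proof -
  define T where "T = (\<lambda>k. - (1 / (4 * real (N + k - 1) ^ 4)))"
  have "(\<lambda>k. 1 / (4 * (real N + real k - 1) ^ 4)) \<longlonglongrightarrow> 0" by real_asymp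
  hence "T \<longlonglongrightarrow> - 0" unfolding T_def using assms by (intro tendsto_minus) (simp add: of_nat_diff)
  hence t: "(\<lambda>k. T (Suc k) - T k) sums (1 / (4 * real (N - 1) ^ 4))"
    using telescope_sums[of T 0] by (simp add: T_def)
  have le: "1 / real (N + k) ^ 5 \<le> T (Suc k) - T k" for k
  proof -
    obtain j where j: "N + k = Suc j" "j > 0" using assms
      by (metis Suc_le_D add_leD1 le_add1 nat_less_le not_less_eq_eq numeral_2_eq_2 order_trans zero_le)
    define x where "x = real j"
    have x: "x > 0" using j by (simp add: x_def)
    have "4 * x ^ 4 \<le> (x + 1) * ((x + 1) ^ 4 - x ^ 4)"
      using x by (simp add: algebra_simps eval_nat_numeral)
    hence "4 * x ^ 4 / ((x + 1) * (4 * x ^ 4 * (x + 1) ^ 4))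
             \<le> (x + 1) * ((x + 1) ^ 4 - x ^ 4) / ((x + 1) * (4 * x ^ 4 * (x + 1) ^ 4))"
      using x by (intro divide_right_mono) auto
    also have "4 * x ^ 4 / ((x + 1) * (4 * x ^ 4 * (x + 1) ^ 4)) = 1 / (x + 1) ^ 5"
      using x power_Suc[of "x + 1" 4] by simp
    finally have "1 / (x + 1) ^ 5 \<le> ((x + 1) ^ 4 - x ^ 4) / (4 * x ^ 4 * (x + 1) ^ 4)"
      using x by simp
    also have "\<dots> = 1 / (4 * x ^ 4) - 1 / (4 * (x + 1) ^ 4)"
      using x by (simp add: field_simps)
    finally show ?thesis unfolding T_def using j by (simp add: x_def add.commute)
  qed
  show sm: "summable (\<lambda>k. 1 / real (N + k) ^ 5)"
    by (rule summable_comparison_test'[OF sums_summable[OF t], of 0]) (use le in auto)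
  show "(\<Sum>k. 1 / real (N + k) ^ 5) \<le> 1 / (4 * real (N - 1) ^ 4)"
    using suminf_le[OF le sm sums_summable[OF t]] t by (simp add: sums_iff)
qed

text \<open>Splitting off the fifth power leaves a summable factor independent of s, so the same
  majorant serves every s with positive real part.\<close>

lemma norm_em_err_le':
  assumes s: "Re s > 0" "s \<noteq> 1" and N: "N > 0"
  shows "norm (em_err s (N + k)) \<le> em_const s / 4000 * real N powr (- Re s) * (1 / real (N + k) ^ 5)"
proof -
  have "norm (em_err s (N + k)) \<le> em_const s / 4000 * real (N + k) powr (- Re s - 5)"
    using assms by (intro norm_em_err_le) auto
  also have "real (N + k) powr (- Re s - 5) = real (N + k) powr (- Re s) * (1 / real (N + k) ^ 5)"
    using N by (simp add: powr_diff powr_numeral)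
  also have "\<dots> \<le> real N powr (- Re s) * (1 / real (N + k) ^ 5)"
    using N s by (intro mult_right_mono powr_mono2') auto
  finally show ?thesis by (simp add: em_const_def mult_left_mono mult.assoc)
qed

lemma suminf_em_err_le:
  assumes "Re s > 0" "s \<noteq> 1" "N \<ge> 2"
  shows "norm (\<Sum>k. em_err s (N + k)) \<le> em_const s / 4000 * real N powr (- Re s) / (4 * real (N - 1) ^ 4)"
proof -
  note sm = summable_mult[OF sum_inverse_fifth_powers_le(1)[OF assms(3)]]
  have "norm (\<Sum>k. em_err s (N + k)) \<le> (\<Sum>k. em_const s / 4000 * real N powr (- Re s) * (1 / real (N + k) ^ 5))"
    using assms by (intro norm_suminf_le norm_em_err_le' sm) auto
  also have "\<dots> = em_const s / 4000 * real N powr (- Re s) * (\<Sum>k. 1 / real (N + k) ^ 5)"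
    by (rule suminf_mult[OF sum_inverse_fifth_powers_le(1)[OF assms(3)]])
  also have "\<dots> \<le> em_const s / 4000 * real N powr (- Re s) * (1 / (4 * real (N - 1) ^ 4))"
    by (intro mult_left_mono sum_inverse_fifth_powers_le assms) (auto simp: em_const_def)
  finally show ?thesis by simp
qed

lemma holomorphic_em_tail: "(\<lambda>s. em_tail s n) holomorphic_on (-{1})"
  unfolding em_tail_def em_deriv_def falling_fact_def by (intro holomorphic_intros) auto

lemma holomorphic_suminf_em_err:
  assumes N: "N \<ge> 2"
  shows "(\<lambda>s. \<Sum>k. em_err s (N + k)) holomorphic_on ({s. Re s > 0} - {1})"
proof (rule holomorphic_on_suminf)
  show op: "open ({s. Re s > 0} - {1})" by (intro open_delete open_halfspace_Re_gt)
  show "(\<lambda>s. em_err s (N + n)) holomorphic_on ({s. Re s > 0} - {1})" for n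
    unfolding em_err_def
    by (intro holomorphic_intros holomorphic_on_subset[OF holomorphic_em_tail]) auto
  fix z assume "z \<in> {s. Re s > 0} - {1}"
  then obtain d where d: "d > 0" "cball z d \<subseteq> {s. Re s > 0} - {1}"
    using op open_contains_cball by blast
  have "compact (em_const ` cball z d)"
    unfolding em_const_def by (intro compact_continuous_image continuous_intros) auto
  then obtain C where C: "\<And>w. w \<in> cball z d \<Longrightarrow> norm (em_const w) \<le> C"
    by (metis bounded_iff compact_imp_bounded image_eqI)
  have "norm (em_err w (N + n)) \<le> C / 4000 * (1 / real (N + n) ^ 5)" if w: "w \<in> cball z d" for w n
  proof -
    have "norm (em_err w (N + n)) \<le> em_const w / 4000 * real N powr (- Re w) * (1 / real (N + n) ^ 5)"
      using d w N by (intro norm_em_err_le') auto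
    also have "\<dots> \<le> C / 4000 * 1 * (1 / real (N + n) ^ 5)"
    proof (intro mult_mono divide_right_mono)
      show "em_const w \<le> C" using C[OF w] by (auto simp: em_const_def)
      have "real N powr (- Re w) \<le> 1 powr (- Re w)" using d w N by (intro powr_mono2') auto
      thus "real N powr (- Re w) \<le> 1" by simp
    qed (use order_trans[OF norm_ge_zero C[OF w]] in \<open>auto simp: em_const_def\<close>)
    finally show ?thesis by simp
  qed
  thus "\<exists>d M. 0 < d \<and> cball z d \<subseteq> {s. Re s > 0} - {1} \<and> summable M \<and>
               (\<forall>n. \<forall>w\<in>cball z d. norm (em_err w (N + n)) \<le> M n)"
    using d summable_mult[OF sum_inverse_fifth_powers_le(1)[OF N]] by blast
qed

lemma em_tail_tendsto_0:
  assumes "Re s > 1"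
  shows "em_tail s \<longlonglongrightarrow> 0"
proof -
  have "(\<lambda>n. em_deriv s j (of_nat n)) \<longlonglongrightarrow> 0" for j
    unfolding em_deriv_def
  proof (rule tendsto_mult_right_zero, rule tendsto_norm_zero_cancel)
    have "(\<lambda>n. real n powr (1 - Re s - real j)) \<longlonglongrightarrow> 0"
      using assms by (intro tendsto_neg_powr filterlim_real_sequentially) auto
    moreover have "eventually (\<lambda>n. norm (of_nat n powr (1 - s - of_nat j) :: complex) = real n powr (1 - Re s - real j)) sequentially"
      using eventually_gt_at_top[of 0] by eventually_elim (subst norm_powr_real_powr, auto)
    ultimately show "(\<lambda>n. norm (of_nat n powr (1 - s - of_nat j) :: complex)) \<longlonglongrightarrow> 0"
      using tendsto_cong by fast
  qed
  hence "em_tail s \<longlonglongrightarrow> - 0 + 0 / 2 - 0 / 12 + 0 / 720"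
    unfolding em_tail_def by (intro tendsto_intros) auto
  thus ?thesis by simp
qed

text \<open>For Re s > 1 the errors telescope to the difference between \<open>em_tail s N\<close>
  and the true tail of the Dirichlet series. Both sides are holomorphic on the connected set Re s >
  0 without 1, so the identity persists there.\<close>

theorem riemann_zeta_euler_maclaurin:
  assumes N: "N \<ge> 2" and s: "Re s > 0" "s \<noteq> 1"
  shows "riemann_zeta s = (\<Sum>n=1..<N. of_nat n powr (- s)) + em_tail s N - (\<Sum>k. em_err s (N + k))"
proof (rule analytic_continuation_open[where s = "{s. Re s > 1}" and s' = "{s. Re s > 0} - {1}"
    and f = riemann_zeta and z = s])
  show "{s. Re s > 1} \<noteq> {}" by (auto intro!: exI[of _ 2])
  show "connected ({s. Re s > 0} - {1::complex})"
    by (intro connected_open_delete) (auto simp: open_halfspace_Re_gt convex_connected convex_halfspace_Re_gt)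
  show "riemann_zeta holomorphic_on {s. Re s > 0} - {1}"
    by (rule holomorphic_on_subset[OF holomorphic_riemann_zeta]) auto
  show "(\<lambda>s. (\<Sum>n=1..<N. of_nat n powr (- s)) + em_tail s N - (\<Sum>k. em_err s (N + k)))
          holomorphic_on {s. Re s > 0} - {1}"
    by (intro holomorphic_intros holomorphic_suminf_em_err N
          holomorphic_on_subset[OF holomorphic_em_tail]) auto
  show "riemann_zeta z = (\<Sum>n=1..<N. of_nat n powr (- z)) + em_tail z N - (\<Sum>k. em_err z (N + k))"
    if "z \<in> {s. Re s > 1}" for z
  proof -
    have z: "Re z > 1" using that by simp
    hence z1: "z \<noteq> 1" by auto
    have "(\<lambda>n. of_nat (Suc n) powr (- z)) sums riemann_zeta z"
      using riemann_zeta_sums[OF z] by (simp add: powr_minus divide_simps)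
    hence "(\<lambda>k. of_nat (Suc (k + (N - 1))) powr (- z)) sums
             (riemann_zeta z - (\<Sum>n<N-1. of_nat (Suc n) powr (- z)))"
      by (rule sums_split_initial_segment)
    also have "(\<Sum>n<N-1. of_nat (Suc n) powr (- z)) = (\<Sum>n=1..<N. of_nat n powr (- z) :: complex)"
      by (rule sum.reindex_bij_witness[of _ "\<lambda>n. n - 1" Suc]) (use N in auto)
    also have "(\<lambda>k. of_nat (Suc (k + (N - 1))) powr (- z)) = (\<lambda>k. of_nat (N + k) powr (- z) :: complex)"
      using N by (auto simp: add_ac)
    finally have 1: "(\<lambda>k. of_nat (N + k) powr (- z)) sums (riemann_zeta z - (\<Sum>n=1..<N. of_nat n powr (- z)))" .
    have "(\<lambda>k. em_tail z (N + k) - em_tail z (Suc (N + k))) sums em_tail z N"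
      using telescope_sums'[OF LIMSEQ_ignore_initial_segment[OF em_tail_tendsto_0[OF z], of N]]
      by (simp add: add.commute)
    from sums_diff[OF this 1] have "(\<lambda>k. em_err z (N + k)) sums
        (em_tail z N - (riemann_zeta z - (\<Sum>n=1..<N. of_nat n powr (- z))))"
      by (simp only: em_err_def)
    thus ?thesis by (simp add: sums_iff)
  qed
qed (use s in \<open>auto simp: open_halfspace_Re_gt open_delete\<close>)

section \<open>A nontrivial zero\<close>

text \<open>The first nontrivial zero is \<open>1/2 + 14.134725... i\<close>.\<close>

definition zero_approx :: complex where
  "zero_approx = Complex (1 / 2) (2827 / 200)"

lemma norm_zero_approx_add_le:
  assumes "(a + 1 / 2)\<^sup>2 + (2827 / 200)\<^sup>2 \<le> b\<^sup>2" "0 \<le> b"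
  shows "norm (zero_approx + of_real a) \<le> b"
  using assms unfolding zero_approx_def cmod_def
  by (intro real_le_lsqrt) (auto simp: add.commute)

section \<open>Evaluation of complex exponentials with rational error bounds\<close>

lemma norm_exp_minus_linear_le:
  fixes z :: complex
  assumes "norm z \<le> 1 / 8"
  shows "norm (exp z - 1 - z) \<le> 3 / 5 * norm z ^ 2"
proof -
  have e: "exp (norm z) \<le> 5 / 4" using assms real_exp_bound_lemma[of "norm z"] by simp
  have "norm (exp z - 1 - z) = norm ((exp z - (\<Sum>i\<le>2. z ^ i / fact i)) + z ^ 2 / 2)"
    by (simp add: eval_nat_numeral algebra_simps)
  also have "\<dots> \<le> norm (exp z - (\<Sum>i\<le>2. z ^ i / fact i)) + norm z ^ 2 / 2"
    by (rule norm_triangle_le) (simp add: norm_divide norm_power)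
  also have "norm (exp z - (\<Sum>i\<le>2. z ^ i / fact i)) \<le> exp (norm z) * norm z ^ Suc 2 / fact 2"
    by (rule Taylor_exp_field)
  also have "\<dots> \<le> 5 / 4 * norm z ^ Suc 2 / fact 2"
    using e by (intro divide_right_mono mult_right_mono) auto
  also have "\<dots> = 5 / 8 * norm z * norm z ^ 2" by (simp add: power2_eq_square power3_eq_cube)
  \<comment> \<open>The constant 3/5 in the claim comes from 1/2 + 5/64 < 3/5.\<close>
  also have "\<dots> \<le> 5 / 8 * (1 / 8) * norm z ^ 2"
    using assms by (intro mult_right_mono mult_left_mono) auto
  finally show ?thesis using zero_le_power2[of "norm z"] by linarith
qed

lemma norm_Complex_diff_le:
  "norm (z - Complex a b) \<le> \<bar>Re z - a\<bar> + \<bar>Im z - b\<bar>"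
  using cmod_le[of "z - Complex a b"] by simp

text \<open>\<open>h\<close> is the Taylor polynomial of degree 8 in Horner form, a shape that
  simplification evaluates by rational arithmetic. The radius 11/25 covers
  \<open>zero_approx\<close> times ln p / 64 for p <= 7, and there the remainder is below 4/10^8.
  The exponent 1 makes the conclusion a starting point for \<open>approx_square\<close>.\<close>

lemma exp_taylor_approx:
  fixes a b :: real
  defines "y \<equiv> Complex a b"
  defines "h \<equiv> Complex 1 0 + y * (Complex 1 0 + (1 / 2) *\<^sub>R (y * (Complex 1 0 + (1 / 3) *\<^sub>R (y *
     (Complex 1 0 + (1 / 4) *\<^sub>R (y * (Complex 1 0 + (1 / 5) *\<^sub>R (y * (Complex 1 0 + (1 / 6) *\<^sub>R (y *
     (Complex 1 0 + (1 / 7) *\<^sub>R (y * (Complex 1 0 + (1 / 8) *\<^sub>R y)))))))))))))"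
  assumes "a * a + b * b \<le> 121 / 625"
    and "\<bar>Re h - u\<bar> + \<bar>Im h - v\<bar> + 4 / 10 ^ 8 \<le> d"
  shows "norm (exp y ^ 1 - Complex u v) \<le> d"
proof -
  have n: "norm y \<le> 11 / 25"
    unfolding y_def cmod_def using assms(3) by (intro real_le_lsqrt) (auto simp: power2_eq_square)
  have one: "Complex 1 0 = 1" by (simp add: complex_eq_iff)
  have "h = (\<Sum>i\<le>8. y ^ i / fact i)"
    unfolding h_def one by (simp add: numeral_eq_Suc fact_numeral scaleR_conv_of_real field_simps)
  hence "norm (exp y - h) \<le> exp (norm y) * norm y ^ Suc 8 / fact 8"
    using Taylor_exp_field[of y 8] by simp
  also have "\<dots> \<le> 2 * (11 / 25) ^ Suc 8 / fact 8"
    using n real_exp_bound_lemma[of "norm y"] by (intro divide_right_mono mult_mono power_mono) auto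
  also have "\<dots> \<le> 4 / 10 ^ 8" by (simp add: fact_numeral power_divide)
  finally have "norm (exp y - h) \<le> 4 / 10 ^ 8" .
  moreover have "norm (exp y - Complex u v) \<le> norm (exp y - h) + norm (h - Complex u v)"
    using norm_triangle_ineq[of "exp y - h" "h - Complex u v"] by simp
  ultimately show ?thesis using norm_Complex_diff_le[of h u v] assms(4) by simp
qed

text \<open>In the split z w - r t = z (w - t) + t (z - r) with r = a + ib and t = p + iq, the
  multipliers z and t have modulus at most 1, so the input errors merely add. The two remaining
  summands pay for rounding r t to u + iv.\<close>

lemma approx_mult:
  assumes z: "norm (z - Complex a b) \<le> d1" and w: "norm (w - Complex p q) \<le> d2"
    and "norm z \<le> 1" "p * p + q * q \<le> 1"
    and d: "d1 + d2 + \<bar>a * p - b * q - u\<bar> + \<bar>a * q + b * p - v\<bar> \<le> d"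
  shows "norm (z * w - Complex u v) \<le> d"
proof -
  have "norm (Complex p q) \<le> 1" using assms(4) by (simp add: cmod_def power2_eq_square)
  hence "norm (Complex p q) * norm (z - Complex a b) \<le> 1 * d1"
    using z by (intro mult_mono) auto
  moreover have "norm z * norm (w - Complex p q) \<le> 1 * d2"
    using assms(3) w by (intro mult_mono) auto
  moreover have "z * w - Complex u v = z * (w - Complex p q) + Complex p q * (z - Complex a b)
      + (Complex a b * Complex p q - Complex u v)" by (simp add: algebra_simps)
  hence "norm (z * w - Complex u v) \<le> norm z * norm (w - Complex p q)
      + norm (Complex p q) * norm (z - Complex a b) + norm (Complex a b * Complex p q - Complex u v)"
    by (metis (no_types, lifting) norm_mult norm_triangle_le norm_triangle_mono order_refl)
  moreover have "norm (Complex a b * Complex p q - Complex u v) \<le> \<bar>a * p - b * q - u\<bar> + \<bar>a * q + b * p - v\<bar>"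
    using norm_Complex_diff_le[of "Complex a b * Complex p q" u v] by simp
  ultimately show ?thesis using d by linarith
qed

text \<open>Factoring the difference of two squares shows that the error about doubles, plus the
  rounding to u + iv. The exponent relation is a separate hypothesis so that exponents remain
  numerals.\<close>

lemma approx_square:
  assumes z: "norm (z ^ k - Complex a b) \<le> d" and "a * a + b * b \<le> 1" "l = 2 * k"
    and d: "2 * d + d * d + \<bar>a * a - b * b - u\<bar> + \<bar>2 * a * b - v\<bar> \<le> d'"
  shows "norm (z ^ l - Complex u v) \<le> d'"
proof -
  define w where "w = z ^ k"
  have n: "norm (Complex a b) \<le> 1" using assms(2) by (simp add: cmod_def power2_eq_square)
  have d0: "0 \<le> d" using z norm_ge_zero order_trans by blast
  have "norm (w + Complex a b) \<le> norm (w - Complex a b) + 2 * norm (Complex a b)"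
    using norm_triangle_ineq[of "w - Complex a b" "2 * Complex a b"] by (simp add: norm_mult add.commute)
  hence "norm (w + Complex a b) \<le> d + 2" using z n by (simp add: w_def)
  hence "norm (w - Complex a b) * norm (w + Complex a b) \<le> d * (d + 2)"
    using z d0 by (intro mult_mono) (auto simp: w_def)
  moreover have "z ^ l = w * w" by (simp add: w_def assms(3) mult_2 power_add)
  hence "z ^ l - Complex u v = (w - Complex a b) * (w + Complex a b)
      + (Complex a b * Complex a b - Complex u v)" by (simp add: algebra_simps)
  hence "norm (z ^ l - Complex u v) \<le> norm (w - Complex a b) * norm (w + Complex a b)
      + norm (Complex a b * Complex a b - Complex u v)"
    by (metis norm_mult norm_triangle_ineq)
  moreover have "norm (Complex a b * Complex a b - Complex u v) \<le> \<bar>a * a - b * b - u\<bar> + \<bar>2 * a * b - v\<bar>"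
    using norm_Complex_diff_le[of "Complex a b * Complex a b" u v] by (simp add: mult_ac)
  ultimately show ?thesis using d by (simp add: algebra_simps)
qed

text \<open>Replacing ln p by 64 m changes the exponent by at most 14.2/10^6. As p^(-c) has modulus
  at most 1 for c = \<open>zero_approx\<close>, this costs less than 3/10^5.\<close>

lemma powr_approx_of_exp:
  fixes p :: nat and m :: real
  assumes e: "norm (exp (- (zero_approx * of_real m)) ^ 64 - w) \<le> d"
    and p: "p \<ge> 1" and m: "\<bar>ln (real p) - 64 * m\<bar> \<le> 1 / 10 ^ 6"
    and d: "d + 3 / 10 ^ 5 \<le> d'"
  shows "norm (of_nat p powr (- zero_approx) - w) \<le> d'"
proof -
  define h where "h = zero_approx * of_real (ln (real p) - 64 * m)"
  have z: "norm zero_approx \<le> 142 / 10"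
    using norm_zero_approx_add_le[of 0 "142 / 10"] by (simp add: power2_eq_square)
  have "norm h \<le> 142 / 10 * (1 / 10 ^ 6)"
    unfolding h_def norm_mult norm_of_real using z m by (intro mult_mono) auto
  hence h: "norm h \<le> 142 / 10 ^ 7" by simp
  have powr: "of_nat p powr (- zero_approx) = exp (- (zero_approx * of_real (ln (real p))))"
    using p Ln_of_real[of "real p"] by (simp add: powr_def)
  have "norm (of_nat p powr (- zero_approx) :: complex) = real p powr (- (1 / 2))"
    using p by (subst norm_powr_real_powr) (auto simp: zero_approx_def)
  also have "\<dots> \<le> 1 powr (- (1 / 2))" using p by (intro powr_mono2') auto
  finally have n: "norm (of_nat p powr (- zero_approx) :: complex) \<le> 1" by simp
  have "exp (- (zero_approx * of_real m)) ^ 64 = exp (- (zero_approx * of_real (64 * m)))"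
    by (subst exp_of_nat_mult[symmetric]) (simp add: mult_ac)
  also have "\<dots> = exp (- (zero_approx * of_real (ln (real p))) + h)"
    unfolding h_def by (simp add: algebra_simps)
  also have "\<dots> = of_nat p powr (- zero_approx) * exp h" by (simp only: powr exp_add)
  finally have "of_nat p powr (- zero_approx) - exp (- (zero_approx * of_real m)) ^ 64
     = of_nat p powr (- zero_approx) * - ((exp h - 1 - h) + h)" by (simp add: algebra_simps)
  hence "norm (of_nat p powr (- zero_approx) - exp (- (zero_approx * of_real m)) ^ 64)
     = norm (of_nat p powr (- zero_approx) :: complex) * norm ((exp h - 1 - h) + h)"
    by (simp only: norm_mult norm_minus_cancel)
  also have "\<dots> \<le> 1 * (3 / 5 * norm h ^ 2 + norm h)"
    using h n by (intro mult_mono order_trans[OF norm_triangle_ineq] add_right_mono norm_exp_minus_linear_le) auto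
  also have "\<dots> \<le> 3 / 5 * (142 / 10 ^ 7) ^ 2 + 142 / 10 ^ 7"
    unfolding mult_1 using h by (intro add_mono mult_left_mono power_mono) auto
  also have "\<dots> \<le> 3 / 10 ^ 5" by (simp add: power2_eq_square)
  finally have "norm (of_nat p powr (- zero_approx) - exp (- (zero_approx * of_real m)) ^ 64) \<le> 3 / 10 ^ 5" .
  thus ?thesis using e d
    norm_triangle_ineq[of "of_nat p powr (- zero_approx) - exp (- (zero_approx * of_real m)) ^ 64"
      "exp (- (zero_approx * of_real m)) ^ 64 - w"] by simp
qed

section \<open>Rational approximations to the logarithms of 2, 3, 5 and 7\<close>

lemma abs_diff_le_trans:
  fixes x :: real
  shows "\<bar>x - a\<bar> \<le> d \<Longrightarrow> \<bar>a - b\<bar> + d \<le> e \<Longrightarrow> \<bar>x - b\<bar> \<le> e"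
  by linarith

lemma ln_two_bounds: "\<bar>ln (2::real) - (34657359 / 50000000)\<bar> \<le> 3 / 10 ^ (8::nat)"
  by (rule abs_diff_le_trans[OF ln_approx_abs[of 2 7]]) (simp_all add: eval_nat_numeral)

lemma ln_two_approx: "\<bar>ln (real 2) - 64 * (541521 / 50000000)\<bar> \<le> 1 / 10 ^ 6"
  by (rule abs_diff_le_trans[of _ "(34657359 / 50000000)" "3 / 10 ^ 8"]) (use ln_two_bounds in simp_all)

text \<open>The series behind \<open>ln_approx_abs\<close> runs in powers of (x-1)/(x+1) and
  converges fast only near 1. Hence 3, and below 5 and 7, are reached from powers of 2 through the
  ratios 3/2, 5/4 and 8/7.\<close>

lemma ln_three_approx: "\<bar>ln (real 3) - 64 * (858291 / 50000000)\<bar> \<le> 1 / 10 ^ 6"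
proof -
  have "\<bar>ln (3 / 2) - (40546511 / 100000000)\<bar> \<le> (1 / 10 ^ 7 :: real)"
    by (rule abs_diff_le_trans[OF ln_approx_abs[of "3 / 2" 5]]) (simp_all add: eval_nat_numeral)
  moreover have "ln (real 3) = ln 2 + ln (3 / 2)" by (subst ln_mult_pos[symmetric]) auto
  ultimately show ?thesis using ln_two_bounds unfolding abs_le_iff by auto
qed

lemma ln_five_approx: "\<bar>ln (real 5) - 64 * (2514747 / 100000000)\<bar> \<le> 1 / 10 ^ 6"
proof -
  have "\<bar>ln (5 / 4) - (4462871 / 20000000)\<bar> \<le> (1 / 10 ^ 7 :: real)"
    by (rule abs_diff_le_trans[OF ln_approx_abs[of "5 / 4" 3]]) (simp_all add: eval_nat_numeral)
  moreover have "ln (real 5) = ln (2 ^ 2) + ln (5 / 4)" by (subst ln_mult_pos[symmetric]) auto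
  hence "ln (real 5) = 2 * ln 2 + ln (5 / 4)" by (subst (asm) ln_realpow) auto
  ultimately show ?thesis using ln_two_bounds unfolding abs_le_iff by auto
qed

lemma ln_seven_approx: "\<bar>ln (real 7) - 64 * (608097 / 20000000)\<bar> \<le> 1 / 10 ^ 6"
proof -
  have "\<bar>ln (8 / 7) - (13353139 / 100000000)\<bar> \<le> (1 / 10 ^ 7 :: real)"
    by (rule abs_diff_le_trans[OF ln_approx_abs[of "8 / 7" 3]]) (simp_all add: eval_nat_numeral)
  moreover have "ln (2 ^ 3) = ln (real 7) + ln (8 / 7)" by (subst ln_mult_pos[symmetric]) auto
  hence "3 * ln 2 = ln (real 7) + ln (8 / 7)" by (subst (asm) ln_realpow) auto
  ultimately show ?thesis using ln_two_bounds unfolding abs_le_iff by auto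
qed

text \<open>
  The Taylor polynomial of \<open>exp\<close> is evaluated at \<open>- zero_approx * ln p / 64\<close> and the result is squared
  six times, rounding after each step.
\<close>

lemma two_powr_approx:
  "norm (of_nat 2 powr (- zero_approx) - Complex (- 658523 / 1000000) (257581 / 1000000)) \<le> 1 / 25000"
proof -
  define y where "y = Complex (- 541521 / 100000000) (- 1530879867 / 10000000000)"
  have y: "y = - (zero_approx * of_real (541521 / 50000000))"
    by (simp add: y_def zero_approx_def complex_eq_iff)
  have "norm (exp y ^ 1 - Complex (98296749 / 100000000) (- 15166719 / 100000000)) \<le> 6 / 10 ^ 8"
    unfolding y_def by (rule exp_taylor_approx) (simp_all add: complex_add complex_mult complex_scaleR)
  \<comment> \<open>Values are kept to eight decimals, so each squaring doubles the error and adds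
    at most 3/10^8. The final value has only six decimals, which explains the larger jump to
    771/10^8.\<close>
  hence "norm (exp y ^ 2 - Complex (18864443 / 20000000) (- 29816783 / 100000000)) \<le> 15 / 10 ^ 8"
    by (rule approx_square) simp_all
  hence "norm (exp y ^ 4 - Complex (80076397 / 100000000) (- 562477 / 1000000)) \<le> 33 / 10 ^ 8"
    by (rule approx_square) simp_all
  hence "norm (exp y ^ 8 - Complex (1015133 / 3125000) (- 90082263 / 100000000)) \<le> 69 / 10 ^ 8"
    by (rule approx_square) simp_all
  hence "norm (exp y ^ 16 - Complex (- 2206121 / 3125000) (- 29262553 / 50000000)) \<le> 141 / 10 ^ 8"
    by (rule approx_square) simp_all
  hence "norm (exp y ^ 32 - Complex (15585891 / 100000000) (41316309 / 50000000)) \<le> 285 / 10 ^ 8"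
    by (rule approx_square) simp_all
  hence "norm (exp y ^ 64 - Complex (- 658523 / 1000000) (257581 / 1000000)) \<le> 771 / 10 ^ 8"
    by (rule approx_square) simp_all
  thus ?thesis unfolding y
    by (rule powr_approx_of_exp) (use ln_two_approx in simp_all)
qed

lemma three_powr_approx:
  "norm (of_nat 3 powr (- zero_approx) - Complex (- 284059 / 500000) (- 51419 / 500000)) \<le> 1 / 25000"
proof -
  define y where "y = Complex (- 858291 / 100000000) (- 2426388657 / 10000000000)"
  have y: "y = - (zero_approx * of_real (858291 / 50000000))"
    by (simp add: y_def zero_approx_def complex_eq_iff)
  have "norm (exp y ^ 1 - Complex (96241149 / 100000000) (- 1488823 / 6250000)) \<le> 6 / 10 ^ 8"
    unfolding y_def by (rule exp_taylor_approx) (simp_all add: complex_add complex_mult complex_scaleR)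
  hence "norm (exp y ^ 2 - Complex (86949107 / 100000000) (- 11462883 / 25000000)) \<le> 15 / 10 ^ 8"
    by (rule approx_square) simp_all
  hence "norm (exp y ^ 4 - Complex (27288921 / 50000000) (- 15946999 / 20000000)) \<le> 33 / 10 ^ 8"
    by (rule approx_square) simp_all
  hence "norm (exp y ^ 8 - Complex (- 16894643 / 50000000) (- 87035279 / 100000000)) \<le> 69 / 10 ^ 8"
    by (rule approx_square) simp_all
  hence "norm (exp y ^ 16 - Complex (- 64334239 / 100000000) (58817199 / 100000000)) \<le> 141 / 10 ^ 8"
    by (rule approx_square) simp_all
  hence "norm (exp y ^ 32 - Complex (3397157 / 50000000) (- 15135839 / 20000000)) \<le> 285 / 10 ^ 8"
    by (rule approx_square) simp_all
  hence "norm (exp y ^ 64 - Complex (- 284059 / 500000) (- 51419 / 500000)) \<le> 771 / 10 ^ 8"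
    by (rule approx_square) simp_all
  thus ?thesis unfolding y
    by (rule powr_approx_of_exp) (use ln_three_approx in simp_all)
qed

lemma five_powr_approx:
  "norm (of_nat 5 powr (- zero_approx) - Complex (- 324693 / 1000000) (30753 / 100000)) \<le> 1 / 25000"
proof -
  define y where "y = Complex (- 2514747 / 200000000) (- 7109189769 / 20000000000)"
  have y: "y = - (zero_approx * of_real (2514747 / 100000000))"
    by (simp add: y_def zero_approx_def complex_eq_iff)
  have "norm (exp y ^ 1 - Complex (92577277 / 100000000) (- 1073977 / 3125000)) \<le> 6 / 10 ^ 8"
    unfolding y_def by (rule exp_taylor_approx) (simp_all add: complex_add complex_mult complex_scaleR)
  hence "norm (exp y ^ 2 - Complex (36947217 / 50000000) (- 31816277 / 50000000)) \<le> 15 / 10 ^ 8"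
    by (rule approx_square) simp_all
  hence "norm (exp y ^ 4 - Complex (7056427 / 50000000) (- 94041831 / 100000000)) \<le> 33 / 10 ^ 8"
    by (rule approx_square) simp_all
  hence "norm (exp y ^ 8 - Complex (- 86446933 / 100000000) (- 26543973 / 100000000)) \<le> 69 / 10 ^ 8"
    by (rule approx_square) simp_all
  hence "norm (exp y ^ 16 - Complex (67684897 / 100000000) (45892901 / 100000000)) \<le> 141 / 10 ^ 8"
    by (rule approx_square) simp_all
  hence "norm (exp y ^ 32 - Complex (24750869 / 100000000) (31062563 / 50000000)) \<le> 285 / 10 ^ 8"
    by (rule approx_square) simp_all
  hence "norm (exp y ^ 64 - Complex (- 324693 / 1000000) (30753 / 100000)) \<le> 771 / 10 ^ 8"
    by (rule approx_square) simp_all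
  thus ?thesis unfolding y
    by (rule powr_approx_of_exp) (use ln_five_approx in simp_all)
qed

lemma seven_powr_approx:
  "norm (of_nat 7 powr (- zero_approx) - Complex (- 271637 / 1000000) (- 262813 / 1000000)) \<le> 1 / 25000"
proof -
  define y where "y = Complex (- 608097 / 40000000) (- 1719090219 / 4000000000)"
  have y: "y = - (zero_approx * of_real (608097 / 20000000))"
    by (simp add: y_def zero_approx_def complex_eq_iff)
  have "norm (exp y ^ 1 - Complex (44767257 / 50000000) (- 8207553 / 20000000)) \<le> 6 / 10 ^ 8"
    unfolding y_def by (rule exp_taylor_approx) (simp_all add: complex_add complex_mult complex_scaleR)
  hence "norm (exp y ^ 2 - Complex (6332331 / 10000000) (- 73485927 / 100000000)) \<le> 15 / 10 ^ 8"
    by (rule approx_square) simp_all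
  hence "norm (exp y ^ 4 - Complex (- 13903399 / 100000000) (- 93067443 / 100000000)) \<le> 33 / 10 ^ 8"
    by (rule approx_square) simp_all
  hence "norm (exp y ^ 8 - Complex (- 21170611 / 25000000) (6469769 / 25000000)) \<le> 69 / 10 ^ 8"
    by (rule approx_square) simp_all
  hence "norm (exp y ^ 16 - Complex (65013897 / 100000000) (- 10957517 / 25000000)) \<le> 141 / 10 ^ 8"
    by (rule approx_square) simp_all
  hence "norm (exp y ^ 32 - Complex (23057319 / 100000000) (- 56991271 / 100000000)) \<le> 285 / 10 ^ 8"
    by (rule approx_square) simp_all
  hence "norm (exp y ^ 64 - Complex (- 271637 / 1000000) (- 262813 / 1000000)) \<le> 771 / 10 ^ 8"
    by (rule approx_square) simp_all
  thus ?thesis unfolding y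
    by (rule powr_approx_of_exp) (use ln_seven_approx in simp_all)
qed

text \<open>
  Decimal values of \<open>n powr (- zero_approx)\<close> and \<open>ln n\<close> and upper bounds for \<open>n powr (- 1/2)\<close>, for
  \<open>1 \<le> n \<le> 10\<close>; the entries at \<open>0\<close> are dummies.
\<close>

definition powr_table :: "nat \<Rightarrow> complex" where
  "powr_table n = [
    0, Complex 1 0, Complex (- 658523 / 1000000) (257581 / 1000000),
    Complex (- 284059 / 500000) (- 51419 / 500000),
    Complex (73461 / 200000) (- 169623 / 500000),
    Complex (- 324693 / 1000000) (30753 / 100000), Complex (12519 / 31250) (- 15723 / 200000),
    Complex (- 271637 / 1000000) (- 262813 / 1000000),
    Complex (- 30899 / 200000) (79503 / 250000), Complex (156091 / 500000) (7303 / 62500),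
    Complex (33651 / 250000) (- 5723 / 20000)] ! n"

definition ln_table :: "nat \<Rightarrow> real" where
  "ln_table n = [
    0, 0, (13863 / 20000), (109861 / 100000), (138629 / 100000), (10059 / 6250),
    (22397 / 12500), (194591 / 100000), (25993 / 12500), (109861 / 50000), (230259 / 100000)] ! n"

definition norm_table :: "nat \<Rightarrow> real" where
  "norm_table n = [
    1, 1, (177 / 250), (289 / 500), (1 / 2), (56 / 125), (409 / 1000), (189 / 500),
    (177 / 500), (167 / 500), (317 / 1000)] ! n"

section \<open>Verification of the tables\<close>

lemma one_to_ten_cases:
  assumes "n \<in> {1..10::nat}"
  obtains "n = 1" | "n = 2" | "n = 3" | "n = 4" | "n = 5" | "n = 6" | "n = 7" | "n = 8" | "n = 9" | "n = 10"
proof -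
  have "n = 1 \<or> n = 2 \<or> n = 3 \<or> n = 4 \<or> n = 5 \<or> n = 6 \<or> n = 7 \<or> n = 8 \<or> n = 9 \<or> n = 10"
    using assms unfolding atLeastAtMost_iff by presburger
  thus ?thesis using that by blast
qed

lemma norm_powr_zero_approx:
  assumes "n \<ge> 1"
  shows "norm (of_nat n powr (- zero_approx) :: complex) = 1 / sqrt (real n)"
proof -
  have "norm (of_nat n powr (- zero_approx) :: complex) = real n powr (- (1 / 2))"
    using assms by (subst norm_powr_real_powr) (auto simp: zero_approx_def)
  thus ?thesis using assms by (simp add: powr_minus powr_half_sqrt field_simps)
qed

lemma norm_powr_zero_approx_le_1:
  "n \<ge> 1 \<Longrightarrow> norm (of_nat n powr (- zero_approx) :: complex) \<le> 1"
  using norm_powr_zero_approx[of n] by simp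

lemma of_nat_mult_powr:
  "(of_nat (m * n) powr s :: complex) = of_nat m powr s * of_nat n powr s"
  unfolding of_nat_mult by (rule powr_times_real) auto

text \<open>As n^(-c) has modulus n^(-1/2), an entry t is an upper bound as soon as t^2 n >= 1, a
  rational check.\<close>

lemma norm_table:
  assumes "n \<in> {1..10}"
  shows "norm (of_nat n powr (- zero_approx) :: complex) \<le> norm_table n"
proof -
  have b: "0 \<le> norm_table n" "1 \<le> norm_table n * norm_table n * real n"
    using assms by (cases rule: one_to_ten_cases; simp add: norm_table_def)+
  have "1 \<le> sqrt (norm_table n * norm_table n * real n)" using b by simp
  also have "\<dots> = norm_table n * sqrt (real n)" using b by (simp add: real_sqrt_mult)
  finally show ?thesis using assms by (simp add: norm_powr_zero_approx field_simps)
qed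

text \<open>Composite n are products of smaller entries and errors add: 1/12000 for two prime
  factors, 1/7000 for n = 8. The common bound 1/5000 covers all of them.\<close>

lemma powr_table:
  assumes "n \<in> {1..10}"
  shows "norm (of_nat n powr (- zero_approx) - powr_table n) \<le> 1 / 5000"
proof -
  have two: "norm (of_nat 2 powr (- zero_approx) - Complex (- 658523 / 1000000) (257581 / 1000000)) \<le> 1 / 25000"
    using two_powr_approx .
  have four: "norm (of_nat (2 * 2) powr (- zero_approx) - Complex (73461 / 200000) (- 169623 / 500000)) \<le> 1 / 12000"
    unfolding of_nat_mult_powr
    by (rule approx_mult[OF two two norm_powr_zero_approx_le_1]) simp_all
  have six: "norm (of_nat (2 * 3) powr (- zero_approx) - Complex (12519 / 31250) (- 15723 / 200000)) \<le> 1 / 12000"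
    unfolding of_nat_mult_powr
    by (rule approx_mult[OF two three_powr_approx norm_powr_zero_approx_le_1]) simp_all
  have eight: "norm (of_nat (2 * (2 * 2)) powr (- zero_approx) - Complex (- 30899 / 200000) (79503 / 250000)) \<le> 1 / 7000"
    unfolding of_nat_mult_powr[of 2 "2 * 2"]
    by (rule approx_mult[OF two four norm_powr_zero_approx_le_1]) simp_all
  have nine: "norm (of_nat (3 * 3) powr (- zero_approx) - Complex (156091 / 500000) (7303 / 62500)) \<le> 1 / 12000"
    unfolding of_nat_mult_powr
    by (rule approx_mult[OF three_powr_approx three_powr_approx norm_powr_zero_approx_le_1]) simp_all
  have ten: "norm (of_nat (2 * 5) powr (- zero_approx) - Complex (33651 / 250000) (- 5723 / 20000)) \<le> 1 / 12000"
    unfolding of_nat_mult_powr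
    by (rule approx_mult[OF two five_powr_approx norm_powr_zero_approx_le_1]) simp_all
  have one: "Complex 1 0 = 1" by (simp add: complex_eq_iff)
  show ?thesis using assms two four six eight nine ten three_powr_approx five_powr_approx seven_powr_approx
    by (cases rule: one_to_ten_cases) (simp_all add: powr_table_def one)
qed

lemma ln_table:
  assumes "n \<in> {1..10}"
  shows "\<bar>ln (real n) - ln_table n\<bar> \<le> 1 / 50000"
proof -
  have eqs: "ln (2 * 2) = ln 2 + ln (2::real)" "ln (2 * 3) = ln 2 + ln (3::real)"
    "ln (2 * 4) = ln 2 + ln (4::real)" "ln (3 * 3) = ln 3 + ln (3::real)" "ln (2 * 5) = ln 2 + ln (5::real)"
    by (subst ln_mult_pos; simp)+
  show ?thesis using assms ln_two_approx ln_three_approx ln_five_approx ln_seven_approx eqs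
    unfolding abs_le_iff
    by (cases rule: one_to_ten_cases) (simp_all add: ln_table_def)
qed

section \<open>The Euler-Maclaurin formula with N = 10 close to the approximate zero\<close>

definition em_factor :: "complex \<Rightarrow> complex" where
  "em_factor s = 10 / (s - 1) + 1 / 2 + s / 120 - s * (s + 1) * (s + 2) / 720000"

text \<open>Once 10^(-s) is pulled out, a rational function of s remains, which can be computed
  exactly at the rational point \<open>zero_approx\<close>.\<close>

lemma em_tail_10:
  assumes "s \<noteq> 1"
  shows "em_tail s 10 = of_nat 10 powr (- s) * em_factor s"
proof -
  have p: "(10::complex) powr (1 - s - of_nat j) = 10 powr (- s) * (10 / 10 ^ j)" for j
  proof -
    have "(10::complex) powr (1 - s - of_nat j) = 10 powr (- s + (1 - of_nat j))"
      by (simp add: algebra_simps)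
    also have "\<dots> = 10 powr (- s) * (10 powr 1 / 10 powr (of_nat j))"
      by (simp only: powr_add powr_diff)
    finally show ?thesis by (simp add: powr_nat)
  qed
  have "falling_fact (1 - s) 2 = (1 - s) * (- s)"
    "falling_fact (1 - s) 4 = (1 - s) * (- (s * (s + 1) * (s + 2)))"
    by (simp_all add: falling_fact_def eval_nat_numeral algebra_simps)
  hence f: "falling_fact (1 - s) 1 / (1 - s) = 1" "falling_fact (1 - s) 2 / (1 - s) = - s"
    "falling_fact (1 - s) 4 / (1 - s) = - (s * (s + 1) * (s + 2))"
    using assms by (simp_all add: falling_fact_def)
  have d: "em_deriv s 0 10 = 10 powr (- s) * (10 / (1 - s))" "em_deriv s 1 10 = 10 powr (- s)"
    "em_deriv s 2 10 = 10 powr (- s) * (- s / 10)"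
    "em_deriv s 4 10 = 10 powr (- s) * (- (s * (s + 1) * (s + 2)) / 1000)"
    unfolding em_deriv_def p f by (simp_all add: falling_fact_def)
  have "10 / (s - 1) = - (10 / (1 - s))" by (metis minus_diff_eq minus_divide_right)
  thus ?thesis unfolding em_tail_def em_factor_def of_nat_numeral d by (simp add: field_simps)
qed

lemma em_factor_zero_approx: "norm (em_factor zero_approx - Complex (480419 / 1000000) (- 292489 / 500000)) \<le> 1 / 100000"
proof -
  have "zero_approx - 1 = Complex (- 1 / 2) (2827 / 200)"
    by (simp add: zero_approx_def complex_eq_iff)
  moreover have num: "Complex 10 0 = 10" "Complex (1 / 2) 0 = 1 / 2" "Complex (1 / 120) 0 = 1 / 120"
    "Complex (1 / 720000) 0 = 1 / 720000" "Complex 1 0 = 1" "Complex 2 0 = 2"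
    by (simp_all add: complex_eq_iff)
  ultimately have e: "em_factor zero_approx = Complex 10 0 * inverse (Complex (- 1 / 2) (2827 / 200))
     + Complex (1 / 2) 0 + Complex (1 / 120) 0 * zero_approx
     - Complex (1 / 720000) 0 * (zero_approx * (zero_approx + Complex 1 0) * (zero_approx + Complex 2 0))"
    unfolding num em_factor_def by (simp only: divide_inverse mult_1_left mult.commute)
  show ?thesis
    by (rule order_trans[OF norm_Complex_diff_le], unfold e, unfold zero_approx_def)
      (simp add: complex_inverse complex_mult complex_add complex_diff power2_eq_square)
qed

lemma norm_em_factor_zero_approx_le: "norm (em_factor zero_approx) \<le> 76 / 100"
proof -
  have "norm (Complex (480419 / 1000000) (- 292489 / 500000)) \<le> 7575 / 10000"
    unfolding cmod_def by (intro real_le_lsqrt) (simp_all add: power2_eq_square)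
  thus ?thesis using em_factor_zero_approx
    norm_triangle_ineq[of "em_factor zero_approx - Complex (480419 / 1000000) (- 292489 / 500000)" "Complex (480419 / 1000000) (- 292489 / 500000)"] by simp
qed
text \<open>This fixes the truncation at N = 10: on the whole disk of radius 1/20 the discarded
  series is below 1/320, well under the linear term 77/2000 with which it is compared later.\<close>

lemma riemann_zeta_near_zero_approx:
  assumes w: "norm w \<le> 1 / 20"
  defines "s \<equiv> zero_approx + w"
  shows "norm (riemann_zeta s - ((\<Sum>n=1..<10. of_nat n powr (- s)) + of_nat 10 powr (- s) * em_factor s)) \<le> 1 / 320"
proof -
  have re: "Re s \<ge> 9 / 20"
    using abs_Re_le_cmod[of w] w by (simp add: s_def zero_approx_def)
  have "Im s > 1" using abs_Im_le_cmod[of w] w by (simp add: s_def zero_approx_def)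
  hence s1: "s \<noteq> 1" by auto
  have k: "norm (s + of_real a) \<le> b + 1 / 20" if "(a + 1 / 2)\<^sup>2 + (2827 / 200)\<^sup>2 \<le> b\<^sup>2" "0 \<le> b" for a b
  proof -
    have "norm (s + of_real a) \<le> norm (zero_approx + of_real a) + norm w"
      using norm_triangle_ineq[of "zero_approx + of_real a" w] by (simp add: s_def add_ac)
    thus ?thesis using norm_zero_approx_add_le[OF that] w by linarith
  qed
  \<comment> \<open>The decimals bound the moduli of c, c+1, ..., c+4 for c =
    \<open>zero_approx\<close>; 1/20 is added to each for the shift by w.\<close>
  have "em_const s \<le> (1415 / 100 + 1 / 20) * (1422 / 100 + 1 / 20) * (1436 / 100 + 1 / 20) *
      (1457 / 100 + 1 / 20) * (1484 / 100 + 1 / 20)"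
    unfolding em_const_def norm_mult
    using k[of 0 "1415 / 100"] k[of 1 "1422 / 100"] k[of 2 "1436 / 100"] k[of 3 "1457 / 100"] k[of 4 "1484 / 100"]
    by (intro mult_mono mult_nonneg_nonneg) (simp_all add: power2_eq_square)
  hence ec: "em_const s \<le> 636000" by simp
  \<comment> \<open>Rounding Re s down to 1/3 and 10 down to 2^3 gives the convenient bound
    1/2.\<close>
  have "10 powr (- Re s) \<le> 10 powr (- (1 / 3))" using re by (intro powr_mono) auto
  also have "\<dots> \<le> (2 powr 3) powr (- (1 / 3))" by (intro powr_mono2') auto
  also have "\<dots> = 2 powr (- 1)" by (subst powr_powr) simp
  also have "\<dots> = 1 / 2" by (simp add: powr_minus)
  finally have p: "10 powr (- Re s) \<le> 1 / 2" .
  have re0: "Re s > 0" using re by linarith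
  have "riemann_zeta s = (\<Sum>n=1..<10. of_nat n powr (- s)) + em_tail s 10 - (\<Sum>k. em_err s (10 + k))"
    by (rule riemann_zeta_euler_maclaurin[OF _ re0 s1]) simp
  hence "norm (riemann_zeta s - ((\<Sum>n=1..<10. of_nat n powr (- s)) + of_nat 10 powr (- s) * em_factor s))
      = norm (\<Sum>k. em_err s (10 + k))"
    unfolding em_tail_10[OF s1] by (simp only: add_diff_cancel_left' diff_diff_eq2 norm_minus_commute diff_add_eq)
  also have "\<dots> \<le> em_const s / 4000 * real 10 powr (- Re s) / (4 * real (10 - 1) ^ 4)"
    by (rule suminf_em_err_le[OF re0 s1]) simp
  also have "\<dots> \<le> 636000 / 4000 * (1 / 2) / (4 * real (10 - 1) ^ 4)"
    using ec p by (intro divide_right_mono mult_mono) (auto simp: em_const_def)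
  also have "\<dots> \<le> 1 / 320" by simp
  finally show ?thesis .
qed

text \<open>Every part of the difference contains the factor w exactly. The remaining quotient is
  dominated by 10 / ((c-1)(c+w-1)), where both factors of the denominator have modulus at least
  14.\<close>

lemma em_factor_near_zero_approx:
  assumes w: "norm w \<le> 1 / 20"
  shows "norm (em_factor (zero_approx + w) - em_factor zero_approx) \<le> 1 / 320"
proof -
  define c where "c = zero_approx"
  have im: "Im c = 2827 / 200" by (simp add: c_def zero_approx_def)
  have c: "norm c \<le> 142 / 10"
    using norm_zero_approx_add_le[of 0 "142 / 10"] by (simp add: c_def power2_eq_square)
  have n1: "norm (c - 1) \<ge> 14" using abs_Im_le_cmod[of "c - 1"] im by simp
  have n2: "norm (c + w - 1) \<ge> 14"
    using abs_Im_le_cmod[of "c + w - 1"] abs_Im_le_cmod[of w] im w by simp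
  have nz: "c - 1 \<noteq> 0" "c + w - 1 \<noteq> 0" using n1 n2 by auto
  have d: "10 / (c + w - 1) - 10 / (c - 1) = - (10 / ((c - 1) * (c + w - 1))) * w"
    using nz by (simp add: divide_simps)
  have "em_factor (c + w) - em_factor c = (10 / (c + w - 1) - 10 / (c - 1)) + w / 120
      - ((c + w) * (c + w + 1) * (c + w + 2) - c * (c + 1) * (c + 2)) / 720000"
    unfolding em_factor_def by (simp add: add_divide_distrib diff_divide_distrib)
  also have "(c + w) * (c + w + 1) * (c + w + 2) - c * (c + 1) * (c + 2)
      = (3 * c * c + 3 * c * w + w * w + 6 * c + 3 * w + 2) * w"
    by (simp add: algebra_simps)
  finally have eq: "em_factor (c + w) - em_factor c = (- (10 / ((c - 1) * (c + w - 1))) + 1 / 120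
      - (3 * c * c + 3 * c * w + w * w + 6 * c + 3 * w + 2) / 720000) * w"
    unfolding d by (simp add: left_diff_distrib distrib_right)
  have "14 * 14 \<le> norm (c - 1) * norm (c + w - 1)" using n1 n2 by (intro mult_mono) auto
  hence a: "norm (- (10 / ((c - 1) * (c + w - 1)))) \<le> 10 / 196"
    unfolding norm_minus_cancel norm_divide norm_mult by (intro frac_le) auto
  have "norm (3 * c * c + 3 * c * w + w * w + 6 * c + 3 * w + 2)
      \<le> 3 * norm c * norm c + 3 * norm c * norm w + norm w * norm w + 6 * norm c + 3 * norm w + 2"
    by (intro norm_triangle_le add_mono) (simp_all add: norm_mult)
  also have "\<dots> \<le> 3 * (142 / 10) * (142 / 10) + 3 * (142 / 10) * (1 / 20) + (1 / 20) * (1 / 20)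
      + 6 * (142 / 10) + 3 * (1 / 20) + 2"
    using c w by (intro add_mono mult_mono mult_left_mono) auto
  also have "\<dots> \<le> 720" by simp
  finally have b: "norm (3 * c * c + 3 * c * w + w * w + 6 * c + 3 * w + 2) / 720000 \<le> 720 / 720000"
    by (intro divide_right_mono) auto
  have "norm (- (10 / ((c - 1) * (c + w - 1))) + 1 / 120
      - (3 * c * c + 3 * c * w + w * w + 6 * c + 3 * w + 2) / 720000) \<le> 10 / 196 + 1 / 120 + 720 / 720000"
    using a b by (intro order_trans[OF norm_triangle_ineq4] order_trans[OF norm_triangle_ineq] add_mono)
      (simp_all add: norm_divide)
  hence "norm (em_factor (c + w) - em_factor c) \<le> (10 / 196 + 1 / 120 + 720 / 720000) * (1 / 20)"
    unfolding eq norm_mult using w by (intro mult_mono) auto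
  thus ?thesis by (simp add: c_def)
qed

text \<open>
  At \<open>zero_approx\<close> the function is small compared with its modulus on a surrounding circle, where
  the linear term of its Taylor expansion dominates; hence it has a zero inside the circle.
\<close>

theorem nontrivial_zero_exists: "\<exists>\<rho>. riemann_zeta \<rho> = 0 \<and> 0 < Re \<rho> \<and> Re \<rho> < 1"
proof -
  define c where "c = zero_approx"
  define z where "z = (\<lambda>n. of_nat n powr (- c) :: complex)"
  define Q where "Q = em_factor c"
  define A0 where "A0 = (\<Sum>n=1..<10. z n) + z 10 * Q"
  \<comment> \<open>This is the derivative of \<open>G\<close> at c with \<open>em_factor\<close>
    frozen at its value \<open>Q\<close>; the variation of \<open>em_factor\<close> is treated as an
    error, called \<open>D\<close> below.\<close>
  define A1 where "A1 = - ((\<Sum>n=1..<10. of_real (ln (real n)) * z n) + of_real (ln 10) * (z 10 * Q))"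
  define G where "G = (\<lambda>s. (\<Sum>n=1..<10. of_nat n powr (- s)) + of_nat 10 powr (- s) * em_factor s)"
  have zt: "norm (z n - powr_table n) \<le> 1 / 5000" "norm (z n) \<le> norm_table n"
      "\<bar>ln (real n) - ln_table n\<bar> \<le> 1 / 50000" "norm (z n) \<le> 1" if "n \<in> {1..10}" for n
    using powr_table[OF that] norm_table[OF that] ln_table[OF that] norm_powr_zero_approx_le_1[of n] that
    by (auto simp: z_def c_def)
  have lt: "0 \<le> ln_table n" "ln_table n \<le> 231 / 100" if "n \<in> {1..10}" for n
    using that by (cases rule: one_to_ten_cases; simp add: ln_table_def)+
  define q where "q = Complex (480419 / 1000000) (- 292489 / 500000)"
  have q: "norm (Q - q) \<le> 1 / 100000" using em_factor_zero_approx by (simp add: Q_def q_def c_def)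
  have Q: "norm Q \<le> 76 / 100" using norm_em_factor_zero_approx_le by (simp add: Q_def c_def)
  have t10: "norm (powr_table 10) \<le> 1"
    by (simp add: powr_table_def cmod_def power2_eq_square)
  have zq: "norm (z 10 * Q - powr_table 10 * q) \<le> 1 / 5000"
  proof -
    have "z 10 * Q - powr_table 10 * q = (z 10 - powr_table 10) * Q + powr_table 10 * (Q - q)"
      by (simp add: algebra_simps)
    hence "norm (z 10 * Q - powr_table 10 * q) \<le> norm (z 10 - powr_table 10) * norm Q + norm (powr_table 10) * norm (Q - q)"
      by (metis norm_mult norm_triangle_ineq)
    also have "\<dots> \<le> 1 / 5000 * (76 / 100) + 1 * (1 / 100000)"
      using zt[of 10] Q q t10 by (intro add_mono mult_mono) auto
    finally show ?thesis by simp
  qed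
  have A0: "norm A0 \<le> 1 / 400"
  proof -
    define B where "B = (\<Sum>n=1..<10. powr_table n) + powr_table 10 * q"
    have "A0 - B = (\<Sum>n=1..<10. z n - powr_table n) + (z 10 * Q - powr_table 10 * q)"
      unfolding A0_def B_def sum_subtractf by simp
    moreover have "norm (\<Sum>n=1..<10. z n - powr_table n) \<le> (\<Sum>n=1..<10::nat. 1 / 5000)"
      by (rule sum_norm_le) (use zt in auto)
    ultimately have "norm (A0 - B) \<le> 10 / 5000"
      using zq norm_triangle_ineq[of "\<Sum>n=1..<10. z n - powr_table n" "z 10 * Q - powr_table 10 * q"] by simp
    moreover have "norm B \<le> 1 / 2000"
      using cmod_le[of B]
      by (simp add: B_def powr_table_def q_def numeral_eq_Suc sum.atLeastLessThan_Suc)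
    ultimately show ?thesis using norm_triangle_ineq[of "A0 - B" B] by simp
  qed
  have A1: "norm A1 \<ge> 77 / 100"
  proof -
    \<comment> \<open>The real part alone gives a sufficient lower bound for the modulus;
      \<open>B\<close> is the tabulated value of - Re A1.\<close>
    define B where "B = (\<Sum>n=1..<10. ln_table n * Re (powr_table n)) + ln_table 10 * Re (powr_table 10 * q)"
    have lz: "\<bar>ln (real n) * Re u - ln_table n * Re v\<bar> \<le> 1 / 2000"
      if "n \<in> {1..10}" "norm (u - v) \<le> 1 / 5000" "norm u \<le> 1" for n u v
    proof -
      have "ln (real n) * Re u - ln_table n * Re v
          = (ln (real n) - ln_table n) * Re u + ln_table n * Re (u - v)" by (simp add: algebra_simps)
      hence "\<bar>ln (real n) * Re u - ln_table n * Re v\<bar>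
          \<le> \<bar>ln (real n) - ln_table n\<bar> * \<bar>Re u\<bar> + ln_table n * \<bar>Re (u - v)\<bar>"
        using abs_triangle_ineq[of "(ln (real n) - ln_table n) * Re u" "ln_table n * Re (u - v)"] lt(1)[OF that(1)]
        by (simp add: abs_mult)
      also have "\<dots> \<le> 1 / 50000 * 1 + 231 / 100 * (1 / 5000)"
        using zt(3)[OF that(1)] lt[OF that(1)] that abs_Re_le_cmod[of u] abs_Re_le_cmod[of "u - v"]
        by (intro add_mono mult_mono) (auto intro: order_trans)
      finally show ?thesis by simp
    qed
    have "norm (z 10) * norm Q \<le> 1 * 1" using zt(4)[of 10] Q by (intro mult_mono) auto
    hence zq1: "norm (z 10 * Q) \<le> 1" by (simp add: norm_mult)
    have "- Re A1 - B = (\<Sum>n=1..<10. ln (real n) * Re (z n) - ln_table n * Re (powr_table n))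
        + (ln (real 10) * Re (z 10 * Q) - ln_table 10 * Re (powr_table 10 * q))"
      unfolding A1_def B_def sum_subtractf by simp
    moreover have "\<bar>\<Sum>n=1..<10. ln (real n) * Re (z n) - ln_table n * Re (powr_table n)\<bar> \<le> 9 / 2000"
    proof -
      have "\<bar>\<Sum>n=1..<10. ln (real n) * Re (z n) - ln_table n * Re (powr_table n)\<bar> \<le> (\<Sum>n=1..<10::nat. 1 / 2000)"
        by (rule order_trans[OF sum_abs sum_mono], rule lz) (use zt in auto)
      thus ?thesis by simp
    qed
    moreover have "\<bar>ln (real 10) * Re (z 10 * Q) - ln_table 10 * Re (powr_table 10 * q)\<bar> \<le> 1 / 2000"
      by (rule lz[OF _ zq zq1]) auto
    ultimately have "\<bar>- Re A1 - B\<bar> \<le> 10 / 2000" by linarith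
    moreover have "B \<le> - 776 / 1000"
      by (simp add: B_def powr_table_def ln_table_def q_def numeral_eq_Suc sum.atLeastLessThan_Suc)
    ultimately have "Re A1 \<ge> 77 / 100" by linarith
    thus ?thesis using complex_Re_le_cmod[of A1] by linarith
  qed
  have G: "norm (G (c + w) - (A0 + A1 * w)) \<le> 172 / 10000" if w: "norm w = 1 / 20" for w
  proof -
    \<comment> \<open>\<open>E n\<close> is what n^(-w) has beyond its linear part, of size at most
      3/5 of the square of ln n / 20.\<close>
    define E where "E = (\<lambda>n. exp (- (w * of_real (ln (real n)))) - 1 + w * of_real (ln (real n)))"
    have pw: "of_nat n powr (- (c + w)) = z n * exp (- (w * of_real (ln (real n))))" if "n \<ge> 1" for n
      using that Ln_of_real[of "real n"] by (simp add: z_def powr_def exp_add[symmetric] algebra_simps)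
    have wl: "norm (- (w * of_real (ln (real n)))) = ln (real n) / 20" if "n \<in> {1..10}" for n
      using w that by (simp add: norm_mult)
    have lnb: "0 \<le> ln (real n)" "ln (real n) \<le> ln_table n + 1 / 50000" if "n \<in> {1..10}" for n
    proof -
      show "0 \<le> ln (real n)" using that by simp
      show "ln (real n) \<le> ln_table n + 1 / 50000" using zt(3)[OF that] by linarith
    qed
    have ll: "ln (real n) / 20 \<le> 1 / 8" if "n \<in> {1..10}" for n
      using lnb[OF that] lt[OF that] by simp
    have E: "norm (E n) \<le> 3 / 5 * ((ln_table n + 1 / 50000) / 20) ^ 2" if "n \<in> {1..10}" for n
    proof -
      have "norm (E n) \<le> 3 / 5 * norm (- (w * of_real (ln (real n)))) ^ 2"
        using norm_exp_minus_linear_le[of "- (w * of_real (ln (real n)))"] ll[OF that] wl[OF that]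
        by (simp add: E_def)
      also have "\<dots> \<le> 3 / 5 * ((ln_table n + 1 / 50000) / 20) ^ 2"
        unfolding wl[OF that] using lnb[OF that] by (intro mult_left_mono power_mono) auto
      finally show ?thesis .
    qed
    define D where "D = em_factor (c + w) - Q"
    have D: "norm D \<le> 1 / 320" unfolding D_def Q_def c_def using w by (intro em_factor_near_zero_approx) simp
    define e10 where "e10 = exp (- (w * of_real (ln 10)))"
    have "norm e10 \<le> 1 + 2 * norm (- (w * of_real (ln (real 10))))"
      unfolding e10_def using exp_bound_lemma[of "- (w * of_real (ln (real 10)))"] wl[of 10] ll[of 10] by simp
    hence e10: "norm e10 \<le> 5 / 4" unfolding wl[of 10, simplified] using ll[of 10] wl[of 10] by simp
    have "G (c + w) = (\<Sum>n=1..<10. z n * exp (- (w * of_real (ln (real n))))) + z 10 * e10 * (Q + D)"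
    proof -
      have "(\<Sum>n=1..<10. of_nat n powr (- (c + w))) = (\<Sum>n=1..<10. z n * exp (- (w * of_real (ln (real n)))))"
        by (intro sum.cong refl pw) auto
      moreover have "of_nat 10 powr (- (c + w)) = z 10 * e10" using pw[of 10] by (simp add: e10_def)
      ultimately show ?thesis unfolding G_def D_def by (simp only:) simp
    qed
    also have "(\<Sum>n=1..<10. z n * exp (- (w * of_real (ln (real n)))))
        = (\<Sum>n=1..<10. z n - w * (of_real (ln (real n)) * z n) + z n * E n)"
      by (intro sum.cong refl) (simp add: E_def algebra_simps)
    also have "\<dots> = (\<Sum>n=1..<10. z n) - w * (\<Sum>n=1..<10. of_real (ln (real n)) * z n) + (\<Sum>n=1..<10. z n * E n)"
      by (simp only: sum.distrib sum_subtractf sum_distrib_left)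
    also have "e10 = E 10 + 1 - w * of_real (ln 10)" by (simp add: E_def e10_def)
    finally have "G (c + w) - (A0 + A1 * w) = (\<Sum>n=1..<10. z n * E n) + z 10 * E 10 * Q + z 10 * e10 * D"
      unfolding A0_def A1_def by (simp add: E_def e10_def algebra_simps)
    hence "norm (G (c + w) - (A0 + A1 * w)) \<le> norm (\<Sum>n=1..<10. z n * E n) + norm (z 10 * E 10 * Q) + norm (z 10 * e10 * D)"
      by (simp only:) (intro order_trans[OF norm_triangle_ineq] add_right_mono norm_triangle_ineq)
    also have "norm (\<Sum>n=1..<10. z n * E n) \<le> (\<Sum>n=1..<10. norm_table n * (3 / 5 * ((ln_table n + 1 / 50000) / 20) ^ 2))"
    proof (rule sum_norm_le)
      fix n :: nat assume "n \<in> {1..<10}"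
      hence n: "n \<in> {1..10}" by simp
      show "norm (z n * E n) \<le> norm_table n * (3 / 5 * ((ln_table n + 1 / 50000) / 20) ^ 2)"
        unfolding norm_mult
        by (intro mult_mono zt(2)[OF n] E[OF n] order_trans[OF norm_ge_zero zt(2)[OF n]] norm_ge_zero)
    qed
    also have "\<dots> \<le> 138 / 10000"
      by (simp add: norm_table_def ln_table_def numeral_eq_Suc sum.atLeastLessThan_Suc)
    also have "norm (z 10 * E 10 * Q) \<le> 317 / 1000 * (3 / 5 * ((ln_table 10 + 1 / 50000) / 20) ^ 2) * (76 / 100)"
      unfolding norm_mult using zt(2)[of 10] E[of 10] Q by (intro mult_mono) (auto simp: norm_table_def)
    also have "\<dots> \<le> 2 / 1000" by (simp add: ln_table_def power2_eq_square)
    also have "norm (z 10 * e10 * D) \<le> 317 / 1000 * (5 / 4) * (1 / 320)"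
      unfolding norm_mult using zt(2)[of 10] e10 D by (intro mult_mono) (auto simp: norm_table_def)
    finally show ?thesis by simp
  qed
  have G0: "G c = A0" by (simp add: G_def A0_def z_def Q_def)
  have zeta_G: "norm (riemann_zeta (c + w) - G (c + w)) \<le> 1 / 320" if "norm w \<le> 1 / 20" for w
    using riemann_zeta_near_zero_approx[OF that] by (simp add: G_def c_def)
  have im: "Im s > 1" "0 < Re s" "Re s < 1" if "s \<in> cball c (1 / 20)" for s
    using that abs_Im_le_cmod[of "c - s"] abs_Re_le_cmod[of "c - s"]
    by (auto simp: dist_norm c_def zero_approx_def)
  have sub: "cball c (1 / 20) \<subseteq> - {1}" using im by fastforce
  obtain \<rho> where "\<rho> \<in> ball c (1 / 20)" "riemann_zeta \<rho> = 0"
  proof (rule holomorphic_contract_to_zero[of c "1 / 20" riemann_zeta])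
    show "continuous_on (cball c (1 / 20)) riemann_zeta"
      by (rule holomorphic_on_imp_continuous_on[OF holomorphic_on_subset[OF holomorphic_riemann_zeta sub]])
    show "riemann_zeta holomorphic_on ball c (1 / 20)"
      by (rule holomorphic_on_subset[OF holomorphic_riemann_zeta]) (use sub in auto)
    fix s assume s: "norm (c - s) = 1 / 20"
    define w where "w = s - c"
    have w: "norm w = 1 / 20" "s = c + w" using s by (simp_all add: w_def norm_minus_commute)
    have "norm (riemann_zeta c) \<le> norm A0 + 1 / 320"
      using zeta_G[of 0] norm_triangle_ineq[of "riemann_zeta c - A0" A0] by (simp add: G0)
    moreover have "norm (A1 * w) \<ge> 77 / 100 * (1 / 20)"
      unfolding norm_mult w(1) using A1 by (intro mult_right_mono) auto
    moreover have "norm (A1 * w) \<le> norm (riemann_zeta s) + norm (riemann_zeta s - G s) + norm (G s - (A0 + A1 * w)) + norm A0"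
    proof -
      have "A1 * w = riemann_zeta s - (riemann_zeta s - G s) - (G s - (A0 + A1 * w)) - A0" by simp
      hence "norm (A1 * w) = norm (riemann_zeta s - (riemann_zeta s - G s) - (G s - (A0 + A1 * w)) - A0)"
        by (rule arg_cong)
      also have "\<dots> \<le> norm (riemann_zeta s) + norm (riemann_zeta s - G s) + norm (G s - (A0 + A1 * w)) + norm A0"
        by (intro order_trans[OF norm_triangle_ineq4] add_right_mono order_refl)
      finally show ?thesis .
    qed
    \<comment> \<open>Numerically, the centre value is at most 0.0025 + 0.003125, while on the
      circle the modulus is at least 0.0385 - 0.0172 - 0.003125 - 0.0025.\<close>
    ultimately show "norm (riemann_zeta c) < norm (riemann_zeta s)"
      using A0 G[OF w(1)] zeta_G[of w] w by simp
  qed simp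
  thus ?thesis using im by (meson ball_subset_cball subsetD)
qed

section \<open>The Moebius function\<close>

definition moebius_mu :: "nat \<Rightarrow> real" where
  "moebius_mu n = (if squarefree n then (-1) ^ card (prime_factors n) else 0)"

lemma abs_moebius_le_1: "\<bar>moebius_mu n\<bar> \<le> 1"
  by (simp add: moebius_mu_def power_abs)

lemma prime_factors_prod_primes:
  fixes S :: "nat set"
  assumes "finite S" "\<And>p. p \<in> S \<Longrightarrow> prime p"
  shows "prime_factorization (\<Prod>S) = mset_set S"
proof -
  have "\<Prod>S = prod_mset (mset_set S)" by (simp add: prod_unfold_prod_mset)
  also have "prime_factorization \<dots> = mset_set S"
    using assms by (intro prime_factorization_prod_mset_primes) auto
  finally show ?thesis .
qed

text \<open>Squarefree divisors correspond to sets of prime factors of n, so the sum is the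
  expansion of a product of factors 1 - 1, which vanishes unless there are no primes.\<close>

lemma sum_moebius_divisors:
  assumes "n > 0"
  shows "(\<Sum>d | d dvd n. moebius_mu d) = (if n = 1 then 1 else 0)"
proof -
  define P where "P = prime_factors n"
  have P: "finite P" "\<And>p. p \<in> P \<Longrightarrow> prime p" by (auto simp: P_def)
  have "(\<Sum>d | d dvd n. moebius_mu d) = (\<Sum>d | d dvd n \<and> squarefree d. moebius_mu d)"
    by (rule sum.mono_neutral_right) (use assms in \<open>auto simp: moebius_mu_def\<close>)
  also have "\<dots> = (\<Sum>S\<in>Pow P. (-1) ^ card S)"
  proof (rule sum.reindex_bij_witness[of _ "\<lambda>S. \<Prod>S" prime_factors])
    fix d assume "d \<in> {d. d dvd n \<and> squarefree d}"
    hence d: "d dvd n" "squarefree d" "d \<noteq> 0" using assms by (auto intro: Nat.gr0I)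
    have "(\<Prod>p\<in>prime_factors d. p ^ multiplicity p d) = d"
      using prod_prime_factors[of d] d by simp
    moreover have "(\<Prod>p\<in>prime_factors d. p ^ multiplicity p d) = \<Prod>(prime_factors d)"
      using d by (intro prod.cong refl) (simp add: squarefree_factorial_semiring')
    ultimately show "\<Prod>(prime_factors d) = d" by simp
    show "prime_factors d \<in> Pow P" using dvd_prime_factors[of n d] assms d by (auto simp: P_def)
    show "(-1) ^ card (prime_factors d) = moebius_mu d" using d by (simp add: moebius_mu_def)
  next
    fix S assume S: "S \<in> Pow P"
    have fin: "finite S" and pr: "\<And>p. p \<in> S \<Longrightarrow> prime p"
      using S P finite_subset by auto
    note pf = prime_factors_prod_primes[OF fin pr]
    have nz: "\<Prod>S \<noteq> 0" using fin pr[of 0] by (auto simp: prod_zero_iff)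
    show "prime_factors (\<Prod>S) = S" using pf fin by simp
    have "mset_set S \<subseteq># prime_factorization n"
    proof (rule mset_subset_eqI)
      fix p
      show "count (mset_set S) p \<le> count (prime_factorization n) p"
      proof (cases "p \<in> S")
        case True
        hence "p \<in># prime_factorization n" using S by (auto simp: P_def)
        thus ?thesis using fin True by (simp add: Suc_leI)
      qed (use fin in simp)
    qed
    hence "\<Prod>S dvd n"
      using prime_factorization_subset_iff_dvd[OF nz] assms pf by simp
    moreover have "squarefree (\<Prod>S)"
    proof (subst squarefree_factorial_semiring'[OF nz], intro ballI)
      fix p assume "p \<in> prime_factors (\<Prod>S)"
      hence p: "p \<in> S" using pf fin by simp
      have "multiplicity p (\<Prod>S) = count (prime_factorization (\<Prod>S)) p"
        using pr[OF p] by (simp add: count_prime_factorization_prime)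
      thus "multiplicity p (\<Prod>S) = 1" using p fin by (simp add: pf)
    qed
    ultimately show "\<Prod>S \<in> {d. d dvd n \<and> squarefree d}" by simp
  qed
  also have "\<dots> = (\<Prod>p\<in>P. (-1) + (1::real))"
    by (subst prod_add) (use P in auto)
  also have "\<dots> = (if P = {} then 1 else 0)"
    using P by (auto simp: prod_zero_iff)
  also have "P = {} \<longleftrightarrow> n = 1"
    using assms by (simp add: P_def prime_factorization_empty_iff)
  finally show ?thesis by simp
qed

section \<open>Rearrangement of double series and the Dirichlet series of 1/zeta\<close>

lemma summable_on_Times_bounded:
  fixes f :: "'a \<Rightarrow> 'b \<Rightarrow> real"
  assumes a: "a summable_on A" and b: "b summable_on B"
    and nonneg: "\<And>x. x \<in> A \<Longrightarrow> a x \<ge> 0" "\<And>y. y \<in> B \<Longrightarrow> b y \<ge> 0"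
    and f: "\<And>x y. x \<in> A \<Longrightarrow> y \<in> B \<Longrightarrow> \<bar>f x y\<bar> \<le> a x * b y"
  shows "(\<lambda>(x, y). f x y) summable_on (A \<times> B)"
proof -
  have "(\<lambda>(x, y). a x * b y) summable_on (A \<times> B)"
  proof (rule summable_on_SigmaI[where g = "\<lambda>x. a x * infsum b B"])
    show "((\<lambda>y. case (x, y) of (x, y) \<Rightarrow> a x * b y) has_sum a x * infsum b B) B" for x
      using has_sum_cmult_right[OF has_sum_infsum[OF b]] by simp
    show "(\<lambda>x. a x * infsum b B) summable_on A"
      using summable_on_cmult_left[OF a] by simp
  qed (use nonneg in auto)
  hence "(\<lambda>p. norm (case p of (x, y) \<Rightarrow> f x y)) summable_on (A \<times> B)"
    by (rule summable_on_comparison_test) (use f in auto)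
  thus ?thesis by (rule abs_summable_summable)
qed

lemma has_sum_powr_minus:
  assumes "s > 1"
  shows "((\<lambda>n. real n powr (- s)) has_sum (\<Sum>n. real (Suc n) powr (- s))) {1..}"
proof -
  have "(\<lambda>n. real (Suc n) powr (- s)) sums (\<Sum>n. real (Suc n) powr (- s))"
    using summable_Suc_powr[of "- s"] assms by (intro summable_sums) auto
  hence "((\<lambda>n. real (Suc n) powr (- s)) has_sum (\<Sum>n. real (Suc n) powr (- s))) UNIV"
    by (intro sums_nonneg_imp_has_sum) auto
  also have "?this \<longleftrightarrow> ?thesis"
    by (rule has_sum_reindex_bij_witness[of _ "\<lambda>n. n - 1" Suc]) auto
  finally show ?thesis .
qed

text \<open>A real-valued copy of zeta for s > 1, so that the Moebius series and the Mellin
  integrals can be handled over the reals.\<close>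

definition zeta_real :: "real \<Rightarrow> real" where
  "zeta_real s = (\<Sum>n. real (Suc n) powr (- s))"

lemma riemann_zeta_of_real:
  assumes "s > 1"
  shows "riemann_zeta (of_real s) = of_real (zeta_real s)"
proof -
  have "(\<lambda>n. real (Suc n) powr (- s)) sums zeta_real s"
    using summable_Suc_powr[of "- s"] assms by (simp add: zeta_real_def summable_sums)
  hence "(\<lambda>n. complex_of_real (real (Suc n) powr (- s))) sums of_real (zeta_real s)"
    by (rule sums_of_real)
  moreover have "1 / of_nat (Suc n) powr (complex_of_real s) = of_real (real (Suc n) powr (- s))" for n
    using powr_of_real[of "real (Suc n)" s] by (simp add: powr_minus divide_inverse del: of_nat_Suc)
  ultimately have "(\<lambda>n. 1 / of_nat (Suc n) powr (complex_of_real s)) sums of_real (zeta_real s)"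
    by (simp only:)
  moreover have "(\<lambda>n. 1 / of_nat (Suc n) powr (complex_of_real s)) sums riemann_zeta (of_real s)"
    using assms by (intro riemann_zeta_sums) simp
  ultimately show ?thesis using sums_unique2 by blast
qed

lemma zeta_real_ge_1:
  assumes "s > 1"
  shows "zeta_real s \<ge> 1"
proof -
  have "(\<Sum>n<1. real (Suc n) powr (- s)) \<le> zeta_real s"
    unfolding zeta_real_def using summable_Suc_powr[of "- s"] assms by (intro sum_le_suminf) auto
  thus ?thesis by simp
qed

text \<open>The product with zeta is an absolutely convergent sum over pairs (d, m); grouping by n =
  d m turns the inner sums into divisor sums of mu, of which only n = 1 survives.\<close>

lemma moebius_dirichlet_series:
  assumes s: "s > 1"
  shows "(\<lambda>n. moebius_mu (Suc n) * real (Suc n) powr (- s)) sums (1 / zeta_real s)"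
proof -
  define N where "N = {1::nat..}"
  have z: "((\<lambda>n. real n powr (- s)) has_sum zeta_real s) N"
    unfolding N_def zeta_real_def by (rule has_sum_powr_minus[OF s])
  hence zs: "(\<lambda>n. real n powr (- s)) summable_on N" by (rule has_sum_imp_summable)
  define f where "f = (\<lambda>d m. moebius_mu d * real d powr (- s) * real m powr (- s))"
  have mu: "\<bar>moebius_mu d * real d powr (- s)\<bar> \<le> real d powr (- s)" for d
    using mult_right_mono[OF abs_moebius_le_1[of d], of "real d powr (- s)"] by (simp add: abs_mult)
  have "\<bar>f d m\<bar> \<le> real d powr (- s) * real m powr (- s)" for d m
    using mult_right_mono[OF mu[of d], of "real m powr (- s)"] by (simp add: f_def abs_mult)
  hence f: "(\<lambda>(d, m). f d m) summable_on (N \<times> N)"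
    using zs by (intro summable_on_Times_bounded[OF zs zs]) auto
  have m: "(\<lambda>d. moebius_mu d * real d powr (- s)) summable_on N"
    by (rule abs_summable_summable, rule summable_on_comparison_test[OF zs])
      (use mu in auto)
  define M where "M = (\<Sum>\<^sub>\<infinity>d\<in>N. moebius_mu d * real d powr (- s))"
  have "infsum (\<lambda>(d, m). f d m) (N \<times> N) = (\<Sum>\<^sub>\<infinity>d\<in>N. \<Sum>\<^sub>\<infinity>m\<in>N. f d m)"
    using infsum_Sigma'_banach[OF f] by simp
  also have "\<dots> = M * zeta_real s"
    using infsumI[OF z] unfolding M_def f_def by (simp add: infsum_cmult_right' infsum_cmult_left')
  finally have 1: "infsum (\<lambda>(d, m). f d m) (N \<times> N) = M * zeta_real s" .
  define t where "t = (\<lambda>(n, d). (d, n div d :: nat))"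
  define F where "F = (\<lambda>(d, m). f d m)"
  define H where "H = (\<lambda>(n, d). moebius_mu d * real n powr (- s))"
  have bij: "bij_betw t (SIGMA n:N. {d. d dvd n}) (N \<times> N)"
    unfolding t_def
    by (rule bij_betwI[where g = "\<lambda>(d, m). (d * m, d)"]) (auto simp: N_def elim!: dvdE)
  have eq: "F (t x) = H x" if xin: "x \<in> (SIGMA n:N. {d. d dvd n})" for x
  proof -
    obtain n d where x: "x = (n, d)" by (cases x)
    obtain m where m: "n = d * m" using xin x by (auto elim: dvdE)
    have "d > 0" using xin x m by (auto simp: N_def intro: Nat.gr0I)
    thus ?thesis by (simp add: x m f_def powr_mult F_def H_def t_def)
  qed
  have "H summable_on (SIGMA n:N. {d. d dvd n})"
    using f summable_on_cong[of "SIGMA n:N. {d. d dvd n}" "\<lambda>x. F (t x)" H]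
      summable_on_reindex_bij_betw[OF bij, of F] eq by (simp add: F_def)
  hence g: "(\<lambda>(n, d). moebius_mu d * real n powr (- s)) summable_on (SIGMA n:N. {d. d dvd n})"
    by (simp only: H_def)
  have geq: "infsum H (SIGMA n:N. {d. d dvd n}) = infsum (\<lambda>(d, m). f d m) (N \<times> N)"
    using infsum_cong[of "SIGMA n:N. {d. d dvd n}" "\<lambda>x. F (t x)" H]
      infsum_reindex_bij_betw[OF bij, of F] eq by (simp add: F_def)
  have "infsum H (SIGMA n:N. {d. d dvd n})
      = (\<Sum>\<^sub>\<infinity>n\<in>N. \<Sum>\<^sub>\<infinity>d\<in>{d. d dvd n}. moebius_mu d * real n powr (- s))"
    using infsum_Sigma'_banach[OF g] by (simp add: H_def)
  also have "\<dots> = (\<Sum>\<^sub>\<infinity>n\<in>N. if n = 1 then 1 else 0)"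
  proof (rule infsum_cong)
    fix n assume "n \<in> N"
    hence n: "n > 0" by (simp add: N_def)
    have "(\<Sum>\<^sub>\<infinity>d\<in>{d. d dvd n}. moebius_mu d * real n powr (- s)) = (\<Sum>d | d dvd n. moebius_mu d) * real n powr (- s)"
      using n by (subst infsum_finite) (auto simp: sum_distrib_right)
    also have "\<dots> = (if n = 1 then 1 else 0)" using sum_moebius_divisors[OF n] by simp
    finally show "(\<Sum>\<^sub>\<infinity>d\<in>{d. d dvd n}. moebius_mu d * real n powr (- s)) = (if n = 1 then 1 else 0)" .
  qed
  also have "\<dots> = (\<Sum>\<^sub>\<infinity>n\<in>{1::nat}. 1)"
    by (rule infsum_cong_neutral) (auto simp: N_def)
  finally have "M * zeta_real s = 1" using 1 geq by simp
  hence M: "M = 1 / zeta_real s" using zeta_real_ge_1[OF s] by (simp add: field_simps)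
  have "((\<lambda>d. moebius_mu d * real d powr (- s)) has_sum M) N"
    unfolding M_def using m by (rule has_sum_infsum)
  also have "?this \<longleftrightarrow> ((\<lambda>n. moebius_mu (Suc n) * real (Suc n) powr (- s)) has_sum M) UNIV"
    by (rule has_sum_reindex_bij_witness[of _ Suc "\<lambda>n. n - 1"]) (auto simp: N_def)
  finally show ?thesis unfolding M by (rule has_sum_imp_sums)
qed

lemma suminf_swap_bounded:
  fixes f :: "nat \<Rightarrow> nat \<Rightarrow> real"
  assumes a: "summable a" "\<And>k. a k \<ge> 0" and b: "summable b" "\<And>n. b n \<ge> 0"
    and f: "\<And>k n. \<bar>f k n\<bar> \<le> a k * b n"
  shows "(\<Sum>k. \<Sum>n. f k n) = (\<Sum>n. \<Sum>k. f k n)" "summable (\<lambda>n. \<Sum>k. f k n)"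
proof -
  have as: "a summable_on UNIV" and bs: "b summable_on UNIV"
    using a b by (auto intro: summable_nonneg_imp_summable_on)
  have fs: "(\<lambda>(k, n). f k n) summable_on (UNIV \<times> UNIV)"
    using f a b by (intro summable_on_Times_bounded[OF as bs]) auto
  have "(\<lambda>(n, k). f k n) summable_on (UNIV \<times> UNIV)"
    using f a b by (intro summable_on_Times_bounded[OF bs as]) (auto simp: mult.commute)
  note fs' = this
  have k: "f k summable_on UNIV" for k
    using f by (intro abs_summable_summable[OF summable_on_comparison_test[OF summable_on_cmult_right[OF bs, of "a k"]]]) auto
  have n: "(\<lambda>k. f k n) summable_on UNIV" for n
    using f by (intro abs_summable_summable[OF summable_on_comparison_test[OF summable_on_cmult_left[OF as, of "b n"]]]) auto
  have sk: "(\<Sum>n. f k n) = infsum (f k) UNIV" for k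
    using has_sum_imp_sums[OF has_sum_infsum[OF k]] by (simp add: sums_iff)
  have sn: "(\<Sum>k. f k n) = infsum (\<lambda>k. f k n) UNIV" for n
    using has_sum_imp_sums[OF has_sum_infsum[OF n]] by (simp add: sums_iff)
  have S1: "(\<lambda>k. infsum (f k) UNIV) summable_on UNIV"
    using summable_on_Sigma_banach[OF fs] by simp
  have S2: "(\<lambda>n. infsum (\<lambda>k. f k n) UNIV) summable_on UNIV"
    using summable_on_Sigma_banach[OF fs'] by simp
  show "(\<Sum>k. \<Sum>n. f k n) = (\<Sum>n. \<Sum>k. f k n)"
    unfolding sk sn
    using has_sum_imp_sums[OF has_sum_infsum[OF S1]] has_sum_imp_sums[OF has_sum_infsum[OF S2]]
      infsum_swap_banach[OF fs] by (simp add: sums_iff)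
  show "summable (\<lambda>n. \<Sum>k. f k n)"
    unfolding sn using has_sum_imp_sums[OF has_sum_infsum[OF S2]] by (simp add: sums_iff)
qed

text \<open>Inserting 1/zeta(k+1) as the sum of mu(n) n^(-k-1) and exchanging the sums trades the
  zeta values in the coefficients for dilations v/n of one power series. With \<open>h 0 = 0\<close>
  all terms are dominated by 1/n^2; the term k = 0 would only have weight 1/n.\<close>

lemma moebius_power_series:
  fixes h :: "nat \<Rightarrow> real"
  assumes h: "summable (\<lambda>k. \<bar>h k\<bar> * \<bar>v\<bar> ^ k)" and h0: "h 0 = 0"
  shows "(\<lambda>n. moebius_mu (Suc n) / real (Suc n) * (\<Sum>k. h k * (v / real (Suc n)) ^ k)) sums
           (\<Sum>k. h k / zeta_real (real k + 1) * v ^ k)"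
proof -
  define f where "f = (\<lambda>k n. h k * v ^ k * (moebius_mu (Suc n) / real (Suc n) ^ (k + 1)))"
  have b: "summable (\<lambda>n. 1 / real (Suc n) ^ 2)"
    using summable_Suc_powr[of "- 2"] by (simp add: powr_minus powr_numeral divide_inverse)
  have f: "\<bar>f k n\<bar> \<le> (\<bar>h k\<bar> * \<bar>v\<bar> ^ k) * (1 / real (Suc n) ^ 2)" for k n
  proof (cases "k = 0")
    case False
    have "real (Suc n) ^ 2 \<le> real (Suc n) ^ (k + 1)" using False by (intro power_increasing) auto
    hence "\<bar>moebius_mu (Suc n)\<bar> / real (Suc n) ^ (k + 1) \<le> 1 / real (Suc n) ^ 2"
      using abs_moebius_le_1 by (intro frac_le) auto
    thus ?thesis unfolding f_def abs_mult abs_divide power_abs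
      by (intro mult_left_mono) auto
  qed (simp add: f_def h0)
  have "(\<Sum>n. f k n) = h k / zeta_real (real k + 1) * v ^ k" for k
  proof (cases "k = 0")
    case False
    have "moebius_mu (Suc n) * real (Suc n) powr (- (real k + 1)) = moebius_mu (Suc n) / real (Suc n) ^ (k + 1)" for n
    proof -
      have "real (Suc n) powr (real k + 1) = real (Suc n) ^ (k + 1)"
        using powr_realpow[of "real (Suc n)" "k + 1"] by (simp add: add.commute)
      thus ?thesis unfolding powr_minus by (simp only: divide_inverse)
    qed
    hence "(\<lambda>n. moebius_mu (Suc n) / real (Suc n) ^ (k + 1)) sums (1 / zeta_real (real k + 1))"
      using moebius_dirichlet_series[of "real k + 1"] False by simp
    from sums_mult[OF this, of "h k * v ^ k"] show ?thesis by (simp add: f_def sums_iff)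
  qed (simp add: f_def h0)
  moreover have "(\<Sum>k. f k n) = moebius_mu (Suc n) / real (Suc n) * (\<Sum>k. h k * (v / real (Suc n)) ^ k)" for n
  proof -
    have "summable (\<lambda>k. h k * (v / real (Suc n)) ^ k)"
    proof (rule summable_comparison_test'[OF h, of 0])
      fix k :: nat
      have "\<bar>v / real (Suc n)\<bar> \<le> \<bar>v\<bar> / 1" unfolding abs_divide by (intro frac_le) auto
      thus "norm (h k * (v / real (Suc n)) ^ k) \<le> \<bar>h k\<bar> * \<bar>v\<bar> ^ k"
        unfolding real_norm_def abs_mult power_abs by (intro mult_left_mono power_mono) auto
    qed
    from suminf_mult[OF this, of "moebius_mu (Suc n) / real (Suc n)"] show ?thesis
      unfolding f_def by (simp add: power_divide mult_ac)
  qed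
  ultimately show ?thesis
    using suminf_swap_bounded[OF h _ b _ f] by (simp add: sums_iff)
qed

section \<open>ERi on the negative real axis\<close>

text \<open>
  \<open>R_fun a u = ERi (- a u)\<close>, \<open>R_euler a u = u * R_fun' a u\<close> and \<open>R_dens a u = - R_euler' a u\<close>, all given by their
  power series in \<open>u\<close>.
\<close>

definition R_coeff :: "real \<Rightarrow> nat \<Rightarrow> real" where
  "R_coeff a k = (if k = 0 then 1 else (- a) ^ k / (real k * fact k * zeta_real (real k + 1)))"

definition R_fun :: "real \<Rightarrow> real \<Rightarrow> real" where
  "R_fun a u = (\<Sum>k. R_coeff a k * u ^ k)"

definition R_euler :: "real \<Rightarrow> real \<Rightarrow> real" where
  "R_euler a u = (\<Sum>k. (real k * R_coeff a k) * u ^ k)"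

definition R_dens_coeff :: "real \<Rightarrow> nat \<Rightarrow> real" where
  "R_dens_coeff a k = - (real (Suc k) * (real (Suc k) * R_coeff a (Suc k)))"

definition R_dens :: "real \<Rightarrow> real \<Rightarrow> real" where
  "R_dens a u = (\<Sum>k. R_dens_coeff a k * u ^ k)"

lemma R_euler_coeff:
  "real k * R_coeff a k = (if k = 0 then 0 else (- a) ^ k / fact k / zeta_real (real k + 1))"
  by (simp add: R_coeff_def)

lemma R_dens_coeff_eq:
  "R_dens_coeff a k = a * (- a) ^ k / fact k / zeta_real (real k + 2)"
proof -
  have "real (Suc k) + 1 = real k + 2" by simp
  thus ?thesis unfolding R_dens_coeff_def R_euler_coeff
    by (simp add: divide_simps del: of_nat_Suc) (simp add: algebra_simps)
qed

lemma abs_R_coeff_le: "\<bar>real k * R_coeff a k\<bar> \<le> \<bar>a\<bar> ^ k / fact k" "\<bar>R_coeff a k\<bar> \<le> \<bar>a\<bar> ^ k / fact k"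
proof -
  show 1: "\<bar>real k * R_coeff a k\<bar> \<le> \<bar>a\<bar> ^ k / fact k"
  proof (cases "k = 0")
    case False
    have "\<bar>a\<bar> ^ k / fact k / zeta_real (real k + 1) \<le> \<bar>a\<bar> ^ k / fact k / 1"
      using False zeta_real_ge_1[of "real k + 1"] by (intro divide_left_mono) auto
    moreover have "\<bar>zeta_real (real k + 1)\<bar> = zeta_real (real k + 1)"
      using False zeta_real_ge_1[of "real k + 1"] by simp
    ultimately show ?thesis using False
      unfolding R_euler_coeff by (simp add: power_abs)
  qed simp
  show "\<bar>R_coeff a k\<bar> \<le> \<bar>a\<bar> ^ k / fact k"
  proof (cases "k = 0")
    case False
    have "1 * \<bar>R_coeff a k\<bar> \<le> real k * \<bar>R_coeff a k\<bar>" using False by (intro mult_right_mono) auto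
    thus ?thesis using 1 by (simp add: abs_mult)
  qed (simp add: R_coeff_def)
qed

lemma abs_R_dens_coeff_le: "\<bar>R_dens_coeff a k\<bar> \<le> \<bar>a\<bar> * \<bar>a\<bar> ^ k / fact k"
proof -
  have "\<bar>a\<bar> * \<bar>a\<bar> ^ k / fact k / zeta_real (real k + 2) \<le> \<bar>a\<bar> * \<bar>a\<bar> ^ k / fact k / 1"
    using zeta_real_ge_1[of "real k + 2"] by (intro divide_left_mono) auto
  moreover have "\<bar>zeta_real (real k + 2)\<bar> = zeta_real (real k + 2)"
    using zeta_real_ge_1[of "real k + 2"] by simp
  ultimately show ?thesis unfolding R_dens_coeff_eq by (simp add: abs_mult power_abs)
qed

lemma summable_exp_bounded:
  fixes c :: "nat \<Rightarrow> real"
  assumes "\<And>k. \<bar>c k\<bar> \<le> C * b ^ k / fact k"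
  shows "summable (\<lambda>k. \<bar>c k\<bar> * \<bar>u\<bar> ^ k)" "summable (\<lambda>k. c k * u ^ k)"
proof -
  have "summable (\<lambda>k. C * ((b * \<bar>u\<bar>) ^ k / fact k))"
    using summable_exp[of "b * \<bar>u\<bar>"] by (intro summable_mult) (simp add: divide_inverse mult.commute)
  thus *: "summable (\<lambda>k. \<bar>c k\<bar> * \<bar>u\<bar> ^ k)"
  proof (rule summable_comparison_test'[of _ 0])
    fix k :: nat
    have "\<bar>c k\<bar> * \<bar>u\<bar> ^ k \<le> C * b ^ k / fact k * \<bar>u\<bar> ^ k" by (intro mult_right_mono assms) auto
    thus "norm (\<bar>c k\<bar> * \<bar>u\<bar> ^ k) \<le> C * ((b * \<bar>u\<bar>) ^ k / fact k)"
      by (simp add: power_mult_distrib)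
  qed
  show "summable (\<lambda>k. c k * u ^ k)"
    by (rule summable_norm_cancel) (use * in \<open>simp add: abs_mult power_abs\<close>)
qed

lemma summable_R_coeff: "summable (\<lambda>k. R_coeff a k * u ^ k)"
  and summable_R_euler: "summable (\<lambda>k. (real k * R_coeff a k) * u ^ k)"
  and summable_R_dens: "summable (\<lambda>k. R_dens_coeff a k * u ^ k)"
  and summable_abs_R_dens: "summable (\<lambda>k. \<bar>R_dens_coeff a k\<bar> * \<bar>u\<bar> ^ k)"
  using summable_exp_bounded(2)[of "R_coeff a" 1 "\<bar>a\<bar>" u] abs_R_coeff_le(2)[of a]
    summable_exp_bounded(2)[of "\<lambda>k. real k * R_coeff a k" 1 "\<bar>a\<bar>" u] abs_R_coeff_le(1)[of _ a]
    summable_exp_bounded[of "R_dens_coeff a" "\<bar>a\<bar>" "\<bar>a\<bar>" u] abs_R_dens_coeff_le[of a]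
  by simp_all

section \<open>Derivatives and Moebius expansions of the power series\<close>

lemma has_derivative_R_fun:
  assumes "u \<noteq> 0"
  shows "(R_fun a has_real_derivative R_euler a u / u) (at u)"
proof -
  have d: "((\<lambda>u. \<Sum>k. R_coeff a k * u ^ k) has_real_derivative (\<Sum>k. diffs (R_coeff a) k * u ^ k)) (at u)"
    by (rule termdiffs_strong_converges_everywhere) (rule summable_R_coeff)
  have "summable (\<lambda>k. diffs (R_coeff a) k * u ^ k)"
    by (rule termdiff_converges_all) (rule summable_R_coeff)
  from sums_mult[OF diffs_equiv[OF this], of u]
  have "(\<lambda>k. u * (real k * R_coeff a k * u ^ (k - Suc 0))) sums (u * (\<Sum>k. diffs (R_coeff a) k * u ^ k))"
    by simp
  moreover have "u * (real k * R_coeff a k * u ^ (k - Suc 0)) = (real k * R_coeff a k) * u ^ k" for k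
    by (cases k) auto
  ultimately have "R_euler a u = u * (\<Sum>k. diffs (R_coeff a) k * u ^ k)"
    by (simp add: R_euler_def sums_iff)
  thus ?thesis using d assms by (simp add: R_fun_def[abs_def])
qed

lemma has_derivative_R_euler: "(R_euler a has_real_derivative - R_dens a u) (at u)"
proof -
  have "((\<lambda>u. \<Sum>k. (real k * R_coeff a k) * u ^ k) has_real_derivative
           (\<Sum>k. diffs (\<lambda>k. real k * R_coeff a k) k * u ^ k)) (at u)"
    by (rule termdiffs_strong_converges_everywhere) (rule summable_R_euler)
  also have "(\<Sum>k. diffs (\<lambda>k. real k * R_coeff a k) k * u ^ k) = - R_dens a u"
    unfolding R_dens_def
    by (subst suminf_minus[symmetric]) (rule summable_R_dens, simp add: R_dens_coeff_def diffs_def)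
  finally show ?thesis by (simp add: R_euler_def[abs_def])
qed

lemma continuous_R_fun: "continuous_on A (R_fun a)"
proof -
  have "isCont (R_fun a) u" for u
    unfolding R_fun_def[abs_def]
    by (rule DERIV_isCont[OF termdiffs_strong_converges_everywhere]) (rule summable_R_coeff)
  thus ?thesis by (simp add: continuous_at_imp_continuous_on)
qed

text \<open>Here \<open>h\<close> holds the coefficients of exp(-y) - 1. The -1 reflects the missing
  constant term of \<open>R_euler\<close> and makes the summands O(1/n^2) for fixed u.\<close>

lemma R_euler_moebius:
  "(\<lambda>n. moebius_mu (Suc n) / real (Suc n) * (exp (- (a * u / real (Suc n))) - 1)) sums R_euler a u"
proof -
  define h where "h = (\<lambda>k. if k = 0 then 0 else (- 1) ^ k / fact k :: real)"
  have "(\<lambda>n. moebius_mu (Suc n) / real (Suc n) * (\<Sum>k. h k * (a * u / real (Suc n)) ^ k)) sums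
           (\<Sum>k. h k / zeta_real (real k + 1) * (a * u) ^ k)"
    by (rule moebius_power_series[OF summable_exp_bounded(1)[of _ 1 1]]) (auto simp: h_def power_abs)
  also have "(\<Sum>k. h k / zeta_real (real k + 1) * (a * u) ^ k) = R_euler a u"
    unfolding R_euler_def R_euler_coeff
    by (intro suminf_cong) (auto simp: h_def power_mult_distrib power_minus[of a])
  finally have 1: "(\<lambda>n. moebius_mu (Suc n) / real (Suc n) * (\<Sum>k. h k * (a * u / real (Suc n)) ^ k)) sums R_euler a u" .
  have 2: "(\<Sum>k. h k * y ^ k) = exp (- y) - 1" for y
  proof -
    have "(\<lambda>k. (- y) ^ k /\<^sub>R fact k) sums exp (- y)" by (rule exp_converges)
    hence "(\<lambda>k. (- y) ^ k / fact k) sums exp (- y)" by (simp add: divide_inverse mult.commute)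
    from sums_diff[OF this sums_single[of 0 "\<lambda>_. 1"]]
    have "(\<lambda>k. (- y) ^ k / fact k - (if k = 0 then 1 else 0)) sums (exp (- y) - 1)" .
    moreover have "(- y) ^ k / fact k - (if k = 0 then 1 else 0) = h k * y ^ k" for k
      by (simp add: h_def power_minus[of y])
    ultimately show ?thesis by (simp add: sums_iff)
  qed
  show ?thesis using 1 unfolding 2 .
qed

text \<open>The density has a nonzero constant term, so \<open>moebius_power_series\<close> is
  applied to u times the density, with \<open>h\<close> the coefficients of y exp(-y); dividing by u
  afterwards requires u > 0.\<close>

lemma R_dens_moebius:
  assumes "u > 0"
  shows "(\<lambda>n. moebius_mu (Suc n) / real (Suc n) ^ 2 * a * exp (- (a * u / real (Suc n)))) sums R_dens a u"
proof -
  define h where "h = (\<lambda>k. if k = 0 then 0 else (- 1) ^ (k - 1) / fact (k - 1) :: real)"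
  have h: "\<bar>h k\<bar> \<le> 1 * 2 ^ k / fact k" for k
  proof (cases k)
    case (Suc j)
    have "real (Suc j) \<le> 2 ^ Suc j" using less_exp[of "Suc j"] by (metis less_imp_le of_nat_le_iff of_nat_numeral of_nat_power)
    hence "real (Suc j) / fact (Suc j) \<le> 2 ^ Suc j / fact (Suc j)" by (intro divide_right_mono) auto
    thus ?thesis by (simp add: h_def Suc power_abs)
  qed (simp add: h_def)
  have "(\<lambda>n. moebius_mu (Suc n) / real (Suc n) * (\<Sum>k. h k * (a * u / real (Suc n)) ^ k)) sums
           (\<Sum>k. h k / zeta_real (real k + 1) * (a * u) ^ k)"
    by (rule moebius_power_series[OF summable_exp_bounded(1)[OF h]]) (simp add: h_def)
  also have "(\<Sum>k. h k / zeta_real (real k + 1) * (a * u) ^ k) = u * R_dens a u"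
  proof -
    have "(\<lambda>k. u * (R_dens_coeff a k * u ^ k)) sums (u * R_dens a u)"
      unfolding R_dens_def by (intro sums_mult summable_sums summable_R_dens)
    also have "(\<lambda>k. u * (R_dens_coeff a k * u ^ k)) =
        (\<lambda>k. h (Suc k) / zeta_real (real (Suc k) + 1) * (a * u) ^ Suc k)"
      by (rule ext) (simp add: R_dens_coeff_eq h_def power_mult_distrib power_minus[of a] add_ac)
    finally have "(\<lambda>k. h k / zeta_real (real k + 1) * (a * u) ^ k) sums (u * R_dens a u + h 0 / zeta_real (real 0 + 1) * (a * u) ^ 0)"
      by (rule sums_Suc)
    thus ?thesis by (simp add: sums_iff h_def)
  qed
  finally have 1: "(\<lambda>n. moebius_mu (Suc n) / real (Suc n) * (\<Sum>k. h k * (a * u / real (Suc n)) ^ k)) sums (u * R_dens a u)" .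
  have 2: "(\<Sum>k. h k * y ^ k) = y * exp (- y)" for y
  proof -
    have "(\<lambda>k. (- y) ^ k /\<^sub>R fact k) sums exp (- y)" by (rule exp_converges)
    hence "(\<lambda>k. y * ((- y) ^ k / fact k)) sums (y * exp (- y))"
      by (intro sums_mult) (simp add: divide_inverse mult.commute)
    also have "(\<lambda>k. y * ((- y) ^ k / fact k)) = (\<lambda>k. h (Suc k) * y ^ Suc k)"
      by (rule ext) (simp add: h_def power_minus[of y])
    finally have "(\<lambda>k. h k * y ^ k) sums (y * exp (- y) + h 0 * y ^ 0)" by (rule sums_Suc)
    thus ?thesis by (simp add: sums_iff h_def)
  qed
  have "(\<lambda>n. 1 / u * (moebius_mu (Suc n) / real (Suc n) * (a * u / real (Suc n) * exp (- (a * u / real (Suc n))))))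
      sums (1 / u * (u * R_dens a u))" using 1 unfolding 2 by (rule sums_mult)
  moreover have "1 / u * (moebius_mu (Suc n) / real (Suc n) * (a * u / real (Suc n) * e))
      = moebius_mu (Suc n) / real (Suc n) ^ 2 * a * e" for n e
    using assms by (simp add: power2_eq_square del: of_nat_Suc)
  ultimately show ?thesis using assms by simp
qed

text \<open>The left side is at most min 1 w, and w powr d lies above w for w <= 1 and above 1 for w
  > 1.\<close>

lemma one_minus_exp_le_powr:
  fixes w d :: real
  assumes "w > 0" "0 < d" "d \<le> 1"
  shows "\<bar>exp (- w) - 1\<bar> \<le> w powr d"
proof -
  have e: "\<bar>exp (- w) - 1\<bar> \<le> min 1 w" using assms exp_ge_add_one_self[of "- w"] by (auto simp: abs_if)
  also have "\<dots> \<le> w powr d"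
  proof (cases "w \<le> 1")
    case True
    have "w powr 1 \<le> w powr d" using True assms by (intro powr_mono') auto
    thus ?thesis using True assms by simp
  next
    case False
    thus ?thesis using ge_one_powr_ge_zero[of w d] assms by simp
  qed
  finally show ?thesis .
qed

text \<open>Spending w powr d on each summand leaves the series of n^(-1-d), which converges because
  d > 0; this is the source of the constant a^d zeta(1+d).\<close>

lemma R_euler_bound:
  assumes a: "a > 0" and d: "0 < d" "d \<le> 1"
  shows "\<exists>C\<ge>0. \<forall>u>0. \<bar>R_euler a u\<bar> \<le> C * u powr d"
proof (intro exI conjI allI impI)
  have z: "zeta_real (1 + d) \<ge> 1" using d by (intro zeta_real_ge_1) auto
  show "0 \<le> a powr d * zeta_real (1 + d)" using z by simp
  fix u :: real assume u: "u > 0"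
  have sm: "(\<lambda>n. real (Suc n) powr (- (1 + d))) sums zeta_real (1 + d)"
    unfolding zeta_real_def using d by (intro summable_sums summable_Suc_powr) auto
  note sm' = sums_mult[OF sm, of "(a * u) powr d"]
  have le: "norm (moebius_mu (Suc n) / real (Suc n) * (exp (- (a * u / real (Suc n))) - 1))
      \<le> (a * u) powr d * real (Suc n) powr (- (1 + d))" for n
  proof -
    have "norm (moebius_mu (Suc n) / real (Suc n) * (exp (- (a * u / real (Suc n))) - 1))
        \<le> 1 / real (Suc n) * (a * u / real (Suc n)) powr d"
      unfolding real_norm_def abs_mult abs_divide
      using abs_moebius_le_1 a u d by (intro mult_mono frac_le one_minus_exp_le_powr) auto
    also have "\<dots> = (a * u) powr d * real (Suc n) powr (- (1 + d))"
    proof -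
      have "real (Suc n) powr (- (1 + d)) = 1 / (real (Suc n) * real (Suc n) powr d)"
        unfolding powr_minus powr_add by (simp add: inverse_eq_divide)
      thus ?thesis using a u by (simp add: powr_divide)
    qed
    finally show ?thesis .
  qed
  have "norm (\<Sum>n. moebius_mu (Suc n) / real (Suc n) * (exp (- (a * u / real (Suc n))) - 1))
      \<le> (\<Sum>n. (a * u) powr d * real (Suc n) powr (- (1 + d)))"
    by (rule norm_suminf_le[OF le sums_summable[OF sm']])
  thus "\<bar>R_euler a u\<bar> \<le> a powr d * zeta_real (1 + d) * u powr d"
    using sums_unique[OF R_euler_moebius[of a u]] sums_unique[OF sm'] a u by (simp add: powr_mult mult_ac)
qed

lemma ERi_eq_R_fun: "ERi (of_real (- (a * u))) = of_real (R_fun a u)"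
proof -
  have "(\<lambda>k. R_coeff a k * u ^ k) sums R_fun a u"
    unfolding R_fun_def by (intro summable_sums summable_R_coeff)
  hence "(\<lambda>k. R_coeff a (Suc k) * u ^ Suc k) sums (R_fun a u - R_coeff a 0 * u ^ 0)"
    by (subst sums_Suc_iff) simp
  hence "(\<lambda>k. R_coeff a (Suc k) * u ^ Suc k) sums (R_fun a u - 1)"
    by (simp add: R_coeff_def[of a 0])
  hence "(\<lambda>k. complex_of_real (R_coeff a (Suc k) * u ^ Suc k)) sums of_real (R_fun a u - 1)"
    by (rule sums_of_real)
  moreover have "complex_of_real (R_coeff a (Suc k) * u ^ Suc k)
      = of_real (- (a * u)) ^ Suc k / (of_nat (Suc k) * fact (Suc k) * riemann_zeta (of_nat (Suc k) + 1))" for k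
  proof -
    have "riemann_zeta (of_nat (Suc k) + 1) = of_real (zeta_real (real (Suc k) + 1))"
      using riemann_zeta_of_real[of "real (Suc k) + 1"] by simp
    moreover have "R_coeff a (Suc k) * u ^ Suc k
        = (- (a * u)) ^ Suc k / (real (Suc k) * fact (Suc k) * zeta_real (real (Suc k) + 1))"
      by (simp add: R_coeff_def power_mult_distrib power_minus[of "a * u"] power_minus[of a] del: of_nat_Suc fact_Suc power_Suc)
    ultimately show ?thesis
      by (simp only: of_real_divide of_real_mult of_real_power of_real_of_nat_eq of_real_fact)
  qed
  ultimately show ?thesis unfolding ERi_def by (simp only: sums_iff) simp
qed

section \<open>The Mellin transform\<close>

lemma has_bochner_integral_nonneg_has_integral:
  fixes f :: "real \<Rightarrow> real"
  assumes "(f has_integral I) A" "\<And>x. 0 \<le> f x" "f \<in> borel_measurable borel" "A \<in> sets borel"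
  shows "has_bochner_integral lborel (\<lambda>x. indicator A x * f x) I"
proof (rule has_bochner_integral_nn_integral)
  show "(\<integral>\<^sup>+x. ennreal (indicator A x * f x) \<partial>lborel) = ennreal I"
    by (rule nn_integral_has_integral_lebesgue[OF assms(2,1)])
  show "0 \<le> I" using has_integral_nonneg[OF assms(1)] assms(2) by simp
  show "(\<lambda>x. indicator A x * f x) \<in> borel_measurable lborel"
    using assms(3,4) by measurable
qed (use assms in auto)

lemma has_bochner_integral_Gamma_scaled:
  fixes s b :: real
  assumes s: "s > 0" and b: "b > 0"
  shows "has_bochner_integral lborel (\<lambda>u. indicator {0..} u * (exp (- (b * u)) * u powr (s - 1)))
           (b powr (- s) * Gamma s)"
proof -
  have "has_bochner_integral lborel (\<lambda>t. indicator {0..} t * (t powr (s - 1) / exp t)) (Gamma s)"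
    by (rule has_bochner_integral_nonneg_has_integral[OF Gamma_integral_real[OF s]]) auto
  hence "has_bochner_integral lborel (\<lambda>u. indicator {0..} (0 + b * u) * ((0 + b * u) powr (s - 1) / exp (0 + b * u)))
           (Gamma s /\<^sub>R \<bar>b\<bar>)"
    using b by (subst (asm) lborel_has_bochner_integral_real_affine_iff[of b _ _ 0]) auto
  from has_bochner_integral_mult_right[OF this, of "b powr (1 - s)"]
  have "has_bochner_integral lborel (\<lambda>u. b powr (1 - s) * (indicator {0..} (b * u) * ((b * u) powr (s - 1) / exp (b * u))))
           (b powr (1 - s) * (Gamma s /\<^sub>R \<bar>b\<bar>))" by simp
  also have "b powr (1 - s) * (Gamma s /\<^sub>R \<bar>b\<bar>) = b powr (- s) * Gamma s"
    using b by (simp add: powr_diff powr_minus field_simps)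
  also have "(\<lambda>u. b powr (1 - s) * (indicator {0..} (b * u) * ((b * u) powr (s - 1) / exp (b * u))))
      = (\<lambda>u. indicator {0..} u * (exp (- (b * u)) * u powr (s - 1)))"
  proof
    fix u :: real
    show "b powr (1 - s) * (indicator {0..} (b * u) * ((b * u) powr (s - 1) / exp (b * u)))
      = indicator {0..} u * (exp (- (b * u)) * u powr (s - 1))"
    proof (cases "u \<ge> 0")
      case True
      have "b powr (1 - s) * b powr (s - 1) = 1" using b by (simp flip: powr_add)
      hence "b powr (1 - s) * (b * u) powr (s - 1) = u powr (s - 1)"
        using b True by (simp add: powr_mult mult.assoc[symmetric])
      thus ?thesis using b True by (simp add: exp_minus field_simps)
    next
      case False
      hence "\<not> b * u \<ge> 0" using b by (simp add: zero_le_mult_iff)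
      thus ?thesis using False by (simp add: indicator_def)
    qed
  qed
  finally show ?thesis .
qed

lemma has_bochner_integral_suminf:
  fixes F :: "nat \<Rightarrow> real \<Rightarrow> real"
  assumes F: "\<And>n. has_bochner_integral lborel (F n) (I n)"
    and N: "\<And>n. has_bochner_integral lborel (\<lambda>x. \<bar>F n x\<bar>) (J n)" "summable J"
    and sm: "\<And>x. summable (\<lambda>n. \<bar>F n x\<bar>)" and S: "\<And>x. (\<lambda>n. F n x) sums S x"
  shows "has_bochner_integral lborel S (\<Sum>n. I n)"
proof -
  have eq: "S = (\<lambda>x. \<Sum>n. F n x)" using S by (auto simp: sums_iff)
  have int: "integrable lborel (F n)" for n using F has_bochner_integral_iff by blast
  have ae: "AE x in lborel. summable (\<lambda>n. norm (F n x))" using sm by simp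
  have sj: "summable (\<lambda>n. \<integral>x. norm (F n x) \<partial>lborel)"
    using N(2) has_bochner_integral_integral_eq[OF N(1)] by simp
  show ?thesis
    unfolding eq has_bochner_integral_iff
    using integrable_suminf[OF int ae sj] integral_suminf[OF int ae sj]
      has_bochner_integral_integral_eq[OF F] by simp
qed

text \<open>Termwise, exp(-a u / n) contributes (a/n)^(s-2) Gamma(2-s); with the weight a mu(n)/n^2
  the powers of n combine to n^(-s). Here s < 2 gives convergence at u = 0 and s > 1 absolute
  convergence of the sum.\<close>

lemma mellin_R_dens:
  assumes a: "a > 0" and s: "1 < s" "s < 2"
  shows "has_bochner_integral lborel (\<lambda>u. indicator {0..} u * (R_dens a u * u powr (1 - s)))
           (a powr (s - 1) * Gamma (2 - s) / zeta_real s)"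
proof -
  define E where "E = (\<lambda>n u. indicator {0..} u * (exp (- (a / real (Suc n) * u)) * u powr (1 - s)) :: real)"
  define c where "c = (\<lambda>n. moebius_mu (Suc n) / real (Suc n) ^ 2 * a)"
  define J where "J = (\<lambda>n. (a / real (Suc n)) powr (- (2 - s)) * Gamma (2 - s))"
  have E: "has_bochner_integral lborel (E n) (J n)" for n
    using has_bochner_integral_Gamma_scaled[of "2 - s" "a / real (Suc n)"] a s
    unfolding E_def J_def by simp
  have E0: "E n u \<ge> 0" for n u by (simp add: E_def indicator_def)
  have cJ: "c n * J n = a powr (s - 1) * Gamma (2 - s) * (moebius_mu (Suc n) * real (Suc n) powr (- s))" for n
  proof -
    have 1: "(a / real (Suc n)) powr (- (2 - s)) = a powr (s - 2) / real (Suc n) powr (s - 2)"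
      using a by (subst powr_divide) auto
    have 2: "a * a powr (s - 2) = a powr (s - 1)"
      using a powr_add[of a 1 "s - 2"] by simp
    have 3: "real (Suc n) ^ 2 * real (Suc n) powr (s - 2) = real (Suc n) powr s"
      using powr_add[of "real (Suc n)" 2 "s - 2"] powr_realpow[of "real (Suc n)" 2] by simp
    have "c n * J n = moebius_mu (Suc n) * (a * a powr (s - 2)) * Gamma (2 - s)
        / (real (Suc n) ^ 2 * real (Suc n) powr (s - 2))"
      unfolding c_def J_def 1 by (simp only: times_divide_times_eq times_divide_eq_left times_divide_eq_right
          divide_divide_eq_left mult_ac)
    hence "c n * J n = moebius_mu (Suc n) * a powr (s - 1) * Gamma (2 - s) / real (Suc n) powr s"
      unfolding 2 3 .
    thus ?thesis by (simp add: powr_minus_divide mult_ac)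
  qed
  have J0: "J n \<ge> 0" for n using s by (simp add: J_def Gamma_real_pos less_imp_le)
  have "has_bochner_integral lborel (\<lambda>u. indicator {0..} u * (R_dens a u * u powr (1 - s))) (\<Sum>n. c n * J n)"
  proof (rule has_bochner_integral_suminf)
    show "has_bochner_integral lborel (\<lambda>u. c n * E n u) (c n * J n)" for n
      using has_bochner_integral_mult_right[OF E[of n], of "c n"] by simp
    show "has_bochner_integral lborel (\<lambda>u. \<bar>c n * E n u\<bar>) (\<bar>c n\<bar> * J n)" for n
      using has_bochner_integral_mult_right[OF E[of n], of "\<bar>c n\<bar>"] E0 by (simp add: abs_mult)
    have "\<bar>c n\<bar> * J n \<le> a powr (s - 1) * Gamma (2 - s) * real (Suc n) powr (- s)" for n
    proof -
      have g: "0 < Gamma (2 - s)" using s by (intro Gamma_real_pos) auto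
      have "\<bar>c n\<bar> * J n = \<bar>c n * J n\<bar>" using J0 by (simp add: abs_mult)
      also have "\<dots> = a powr (s - 1) * Gamma (2 - s) * (\<bar>moebius_mu (Suc n)\<bar> * real (Suc n) powr (- s))"
        unfolding cJ using g by (simp add: abs_mult)
      also have "\<dots> \<le> a powr (s - 1) * Gamma (2 - s) * (1 * real (Suc n) powr (- s))"
        using g by (intro mult_left_mono mult_right_mono abs_moebius_le_1) auto
      finally show ?thesis by simp
    qed
    thus "summable (\<lambda>n. \<bar>c n\<bar> * J n)"
      using s J0 by (intro summable_comparison_test'[OF summable_mult[OF summable_Suc_powr[of "- s"]], of 0]) auto
    fix u :: real
    show "summable (\<lambda>n. \<bar>c n * E n u\<bar>)"
    proof (rule summable_comparison_test'[OF summable_mult[OF summable_Suc_powr[of "- 2"]], of 0])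
      fix n :: nat
      have "\<bar>c n\<bar> \<le> a * real (Suc n) powr (- 2)"
      proof -
        have "\<bar>c n\<bar> = \<bar>moebius_mu (Suc n)\<bar> * (a * real (Suc n) powr (- 2))"
          using a powr_realpow[of "real (Suc n)" 2]
          unfolding c_def powr_minus abs_mult abs_divide by (simp add: field_simps)
        also have "\<dots> \<le> 1 * (a * real (Suc n) powr (- 2))"
          using a by (intro mult_right_mono abs_moebius_le_1) auto
        finally show ?thesis by simp
      qed
      moreover have "E n u \<le> u powr (1 - s)"
      proof (cases "u \<ge> 0")
        case True
        have "exp (- (a / real (Suc n) * u)) \<le> 1" using a True by simp
        thus ?thesis using True by (simp add: E_def mult_left_le_one_le)
      qed (simp add: E_def)
      ultimately have "\<bar>c n\<bar> * E n u \<le> (a * real (Suc n) powr (- 2)) * u powr (1 - s)"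
        using E0 a by (intro mult_mono) auto
      thus "norm \<bar>c n * E n u\<bar> \<le> a * u powr (1 - s) * real (Suc n) powr (- 2)"
        using E0[of n u] by (simp add: abs_mult mult_ac)
    qed simp
    show "(\<lambda>n. c n * E n u) sums (indicator {0..} u * (R_dens a u * u powr (1 - s)))"
    \<comment> \<open>The point u = 0 is harmless because 0 powr x = 0, so both sides vanish
      there.\<close>
    proof (cases "u > 0")
      case True
      show ?thesis using sums_mult2[OF R_dens_moebius[OF True, of a], of "u powr (1 - s)"] True
        by (simp add: c_def E_def mult_ac)
    qed (auto simp: E_def indicator_def)
  qed
  also have "(\<Sum>n. c n * J n) = a powr (s - 1) * Gamma (2 - s) / zeta_real s"
    using sums_mult[OF moebius_dirichlet_series[OF s(1)], of "a powr (s - 1) * Gamma (2 - s)"]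
    unfolding cJ by (simp add: sums_iff)
  finally show ?thesis .
qed

text \<open>The power series is integrated termwise. The resulting sum makes sense for all complex s
  with Re s < 2, so only the integral over u >= 1 is left to continue.\<close>

lemma mellin_R_dens_unit_interval:
  assumes s: "s < 2"
  shows "has_bochner_integral lborel (\<lambda>u. indicator {0..1} u * (R_dens a u * u powr (1 - s)))
           (\<Sum>k. R_dens_coeff a k / (real k + 2 - s))"
proof -
  define P where "P = (\<lambda>k u. indicator {0..1} u * u powr (real k + 1 - s) :: real)"
  have P: "has_bochner_integral lborel (P k) (1 / (real k + 2 - s))" for k
  proof -
    have "((\<lambda>u. u powr (real k + 1 - s)) has_integral (1 powr (real k + 1 - s + 1) / (real k + 1 - s + 1))) {0..1}"
      using s by (intro has_integral_powr_from_0) auto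
    from has_bochner_integral_nonneg_has_integral[OF this] show ?thesis
      unfolding P_def by (simp add: algebra_simps)
  qed
  have P0: "P k u \<ge> 0" for k u by (simp add: P_def indicator_def)
  have "has_bochner_integral lborel (\<lambda>u. indicator {0..1} u * (R_dens a u * u powr (1 - s)))
      (\<Sum>k. R_dens_coeff a k * (1 / (real k + 2 - s)))"
  proof (rule has_bochner_integral_suminf)
    show "has_bochner_integral lborel (\<lambda>u. R_dens_coeff a k * P k u) (R_dens_coeff a k * (1 / (real k + 2 - s)))" for k
      using has_bochner_integral_mult_right[OF P[of k], of "R_dens_coeff a k"] by simp
    show "has_bochner_integral lborel (\<lambda>u. \<bar>R_dens_coeff a k * P k u\<bar>) (\<bar>R_dens_coeff a k\<bar> * (1 / (real k + 2 - s)))" for k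
      using has_bochner_integral_mult_right[OF P[of k], of "\<bar>R_dens_coeff a k\<bar>"] P0 by (simp add: abs_mult)
    show "summable (\<lambda>k. \<bar>R_dens_coeff a k\<bar> * (1 / (real k + 2 - s)))"
    proof (rule summable_comparison_test'[OF summable_mult2[OF summable_abs_R_dens[of a 1]], of 0])
      show "norm (\<bar>R_dens_coeff a k\<bar> * (1 / (real k + 2 - s))) \<le> \<bar>R_dens_coeff a k\<bar> * \<bar>1\<bar> ^ k * (1 / (2 - s))" for k
        using s unfolding real_norm_def abs_mult by (auto intro!: mult_left_mono frac_le)
    qed
    fix u :: real
    show "summable (\<lambda>k. \<bar>R_dens_coeff a k * P k u\<bar>)"
    proof (rule summable_comparison_test'[OF summable_mult2[OF summable_abs_R_dens[of a 1]], of 0])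
      fix k
      have "P k u \<le> u powr (1 - s)"
        by (cases "u \<in> {0..1}") (auto simp: P_def intro!: powr_mono')
      thus "norm \<bar>R_dens_coeff a k * P k u\<bar> \<le> \<bar>R_dens_coeff a k\<bar> * \<bar>1\<bar> ^ k * u powr (1 - s)"
        using P0[of k u] by (simp add: abs_mult mult_left_mono)
    qed
    show "(\<lambda>k. R_dens_coeff a k * P k u) sums (indicator {0..1} u * (R_dens a u * u powr (1 - s)))"
    proof (cases "u \<in> {0<..1}")
      case True
      have "(\<lambda>k. R_dens_coeff a k * u ^ k * u powr (1 - s)) sums (R_dens a u * u powr (1 - s))"
        unfolding R_dens_def by (intro sums_mult2 summable_sums summable_R_dens)
      moreover have "u powr (real k + 1 - s) = u ^ k * u powr (1 - s)" for k
        using True powr_add[of u "real k" "1 - s"] by (simp add: powr_realpow add_diff_eq)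
      ultimately show ?thesis using True by (simp add: P_def mult_ac)
    qed (auto simp: P_def indicator_def)
  qed
  thus ?thesis by simp
qed

text \<open>The part over u >= 1 is the full Mellin integral minus the unit interval. Integer
  endpoints are taken because they are to be matched with partial sums.\<close>

lemma integral_R_dens_tendsto:
  assumes a: "a > 0" and s: "1 < s" "s < 2"
  shows "(\<lambda>N. integral {1..real N} (\<lambda>u. R_dens a u * u powr (1 - s))) \<longlonglongrightarrow>
     a powr (s - 1) * Gamma (2 - s) / zeta_real s - (\<Sum>k. R_dens_coeff a k / (real k + 2 - s))"
proof -
  define G where "G = (\<lambda>u. R_dens a u * u powr (1 - s))"
  have int: "set_integrable lborel {0..} G"
    and T: "(LINT u:{0..}|lborel. G u) = a powr (s - 1) * Gamma (2 - s) / zeta_real s"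
    using mellin_R_dens[OF a s]
    by (auto simp: set_integrable_def set_lebesgue_integral_def G_def has_bochner_integral_iff)
  have int1: "set_integrable lborel {0..b} G" for b
    by (rule set_integrable_subset[OF int]) auto
  have T1: "integral {0..1} G = (\<Sum>k. R_dens_coeff a k / (real k + 2 - s))"
    using mellin_R_dens_unit_interval[OF s(2), of a] set_borel_integral_eq_integral(2)[OF int1[of 1]]
    by (auto simp: set_lebesgue_integral_def G_def has_bochner_integral_iff)
  have "((\<lambda>b. LINT u:{0..b}|lborel. G u) \<longlongrightarrow> (LINT u:{0..}|lborel. G u)) at_top"
    by (rule tendsto_set_lebesgue_integral_at_top) (use int in auto)
  from filterlim_compose[OF this filterlim_real_sequentially]
  have "(\<lambda>N. integral {0..real N} G) \<longlonglongrightarrow> a powr (s - 1) * Gamma (2 - s) / zeta_real s"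
    unfolding T by (simp add: set_borel_integral_eq_integral(2)[OF int1])
  from tendsto_diff[OF this tendsto_const[of "integral {0..1} G"]]
  have "(\<lambda>N. integral {0..real N} G - integral {0..1} G) \<longlonglongrightarrow>
      a powr (s - 1) * Gamma (2 - s) / zeta_real s - (\<Sum>k. R_dens_coeff a k / (real k + 2 - s))"
    unfolding T1 .
  moreover have "eventually (\<lambda>N. integral {0..real N} G - integral {0..1} G = integral {1..real N} G) sequentially"
    using eventually_ge_at_top[of 1]
  proof eventually_elim
    case (elim N)
    have "integral {0..1} G + integral {1..real N} G = integral {0..real N} G"
      using elim set_borel_integral_eq_integral(1)[OF int1[of "real N"]]
      by (intro Henstock_Kurzweil_Integration.integral_combine) auto
    thus ?case by simp
  qed
  ultimately show ?thesis unfolding G_def by (rule Lim_transform_eventually)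
qed

section \<open>Continuation under a bound on the partial sums\<close>

text \<open>The derivative \<open>R_euler a u / u\<close> is O(u powr (d - 1)), which integrates to
  O(u powr d). The integration is replaced by monotonicity of \<open>G\<close>, and the sign
  \<open>e\<close> yields the upper and the lower bound together.\<close>

lemma R_fun_bound:
  assumes a: "a > 0" and d: "0 < d" "d \<le> 1"
  shows "\<exists>C\<ge>0. \<forall>u\<ge>1. \<bar>R_fun a u\<bar> \<le> C * u powr d"
proof -
  obtain C where C: "C \<ge> 0" "\<And>u. u > 0 \<Longrightarrow> \<bar>R_euler a u\<bar> \<le> C * u powr d"
    using R_euler_bound[OF assms] by blast
  have main: "e * R_fun a u \<le> (\<bar>R_fun a 1\<bar> + C / d) * u powr d" if u: "u \<ge> 1" and e: "\<bar>e\<bar> = 1" for u e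
  proof -
    define G where "G = (\<lambda>u. C / d * u powr d - e * R_fun a u)"
    have "G 1 \<le> G u"
    proof (rule DERIV_nonneg_imp_nondecreasing[OF u])
      fix v :: real assume v: "1 \<le> v" "v \<le> u"
      have "(G has_real_derivative (C / d * (d * v powr (d - 1)) - e * (R_euler a v / v))) (at v)"
        unfolding G_def using v by (intro DERIV_diff DERIV_cmult has_derivative_R_fun has_real_derivative_powr) auto
      moreover have "e * (R_euler a v / v) \<le> C / d * (d * v powr (d - 1))"
      proof -
        have "e * R_euler a v \<le> \<bar>e * R_euler a v\<bar>" by simp
        also have "\<dots> \<le> C * v powr d" using C(2)[of v] v e by (simp add: abs_mult)
        finally have "e * R_euler a v / v \<le> C * v powr d / v" using v by (intro divide_right_mono) auto
        also have "\<dots> = C / d * (d * v powr (d - 1))" using v d by (simp add: powr_diff)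
        finally show ?thesis by simp
      qed
      ultimately show "\<exists>y. (G has_real_derivative y) (at v) \<and> 0 \<le> y" by force
    qed
    hence "e * R_fun a u \<le> e * R_fun a 1 - C / d + C / d * u powr d" by (simp add: G_def)
    also have "e * R_fun a 1 - C / d \<le> \<bar>R_fun a 1\<bar>"
    proof -
      have "e * R_fun a 1 \<le> \<bar>e * R_fun a 1\<bar>" by simp
      moreover have "0 \<le> C / d" using C d by simp
      ultimately show ?thesis using e by (simp add: abs_mult)
    qed
    also have "\<bar>R_fun a 1\<bar> \<le> \<bar>R_fun a 1\<bar> * u powr d"
      using mult_left_mono[OF ge_one_powr_ge_zero[OF u, of d], of "\<bar>R_fun a 1\<bar>"] d by simp
    finally show ?thesis by (simp add: distrib_right)
  qed
  have "\<bar>R_fun a u\<bar> \<le> (\<bar>R_fun a 1\<bar> + C / d) * u powr d" if u: "u \<ge> 1" for u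
    using main[OF u, of 1] main[OF u, of "-1"] by (simp add: abs_le_iff)
  moreover have "\<bar>R_fun a 1\<bar> + C / d \<ge> 0" using C d by simp
  ultimately show ?thesis by blast
qed

text \<open>This is u^(-s) for u > 0. The real logarithm inside exp makes it visibly entire in s and
  differentiable along the real variable u.\<close>

definition neg_powr :: "complex \<Rightarrow> real \<Rightarrow> complex" where
  "neg_powr s u = exp (- (s * of_real (ln u)))"

lemma norm_neg_powr: "u > 0 \<Longrightarrow> norm (neg_powr s u) = u powr (- Re s)"
  by (simp add: neg_powr_def powr_def)

lemma neg_powr_of_real: "u > 0 \<Longrightarrow> neg_powr (of_real s) u = of_real (u powr (- s))"
  unfolding neg_powr_def powr_def by (simp flip: exp_of_real)

lemma has_vector_derivative_neg_powr:
  assumes "u > 0"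
  shows "(neg_powr s has_vector_derivative - (s / of_real u) * neg_powr s u) (at u within A)"
proof -
  have "((\<lambda>u. - (s * of_real (ln u))) has_vector_derivative - (s / of_real u)) (at u within A)"
    using assms by (auto intro!: derivative_eq_intros simp: has_real_derivative_iff_has_vector_derivative[symmetric] divide_inverse)
  from field_vector_diff_chain_within[OF this has_field_derivative_at_within[OF DERIV_exp]]
  show ?thesis by (simp add: neg_powr_def[abs_def] o_def mult.commute)
qed

text \<open>The error of the left-endpoint rule on [k, k+1] for the integral of f(u) u^(-s); it
  measures integral against sum.\<close>

definition unit_defect :: "(real \<Rightarrow> real) \<Rightarrow> nat \<Rightarrow> complex \<Rightarrow> complex" where
  "unit_defect f k s = integral {real k..real k + 1} (\<lambda>u. of_real (f u) * neg_powr s u) - of_real (f (real k)) * neg_powr s (real k)"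

lemma neg_powr_difference_bound:
  assumes k: "k \<ge> 1" and s: "Re s \<ge> - 1"
  shows "norm (neg_powr s (real k) - neg_powr s (real k + 1)) \<le> norm s * real k powr (- Re s - 1)"
proof -
  have "((\<lambda>u. - (s / of_real u) * neg_powr s u) has_integral (neg_powr s (real k + 1) - neg_powr s (real k))) (cbox (real k) (real k + 1))"
    unfolding cbox_interval using k by (intro fundamental_theorem_of_calculus has_vector_derivative_neg_powr) auto
  moreover have "norm (- (s / of_real u) * neg_powr s u) \<le> norm s * real k powr (- Re s - 1)"
    if "u \<in> cbox (real k) (real k + 1)" for u
  proof -
    have u: "u \<ge> real k" "u > 0" using that k by auto
    have "norm (- (s / of_real u) * neg_powr s u) = norm s * u powr (- Re s - 1)"
      using u by (simp add: norm_mult norm_divide norm_neg_powr powr_diff)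
    also have "\<dots> \<le> norm s * real k powr (- Re s - 1)"
      using u k s by (intro mult_left_mono powr_mono2') auto
    finally show ?thesis .
  qed
  ultimately have "norm (neg_powr s (real k + 1) - neg_powr s (real k)) \<le> norm s * real k powr (- Re s - 1) * measure lborel (cbox (real k) (real k + 1))"
    by (intro has_integral_bound) auto
  thus ?thesis by (simp add: norm_minus_commute)
qed

text \<open>Both f and u f' are O(u powr d), so the derivative of f(u) u^(-s) is smaller than the
  function bound by a factor of order 1/u. This extra power moves convergence of the summed defects
  from Re s > d + 1 to Re s > d.\<close>

lemma unit_defect_bound:
  assumes k: "k \<ge> 1" and s: "Re s \<ge> d"
    and f: "\<And>u. u > 0 \<Longrightarrow> (f has_real_derivative q u / u) (at u)"
    and Cq: "Cq \<ge> 0" "\<And>u. u > 0 \<Longrightarrow> \<bar>q u\<bar> \<le> Cq * u powr d"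
    and Cf: "Cf \<ge> 0" "\<And>u. u \<ge> 1 \<Longrightarrow> \<bar>f u\<bar> \<le> Cf * u powr d"
  shows "norm (unit_defect f k s) \<le> (Cq + norm s * Cf) * real k powr (d - Re s - 1)"
proof -
  define B where "B = (Cq + norm s * Cf) * real k powr (d - Re s - 1)"
  have B0: "B \<ge> 0" using Cq Cf by (simp add: B_def)
  define p where "p = (\<lambda>u. of_real (f u) * neg_powr s u)"
  define p' where "p' = (\<lambda>u. of_real (f u) * (- (s / of_real u) * neg_powr s u) + of_real (q u / u) * neg_powr s u)"
  have p: "(p has_vector_derivative p' u) (at u within A)" if "u > 0" for u A
  proof -
    have "((\<lambda>u. complex_of_real (f u)) has_vector_derivative of_real (q u / u)) (at u within A)"
      using has_vector_derivative_of_real[OF f[OF that, THEN has_field_derivative_at_within]] by blast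
    from has_vector_derivative_mult[OF this has_vector_derivative_neg_powr[OF that]]
    show ?thesis unfolding p_def p'_def .
  qed
  have p'_le: "norm (p' u) \<le> B" if u: "u \<ge> real k" for u
  proof -
    have u1: "u \<ge> 1" "u > 0" using u k by auto
    have "norm (p' u) \<le> \<bar>f u\<bar> * (norm s / u * u powr (- Re s)) + \<bar>q u\<bar> / u * u powr (- Re s)"
      unfolding p'_def by (rule norm_triangle_le) (use u1 in \<open>simp add: norm_mult norm_divide norm_neg_powr\<close>)
    also have "\<dots> \<le> Cf * u powr d * (norm s / u * u powr (- Re s)) + Cq * u powr d / u * u powr (- Re s)"
      using Cf(2)[OF u1(1)] Cq(2)[OF u1(2)] u1 by (intro add_mono mult_right_mono divide_right_mono) auto
    also have "\<dots> = (Cq + norm s * Cf) * (u powr d / u * u powr (- Re s))"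
      by (simp add: algebra_simps add_divide_distrib)
    also have "u powr d / u * u powr (- Re s) = u powr (d - Re s - 1)"
    proof -
      have "u powr (d - Re s - 1) = u powr ((d - 1) + (- Re s))" by (simp add: algebra_simps)
      also have "\<dots> = u powr (d - 1) * u powr (- Re s)" by (rule powr_add)
      finally show ?thesis using u1 by (simp add: powr_diff)
    qed
    also have "(Cq + norm s * Cf) * u powr (d - Re s - 1) \<le> B"
      unfolding B_def using u u1 k s Cq Cf by (intro mult_left_mono powr_mono2') auto
    finally show ?thesis .
  qed
  have diff: "norm (p u - p (real k)) \<le> B" if u: "u \<in> {real k..real k + 1}" for u
  proof -
    have "(p' has_integral (p u - p (real k))) (cbox (real k) u)"
      unfolding cbox_interval using k u by (intro fundamental_theorem_of_calculus p) auto
    hence "norm (p u - p (real k)) \<le> B * measure lborel (cbox (real k) u)"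
      using B0 p'_le by (intro has_integral_bound) auto
    also have "\<dots> \<le> B * 1" using B0 u by (intro mult_left_mono) auto
    finally show ?thesis by simp
  qed
  have "continuous_on {real k..real k + 1} p"
    by (rule continuous_on_vector_derivative[OF p]) (use k in auto)
  hence "p integrable_on {real k..real k + 1}" by (rule integrable_continuous_interval)
  hence "((\<lambda>u. p u - p (real k)) has_integral (integral {real k..real k + 1} p - p (real k))) (cbox (real k) (real k + 1))"
    using has_integral_diff[OF integrable_integral has_integral_const_real[of "p (real k)" "real k" "real k + 1"]]
    unfolding cbox_interval by simp
  hence "norm (integral {real k..real k + 1} p - p (real k)) \<le> B * measure lborel (cbox (real k) (real k + 1))"
    using B0 diff by (intro has_integral_bound) auto
  thus ?thesis by (simp add: unit_defect_def p_def B_def)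
qed

lemma holomorphic_unit_defect:
  assumes k: "k \<ge> 1" and f: "continuous_on {real k..real k + 1} f"
  shows "unit_defect f k holomorphic_on A"
proof -
  have lncont: "continuous_on (UNIV \<times> {real k..real k + 1}) (\<lambda>x. ln (snd x))"
    using k by (intro continuous_on_ln continuous_intros) auto
  have fcont: "continuous_on (UNIV \<times> {real k..real k + 1}) (\<lambda>x. f (snd x))"
    by (rule continuous_on_compose2[OF f]) (auto intro: continuous_intros)
  have "(\<lambda>s. integral (cbox (real k) (real k + 1)) (\<lambda>u. of_real (f u) * neg_powr s u)) holomorphic_on UNIV"
  proof (rule leibniz_rule_holomorphic)
    fix s u
    show "((\<lambda>s. of_real (f u) * neg_powr s u) has_field_derivative of_real (f u) * (neg_powr s u * (- of_real (ln u)))) (at s within UNIV)"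
      unfolding neg_powr_def by (auto intro!: derivative_eq_intros)
    have "continuous_on {real k..real k + 1} (\<lambda>u. of_real (f u) * neg_powr s u)"
      unfolding neg_powr_def using k by (intro continuous_intros f continuous_on_ln) auto
    thus "(\<lambda>u. of_real (f u) * neg_powr s u) integrable_on cbox (real k) (real k + 1)"
      unfolding cbox_interval by (rule integrable_continuous_interval)
  next
    show "continuous_on (UNIV \<times> cbox (real k) (real k + 1)) (\<lambda>(s, u). of_real (f u) * (neg_powr s u * (- of_real (ln u))))"
      unfolding neg_powr_def case_prod_beta cbox_interval by (intro continuous_intros lncont fcont)
  qed auto
  moreover have "(\<lambda>s. of_real (f (real k)) * neg_powr s (real k)) holomorphic_on UNIV"
    unfolding neg_powr_def by (intro holomorphic_intros)
  ultimately have "unit_defect f k holomorphic_on UNIV"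
    unfolding unit_defect_def[abs_def] cbox_interval by (intro holomorphic_on_diff) auto
  thus ?thesis by (rule holomorphic_on_subset) auto
qed

text \<open>\<open>\<Psi>\<close> is the boundary term of two integrations by parts. In its
  derivative the two terms containing \<open>R_euler a u\<close> cancel, leaving the density and
  (1-s)^2 f(u) u^(-s).\<close>

lemma integral_R_dens_by_parts:
  fixes s a :: real and N :: nat
  assumes N: "N \<ge> 1"
  defines "\<Psi> \<equiv> (\<lambda>u. (1 - s) * R_fun a u * u powr (1 - s) - R_euler a u * u powr (1 - s))"
  shows "integral {1..real N} (\<lambda>u. R_dens a u * u powr (1 - s))
     = \<Psi> (real N) - \<Psi> 1 - (1 - s)\<^sup>2 * integral {1..real N} (\<lambda>u. R_fun a u * u powr (- s))"
proof -
  have d: "(\<Psi> has_real_derivative R_dens a u * u powr (1 - s) + (1 - s)\<^sup>2 * (R_fun a u * u powr (- s))) (at u)"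
    if u: "u \<ge> 1" for u
  proof -
    have u0: "u > 0" "u \<noteq> 0" using u by auto
    have p: "u powr (1 - s) = u * u powr (- s)" "u powr (1 - s - 1) = u powr (- s)"
      using u0 powr_add[of u 1 "- s"] by simp_all
    show ?thesis unfolding \<Psi>_def
      by (rule derivative_eq_intros has_derivative_R_fun has_derivative_R_euler has_real_derivative_powr refl u0)+
        (use u0 in \<open>simp add: p power2_eq_square field_simps\<close>)
  qed
  have 1: "((\<lambda>u. R_dens a u * u powr (1 - s) + (1 - s)\<^sup>2 * (R_fun a u * u powr (- s))) has_integral (\<Psi> (real N) - \<Psi> 1)) {1..real N}"
    using N by (intro fundamental_theorem_of_calculus)
      (auto intro!: has_field_derivative_at_within d simp flip: has_real_derivative_iff_has_vector_derivative)
  have "continuous_on {1..real N} (\<lambda>u. R_fun a u * u powr (- s))"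
    by (intro continuous_intros continuous_R_fun) auto
  hence 2: "((\<lambda>u. (1 - s)\<^sup>2 * (R_fun a u * u powr (- s))) has_integral
      ((1 - s)\<^sup>2 * integral {1..real N} (\<lambda>u. R_fun a u * u powr (- s)))) {1..real N}"
    by (intro has_integral_mult_right integrable_integral integrable_continuous_interval)
  have "((\<lambda>u. R_dens a u * u powr (1 - s)) has_integral
      (\<Psi> (real N) - \<Psi> 1 - (1 - s)\<^sup>2 * integral {1..real N} (\<lambda>u. R_fun a u * u powr (- s)))) {1..real N}"
    using has_integral_diff[OF 1 2] by simp
  thus ?thesis by (rule integral_unique)
qed

lemma holomorphic_R_dens_mellin_unit:
  "(\<lambda>s. \<Sum>k. of_real (R_dens_coeff a k) / (of_nat k + 2 - s)) holomorphic_on {s. Re s < 2}"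
proof (rule holomorphic_on_suminf)
  show "open {s. Re s < 2}" by (rule open_halfspace_Re_lt)
  show "(\<lambda>s. of_real (R_dens_coeff a n) / (of_nat n + 2 - s)) holomorphic_on {s. Re s < 2}" for n
  proof (intro holomorphic_intros)
    fix s :: complex assume "s \<in> {s. Re s < 2}"
    hence "Re (of_nat n + 2 - s) > 0" by simp
    thus "of_nat n + 2 - s \<noteq> 0" by force
  qed
  fix z :: complex assume "z \<in> {s. Re s < 2}"
  hence z: "Re z < 2" by simp
  define e where "e = (2 - Re z) / 2"
  have e: "e > 0" using z by (simp add: e_def)
  have re: "2 - Re w \<ge> e" if "w \<in> cball z e" for w
  proof -
    have "\<bar>Re (z - w)\<bar> \<le> e" using that abs_Re_le_cmod[of "z - w"] by (simp add: dist_norm)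
    moreover have "Re z = 2 - 2 * e" by (simp add: e_def field_simps)
    ultimately show ?thesis by simp
  qed
  have "norm (of_real (R_dens_coeff a n) / (of_nat n + 2 - w)) \<le> \<bar>R_dens_coeff a n\<bar> * \<bar>1\<bar> ^ n / e"
    if w: "w \<in> cball z e" for n w
  proof -
    have "e \<le> Re (of_nat n + 2 - w)" using re[OF w] by simp
    also have "\<dots> \<le> norm (of_nat n + 2 - w)" by (rule complex_Re_le_cmod)
    finally show ?thesis using e by (simp add: norm_divide frac_le)
  qed
  moreover have "summable (\<lambda>n. \<bar>R_dens_coeff a n\<bar> * \<bar>1\<bar> ^ n / e)"
    by (intro summable_divide summable_abs_R_dens)
  moreover have "cball z e \<subseteq> {s. Re s < 2}" using re e by force
  ultimately show "\<exists>d M. 0 < d \<and> cball z d \<subseteq> {s. Re s < 2} \<and> summable M \<and>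
      (\<forall>n. \<forall>w\<in>cball z d. norm (of_real (R_dens_coeff a n) / (of_nat n + 2 - w)) \<le> M n)"
    using e by blast
qed

lemma nonpos_Ints_Re_le_0: "z \<in> \<int>\<^sub>\<le>\<^sub>0 \<Longrightarrow> Re z \<le> 0"
  by (auto elim!: nonpos_Ints_cases)

lemma summation_by_parts:
  fixes f :: "nat \<Rightarrow> real" and e :: "nat \<Rightarrow> real"
  shows "(\<Sum>k<n. (\<Sum>j=1..Suc k. f j) * (e (Suc k) - e (Suc (Suc k))))
     = (\<Sum>k<n. f (Suc k) * e (Suc k)) - (\<Sum>j=1..n. f j) * e (Suc n)"
  by (induction n) (simp_all add: algebra_simps)

text \<open>
  Assuming the bound, the Mellin transform of the density extends holomorphically to
  \<open>Re s > d\<close>. On the real segment above \<open>1 + d\<close> its product with zeta is a nowhere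
  vanishing function, so by continuation zeta has no zero to the right of \<open>d\<close>.
\<close>

theorem R_fun_partial_sums_unbounded:
  fixes a d C :: real and \<rho> :: complex
  assumes a: "a > 0" and \<rho>: "riemann_zeta \<rho> = 0" "Re \<rho> < 1" and d: "0 < d" "d < Re \<rho>"
    and C: "\<And>N::nat. N \<ge> 1 \<Longrightarrow> \<bar>\<Sum>k=1..N. R_fun a (real k)\<bar> \<le> C * real N powr d"
  shows False
proof -
  have d1: "d < 1" "d \<le> 1" using d \<rho> by auto
  obtain Cq where Cq: "Cq \<ge> 0" "\<And>u. u > 0 \<Longrightarrow> \<bar>R_euler a u\<bar> \<le> Cq * u powr d"
    using R_euler_bound[OF a d(1) d1(2)] by blast
  obtain Cf where Cf: "Cf \<ge> 0" "\<And>u. u \<ge> 1 \<Longrightarrow> \<bar>R_fun a u\<bar> \<le> Cf * u powr d"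
    using R_fun_bound[OF a d(1) d1(2)] by blast
  define S where "S = (\<lambda>n. \<Sum>k=1..n. R_fun a (real k))"
  have S: "\<bar>S n\<bar> \<le> C * real n powr d" if "n \<ge> 1" for n using C[OF that] by (simp add: S_def)
  have C0: "C \<ge> 0" using order_trans[OF abs_ge_zero S[of 1]] by simp
  \<comment> \<open>Abel summation of f(k) k^(-s) plus the defect on the same unit interval. The
    assumed bound on \<open>S\<close> makes each term O(k powr (d - Re s - 1)), so the series
    continues the integral of f(u) u^(-s) over u >= 1 to Re s > d.\<close>
  define t where "t = (\<lambda>k s. of_real (S (Suc k)) * (neg_powr s (real (Suc k)) - neg_powr s (real (Suc k) + 1))
      + unit_defect (R_fun a) (Suc k) s)"
  define K where "K = (\<lambda>s :: complex. C * norm s + (Cq + norm s * Cf))"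
  have t_bound: "norm (t k s) \<le> K s * real (Suc k) powr (d - Re s - 1)" if s: "Re s \<ge> d" for k s
  proof -
    have "norm (t k s) \<le> \<bar>S (Suc k)\<bar> * norm (neg_powr s (real (Suc k)) - neg_powr s (real (Suc k) + 1))
        + norm (unit_defect (R_fun a) (Suc k) s)"
      unfolding t_def by (rule norm_triangle_le) (simp add: norm_mult)
    also have "\<dots> \<le> C * real (Suc k) powr d * (norm s * real (Suc k) powr (- Re s - 1))
        + (Cq + norm s * Cf) * real (Suc k) powr (d - Re s - 1)"
    proof (intro add_mono mult_mono S neg_powr_difference_bound)
      show "norm (unit_defect (R_fun a) (Suc k) s) \<le> (Cq + norm s * Cf) * real (Suc k) powr (d - Re s - 1)"
        by (rule unit_defect_bound[OF _ s has_derivative_R_fun Cq Cf]) auto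
    qed (use s d C0 in auto)
    also have "C * real (Suc k) powr d * (norm s * real (Suc k) powr (- Re s - 1))
        = C * norm s * real (Suc k) powr (d - Re s - 1)"
      using powr_add[of "real (Suc k)" d "- Re s - 1"] by (simp add: algebra_simps)
    finally show ?thesis by (simp add: K_def algebra_simps)
  qed
  define W where "W = (\<lambda>s. \<Sum>k. t k s)"
  have W_hol: "W holomorphic_on {s. Re s > d}"
    unfolding W_def
  proof (rule holomorphic_on_suminf)
    show "open {s. Re s > d}" by (rule open_halfspace_Re_gt)
    have "unit_defect (R_fun a) (Suc n) holomorphic_on {s. Re s > d}" for n
      by (intro holomorphic_unit_defect continuous_R_fun) auto
    thus "t n holomorphic_on {s. Re s > d}" for n
      unfolding t_def neg_powr_def by (intro holomorphic_intros)
    fix z :: complex assume "z \<in> {s. Re s > d}"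
    hence z: "Re z > d" by simp
    define e where "e = (Re z - d) / 2"
    have e: "e > 0" using z by (simp add: e_def)
    have re: "Re w \<ge> d + e" if "w \<in> cball z e" for w
    proof -
      have "\<bar>Re (z - w)\<bar> \<le> e" using that abs_Re_le_cmod[of "z - w"] by (simp add: dist_norm)
      moreover have "Re z = d + 2 * e" by (simp add: e_def field_simps)
      ultimately show ?thesis by simp
    qed
    define B where "B = C * (norm z + e) + (Cq + (norm z + e) * Cf)"
    have "norm (t n w) \<le> B * real (Suc n) powr (- 1 - e)" if w: "w \<in> cball z e" for n w
    proof -
      have "norm w \<le> norm z + e"
        using w norm_triangle_ineq4[of z "z - w"] by (simp add: dist_norm)
      hence "K w \<le> B" unfolding K_def B_def using C0 Cf by (intro add_mono mult_left_mono mult_right_mono) auto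
      have "norm (t n w) \<le> K w * real (Suc n) powr (d - Re w - 1)"
        using re[OF w] e by (intro t_bound) auto
      also have "\<dots> \<le> B * real (Suc n) powr (- 1 - e)"
        using \<open>K w \<le> B\<close> re[OF w] C0 Cq Cf by (intro mult_mono powr_mono) (auto simp: K_def intro: order_trans[of _ "K w"])
      finally show ?thesis .
    qed
    moreover have "summable (\<lambda>n. B * real (Suc n) powr (- 1 - e))"
      using e by (intro summable_mult summable_Suc_powr) auto
    moreover have "cball z e \<subseteq> {s. Re s > d}" using re e by force
    ultimately show "\<exists>e M. 0 < e \<and> cball z e \<subseteq> {s. Re s > d} \<and> summable M \<and>
        (\<forall>n. \<forall>w\<in>cball z e. norm (t n w) \<le> M n)"
      using e by blast
  qed
  define B where "B = (\<lambda>s. \<Sum>k. of_real (R_dens_coeff a k) / (of_nat k + 2 - s) :: complex)"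
  \<comment> \<open>\<open>V\<close> continues the full Mellin transform: \<open>B\<close> is the
    unit interval, the two constants form minus the boundary term at u = 1, and \<open>W\<close> is
    the remaining integral.\<close>
  define V where "V = (\<lambda>s. B s + of_real (R_euler a 1) - (1 - s) * of_real (R_fun a 1) - (1 - s)\<^sup>2 * W s)"
  define \<Phi> where "\<Phi> = (\<lambda>s. riemann_zeta s * V s - exp ((s - 1) * of_real (ln a)) * Gamma (2 - s))"
  define D where "D = {s. d < Re s \<and> Re s < 2} - {1 :: complex}"
  have V_real: "complex_of_real (zeta_real s) * V (of_real s) = exp ((of_real s - 1) * of_real (ln a)) * Gamma (2 - of_real s)"
    if s: "1 + d < s" "s < 2" for s :: real
  proof -
    have s1: "1 < s" using s d by simp
    define I where "I = (\<lambda>n. integral {1..real n} (\<lambda>u. R_fun a u * u powr (- s)))"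
    have cont: "continuous_on A (\<lambda>u. R_fun a u * u powr (- s))" if "A \<subseteq> {0<..}" for A
      using that by (intro continuous_intros continuous_R_fun) auto
    have ud: "unit_defect (R_fun a) (Suc k) (of_real s) = of_real (integral {real (Suc k)..real (Suc k) + 1} (\<lambda>u. R_fun a u * u powr (- s))
        - R_fun a (real (Suc k)) * real (Suc k) powr (- s))" for k
    proof -
      have "continuous_on {real (Suc k)..real (Suc k) + 1} (\<lambda>u. R_fun a u * u powr (- s))" by (rule cont) auto
      hence "((\<lambda>u. R_fun a u * u powr (- s)) has_integral integral {real (Suc k)..real (Suc k) + 1} (\<lambda>u. R_fun a u * u powr (- s)))
          {real (Suc k)..real (Suc k) + 1}"
        by (intro integrable_integral integrable_continuous_interval)
      from has_integral_of_real[OF this, where 'b = complex]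
      have "((\<lambda>u. of_real (R_fun a u) * neg_powr (of_real s) u) has_integral
          of_real (integral {real (Suc k)..real (Suc k) + 1} (\<lambda>u. R_fun a u * u powr (- s)))) {real (Suc k)..real (Suc k) + 1}"
        by (rule has_integral_eq[rotated]) (simp add: neg_powr_of_real)
      thus ?thesis unfolding unit_defect_def by (simp add: integral_unique neg_powr_of_real)
    qed
    \<comment> \<open>The indices k < n cover the intervals from [1, 2] to [n, n+1], so the integral
      ends at n + 1, while summation by parts leaves \<open>S n\<close> with weight
      (n+1)^(-s).\<close>
    have sum_t: "(\<Sum>k<n. t k (of_real s)) = of_real (I (Suc n) - S n * real (Suc n) powr (- s))" for n
    proof -
      define e where "e = (\<lambda>j::nat. real j powr (- s))"
      define h where "h = (\<lambda>k::nat. integral {real k..real k + 1} (\<lambda>u. R_fun a u * u powr (- s)))"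
      have "t k (of_real s) = of_real (S (Suc k) * (e (Suc k) - e (Suc (Suc k))) + (h (Suc k) - R_fun a (real (Suc k)) * e (Suc k)))" for k
        unfolding t_def ud e_def h_def using neg_powr_of_real[of "real (Suc k)" s] neg_powr_of_real[of "real (Suc k) + 1" s]
        by (simp add: add_ac)
      hence "(\<Sum>k<n. t k (of_real s)) = of_real (\<Sum>k<n. S (Suc k) * (e (Suc k) - e (Suc (Suc k))) + (h (Suc k) - R_fun a (real (Suc k)) * e (Suc k)))"
        by (simp only: of_real_sum)
      also have "(\<Sum>k<n. S (Suc k) * (e (Suc k) - e (Suc (Suc k))) + (h (Suc k) - R_fun a (real (Suc k)) * e (Suc k)))
          = (\<Sum>k<n. h (Suc k)) - S n * e (Suc n)"
        using summation_by_parts[of "\<lambda>j. R_fun a (real j)" e n]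
        unfolding sum.distrib sum_subtractf S_def by linarith
      also have "(\<Sum>k<n. h (Suc k)) = I (Suc n)"
      proof (induction n)
        case (Suc n)
        have "I (Suc n) + h (Suc n) = I (Suc (Suc n))"
          unfolding I_def h_def
          using Henstock_Kurzweil_Integration.integral_combine[of 1 "real (Suc n)" "real (Suc n) + 1" "\<lambda>u. R_fun a u * u powr (- s)"]
            integrable_continuous_interval[OF cont[of "{1..real (Suc n) + 1}"]]
          by (simp add: add_ac subset_iff)
        thus ?case using Suc by simp
      qed (simp add: I_def)
      finally show ?thesis by (simp only: e_def)
    qed
    have lim_S: "(\<lambda>n. S n * real (Suc n) powr (- s)) \<longlonglongrightarrow> 0"
    proof (rule Lim_null_comparison)
      show "eventually (\<lambda>n. norm (S n * real (Suc n) powr (- s)) \<le> C * real (Suc n) powr (d - s)) sequentially"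
        using eventually_ge_at_top[of 1]
      proof eventually_elim
        case (elim n)
        have "norm (S n * real (Suc n) powr (- s)) \<le> C * real n powr d * real (Suc n) powr (- s)"
          using S[OF elim] by (simp add: abs_mult mult_right_mono)
        also have "\<dots> \<le> C * real (Suc n) powr d * real (Suc n) powr (- s)"
          using C0 d by (intro mult_right_mono mult_left_mono powr_mono2) auto
        also have "\<dots> = C * real (Suc n) powr (d - s)" using powr_add[of "real (Suc n)" d "- s"] by simp
        finally show ?case .
      qed
      show "(\<lambda>n. C * real (Suc n) powr (d - s)) \<longlonglongrightarrow> 0"
        using s by (intro tendsto_mult_right_zero tendsto_neg_powr filterlim_compose[OF filterlim_real_sequentially filterlim_Suc]) auto
    qed
    have "summable (\<lambda>k. t k (of_real s))"
    proof (rule summable_comparison_test'[of _ 0])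
      show "summable (\<lambda>k. K (of_real s) * real (Suc k) powr (d - s - 1))"
        using s d by (intro summable_mult summable_Suc_powr) auto
      show "norm (t k (of_real s)) \<le> K (of_real s) * real (Suc k) powr (d - s - 1)" for k
        using t_bound[of "of_real s" k] s d by simp
    qed
    hence "(\<lambda>n. \<Sum>k<n. t k (of_real s)) \<longlonglongrightarrow> W (of_real s)"
      unfolding W_def by (rule summable_LIMSEQ)
    from tendsto_add[OF this tendsto_of_real[OF lim_S]]
    have I_lim: "(\<lambda>n. complex_of_real (I (Suc n))) \<longlonglongrightarrow> W (of_real s)"
      unfolding sum_t by simp
    define P where "P = (\<lambda>u. (1 - s) * R_fun a u * u powr (1 - s) - R_euler a u * u powr (1 - s))"
    \<comment> \<open>Both boundary terms are O(u powr (d + 1 - s)), which decays because s > 1 +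
      d.\<close>
    have P_lim: "(\<lambda>n. P (real (Suc n))) \<longlonglongrightarrow> 0"
    proof (rule Lim_null_comparison)
      show "eventually (\<lambda>n. norm (P (real (Suc n))) \<le> (\<bar>1 - s\<bar> * Cf + Cq) * real (Suc n) powr (d + 1 - s)) sequentially"
      proof (intro always_eventually allI)
        fix n
        define u where "u = real (Suc n)"
        have u: "u \<ge> 1" "u > 0" by (simp_all add: u_def)
        have "norm (P u) \<le> \<bar>1 - s\<bar> * \<bar>R_fun a u\<bar> * u powr (1 - s) + \<bar>R_euler a u\<bar> * u powr (1 - s)"
          unfolding P_def by (rule order_trans[OF norm_triangle_ineq4]) (simp add: abs_mult)
        also have "\<dots> \<le> \<bar>1 - s\<bar> * (Cf * u powr d) * u powr (1 - s) + (Cq * u powr d) * u powr (1 - s)"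
          using Cf(2)[OF u(1)] Cq(2)[OF u(2)] by (intro add_mono mult_right_mono mult_left_mono) auto
        also have "\<dots> = (\<bar>1 - s\<bar> * Cf + Cq) * (u powr d * u powr (1 - s))" by (simp add: algebra_simps)
        also have "u powr d * u powr (1 - s) = u powr (d + 1 - s)" by (simp add: powr_add[symmetric] add_diff_eq)
        finally show "norm (P (real (Suc n))) \<le> (\<bar>1 - s\<bar> * Cf + Cq) * real (Suc n) powr (d + 1 - s)"
          by (simp only: u_def)
      qed
      show "(\<lambda>n. (\<bar>1 - s\<bar> * Cf + Cq) * real (Suc n) powr (d + 1 - s)) \<longlonglongrightarrow> 0"
        using s by (intro tendsto_mult_right_zero tendsto_neg_powr filterlim_compose[OF filterlim_real_sequentially filterlim_Suc]) auto
    qed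
    define b where "b = (\<Sum>k. R_dens_coeff a k / (real k + 2 - s))"
    define T where "T = a powr (s - 1) * Gamma (2 - s) / zeta_real s"
    have "(\<lambda>n. integral {1..real (Suc n)} (\<lambda>u. R_dens a u * u powr (1 - s))) \<longlonglongrightarrow> T - b"
      using LIMSEQ_Suc[OF integral_R_dens_tendsto[OF a s1 s(2)]] by (simp only: T_def b_def)
    hence "(\<lambda>n. P (real (Suc n)) - P 1 - (1 - s)\<^sup>2 * I (Suc n)) \<longlonglongrightarrow> T - b"
      using integral_R_dens_by_parts[of "Suc n" a s for n] by (simp add: P_def I_def)
    from tendsto_of_real[OF this, where 'a = complex]
    have "(\<lambda>n. complex_of_real (P (real (Suc n)) - P 1 - (1 - s)\<^sup>2 * I (Suc n))) \<longlonglongrightarrow> of_real (T - b)" .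
    moreover have "(\<lambda>n. complex_of_real (P (real (Suc n)) - P 1 - (1 - s)\<^sup>2 * I (Suc n))) \<longlonglongrightarrow>
        of_real 0 - of_real (P 1) - (1 - of_real s)\<^sup>2 * W (of_real s)"
    proof -
      have "(\<lambda>n. complex_of_real (P (real (Suc n))) - of_real (P 1) - (1 - of_real s)\<^sup>2 * of_real (I (Suc n))) \<longlonglongrightarrow>
        of_real 0 - of_real (P 1) - (1 - of_real s)\<^sup>2 * W (of_real s)"
        by (intro tendsto_intros I_lim P_lim)
      thus ?thesis by simp
    qed
    ultimately have eq: "complex_of_real (T - b) = - of_real (P 1) - (1 - of_real s)\<^sup>2 * W (of_real s)"
      using LIMSEQ_unique by fastforce
    have Bb: "B (of_real s) = of_real b"
    proof -
      have "summable (\<lambda>k. R_dens_coeff a k / (real k + 2 - s))"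
      proof (rule summable_comparison_test'[OF summable_mult2[OF summable_abs_R_dens[of a 1]], of 0])
        show "norm (R_dens_coeff a k / (real k + 2 - s)) \<le> \<bar>R_dens_coeff a k\<bar> * \<bar>1\<bar> ^ k * (1 / (2 - s))" for k
          using s by (simp add: frac_le)
      qed
      hence "(\<lambda>k. complex_of_real (R_dens_coeff a k / (real k + 2 - s))) sums of_real b"
        unfolding b_def by (intro sums_of_real summable_sums)
      thus ?thesis unfolding B_def by (simp add: sums_iff)
    qed
    have "V (of_real s) = of_real b - of_real (P 1) - (1 - of_real s)\<^sup>2 * W (of_real s)"
      unfolding V_def Bb by (simp add: P_def)
    also have "\<dots> = of_real T" using eq by (simp add: algebra_simps)
    finally have "complex_of_real (zeta_real s) * V (of_real s) = of_real (zeta_real s * T)" by simp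
    also have "zeta_real s * T = a powr (s - 1) * Gamma (2 - s)"
      using zeta_real_ge_1[OF s1] by (simp add: T_def)
    also have "complex_of_real \<dots> = exp ((of_real s - 1) * of_real (ln a)) * Gamma (2 - of_real s)"
    proof -
      have "complex_of_real (a powr (s - 1)) = exp ((of_real s - 1) * of_real (ln a))"
        unfolding powr_def using a by (simp flip: exp_of_real)
      moreover have "complex_of_real (Gamma (2 - s)) = Gamma (2 - of_real s)"
        using Gamma_complex_of_real[of "2 - s"] by simp
      ultimately show ?thesis by simp
    qed
    finally show ?thesis .
  qed
  have strip: "open {s. d < Re s \<and> Re s < 2}" "connected {s. d < Re s \<and> Re s < 2}"
  proof -
    have eq: "{s. d < Re s \<and> Re s < 2} = {s. Re s > d} \<inter> {s. Re s < 2}" by auto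
    show "open {s. d < Re s \<and> Re s < 2}" unfolding eq
      by (intro open_Int open_halfspace_Re_gt open_halfspace_Re_lt)
    show "connected {s. d < Re s \<and> Re s < 2}" unfolding eq
      by (intro convex_connected convex_Int convex_halfspace_Re_gt convex_halfspace_Re_lt)
  qed
  have "\<Phi> \<rho> = 0"
  \<comment> \<open>The limit point is the midpoint of the interval (1 + d, 2). Its half-length is
    (1 - d)/2, so a displacement of at most (1 - d)/4 stays inside.\<close>
  proof (rule analytic_continuation[where f = \<Phi> and w = \<rho> and S = D and U = "complex_of_real ` {1 + d<..<2}" and \<xi> = "of_real ((3 + d) / 2)"])
    show "open D" unfolding D_def using strip by (intro open_delete)
    show "connected D" unfolding D_def using strip by (intro connected_open_delete) auto
    show "complex_of_real ` {1 + d<..<2} \<subseteq> D" using d by (auto simp: D_def)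
    show "of_real ((3 + d) / 2) \<in> D"
      unfolding D_def using d d1 by (simp del: of_real_divide of_real_add)
    show "complex_of_real ((3 + d) / 2) islimpt complex_of_real ` {1 + d<..<2}"
      unfolding islimpt_approachable
    proof (intro allI impI)
      fix e :: real assume e: "e > 0"
      define x where "x = (3 + d) / 2 + min (e / 2) ((1 - d) / 4)"
      have x: "x \<in> {1 + d<..<2}" "x \<noteq> (3 + d) / 2" "\<bar>x - (3 + d) / 2\<bar> < e"
        using e d1 by (auto simp: x_def min_def field_simps)
      have "dist (complex_of_real x) (of_real ((3 + d) / 2)) = \<bar>x - (3 + d) / 2\<bar>"
        unfolding dist_norm of_real_diff[symmetric] norm_of_real ..
      thus "\<exists>x'\<in>complex_of_real ` {1 + d<..<2}. x' \<noteq> of_real ((3 + d) / 2) \<and> dist x' (of_real ((3 + d) / 2)) < e"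
        using x by (intro bexI[of _ "of_real x"]) (auto simp del: of_real_divide of_real_add)
    qed
    show "\<Phi> z = 0" if "z \<in> complex_of_real ` {1 + d<..<2}" for z
    proof -
      obtain s where s: "z = of_real s" "1 + d < s" "s < 2" using \<open>z \<in> complex_of_real ` {1 + d<..<2}\<close> by auto
      show ?thesis using V_real[OF s(2,3)] riemann_zeta_of_real[of s] s d by (simp add: \<Phi>_def)
    qed
    show "\<rho> \<in> D" using d \<rho> by (auto simp: D_def)
    have "B holomorphic_on D"
      unfolding B_def by (rule holomorphic_on_subset[OF holomorphic_R_dens_mellin_unit]) (auto simp: D_def)
    moreover have "W holomorphic_on D"
      by (rule holomorphic_on_subset[OF W_hol]) (auto simp: D_def)
    moreover have "riemann_zeta holomorphic_on D"
      by (rule holomorphic_on_subset[OF holomorphic_riemann_zeta]) (auto simp: D_def)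
    moreover have "2 - s \<notin> \<int>\<^sub>\<le>\<^sub>0" if "s \<in> D" for s
      using that nonpos_Ints_Re_le_0[of "2 - s"] by (auto simp: D_def)
    ultimately show "\<Phi> holomorphic_on D"
      unfolding \<Phi>_def V_def by (intro holomorphic_intros) auto
  qed
  hence "exp ((\<rho> - 1) * of_real (ln a)) * Gamma (2 - \<rho>) = 0" by (simp add: \<Phi>_def \<rho>)
  moreover have "2 - \<rho> \<notin> \<int>\<^sub>\<le>\<^sub>0"
    using nonpos_Ints_Re_le_0[of "2 - \<rho>"] \<rho> by auto
  ultimately show False using Gamma_nonzero[of "2 - \<rho>"] by simp
qed

section \<open>Transfer to the partial sums of ERi\<close>

lemma ERi_partial_sums_not_eventually_bounded:
  fixes x d c :: real and \<rho> :: complex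
  assumes x: "x > 1" and \<rho>: "riemann_zeta \<rho> = 0" "Re \<rho> < 1" and d: "0 < d" "d < Re \<rho>"
  shows "\<not> eventually (\<lambda>N. norm (\<Sum>k = 1..N. ERi (complex_of_real (- 2 * real k * ln x))) \<le> c * real N powr d) sequentially"
proof
  define S where "S = (\<lambda>N. \<Sum>k=1..N. R_fun (2 * ln x) (real k))"
  have S: "norm (\<Sum>k = 1..N. ERi (complex_of_real (- 2 * real k * ln x))) = \<bar>S N\<bar>" for N
  proof -
    have "(\<Sum>k = 1..N. ERi (complex_of_real (- 2 * real k * ln x))) = of_real (S N)"
      unfolding S_def of_real_sum
      by (intro sum.cong refl) (simp only: ERi_eq_R_fun[symmetric], simp add: mult_ac)
    thus ?thesis by simp
  qed
  assume "eventually (\<lambda>N. norm (\<Sum>k = 1..N. ERi (complex_of_real (- 2 * real k * ln x))) \<le> c * real N powr d) sequentially"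
  then obtain M where M: "\<And>N. N \<ge> M \<Longrightarrow> \<bar>S N\<bar> \<le> c * real N powr d"
    unfolding S eventually_sequentially by blast
  \<comment> \<open>The finitely many early partial sums are absorbed into the constant, which
    suffices because N powr d >= 1 for N >= 1.\<close>
  define C where "C = \<bar>c\<bar> + (\<Sum>N<M. \<bar>S N\<bar>)"
  have sum0: "0 \<le> (\<Sum>N<M. \<bar>S N\<bar>)" by (intro sum_nonneg) auto
  hence C0: "0 \<le> C" "c \<le> C" unfolding C_def by linarith+
  have "\<bar>S N\<bar> \<le> C * real N powr d" if N: "N \<ge> 1" for N
  proof (cases "N \<ge> M")
    case True
    have "\<bar>S N\<bar> \<le> c * real N powr d" by (rule M[OF True])
    also have "\<dots> \<le> C * real N powr d"
      using C0 by (intro mult_right_mono) auto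
    finally show ?thesis .
  next
    case False
    have "\<bar>S N\<bar> \<le> (\<Sum>N<M. \<bar>S N\<bar>)" using False by (intro member_le_sum) auto
    also have "\<dots> \<le> C * 1" by (simp add: C_def)
    also have "\<dots> \<le> C * real N powr d"
      using N d C0 by (intro mult_left_mono ge_one_powr_ge_zero) auto
    finally show ?thesis .
  qed
  thus False
    using R_fun_partial_sums_unbounded[of "2 * ln x" \<rho> d C] x \<rho> d by (simp add: S_def)
qed

theorem proposition4p1:
  fixes x :: real
  assumes "x > 1"
  shows "(\<forall>\<theta>::real. \<theta> < zeta_Theta \<longrightarrow>
            (\<lambda>T::real. SigmaRtriv T x) \<notin> O[at_top](\<lambda>T. complex_of_real (T powr \<theta>)))
       \<and> limsup (\<lambda>N::nat. ereal (norm (\<Sum>k = 1..N. ERi (complex_of_real (- 2 * real k * ln x))))) = \<infinity>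
       \<and> \<not> summable (\<lambda>k::nat. ERi (complex_of_real (- 2 * real (Suc k) * ln x)))"
proof -
  define S where "S = (\<lambda>N. \<Sum>k = 1..N. ERi (complex_of_real (- 2 * real k * ln x)))"
  define Z where "Z = {Re \<rho> | \<rho>. riemann_zeta \<rho> = 0 \<and> 0 < Re \<rho> \<and> Re \<rho> < 1}"
  have Z: "Z \<noteq> {}" "bdd_above Z"
    using nontrivial_zero_exists by (auto simp: Z_def intro!: bdd_aboveI[of _ 1])
  obtain \<rho>0 where \<rho>0: "riemann_zeta \<rho>0 = 0" "0 < Re \<rho>0" "Re \<rho>0 < 1"
    using nontrivial_zero_exists by blast
  have unbounded: "\<not> eventually (\<lambda>N. norm (S N) \<le> c) sequentially" for c
  proof
    assume "eventually (\<lambda>N. norm (S N) \<le> c) sequentially"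
    \<comment> \<open>Boundedness is weakened to growth with an admissible positive exponent below
      the real part of a zero.\<close>
    hence "eventually (\<lambda>N. norm (S N) \<le> \<bar>c\<bar> * real N powr (Re \<rho>0 / 2)) sequentially"
      using eventually_ge_at_top[of 1]
    proof eventually_elim
      case (elim N)
      have "\<bar>c\<bar> * 1 \<le> \<bar>c\<bar> * real N powr (Re \<rho>0 / 2)"
        using elim \<rho>0 by (intro mult_left_mono ge_one_powr_ge_zero) auto
      thus ?case using elim by simp
    qed
    thus False
      using ERi_partial_sums_not_eventually_bounded[OF assms \<rho>0(1,3), of "Re \<rho>0 / 2"] \<rho>0
      by (simp add: S_def)
  qed
  have "(\<lambda>T::real. SigmaRtriv T x) \<notin> O[at_top](\<lambda>T. complex_of_real (T powr \<theta>))" if \<theta>: "\<theta> < zeta_Theta" for \<theta>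
  proof
    assume "(\<lambda>T::real. SigmaRtriv T x) \<in> O[at_top](\<lambda>T. complex_of_real (T powr \<theta>))"
    then obtain c where c: "c > 0" "eventually (\<lambda>T. norm (SigmaRtriv T x) \<le> c * norm (complex_of_real (T powr \<theta>))) at_top"
      by (elim landau_o.bigE)
    obtain \<rho> where \<rho>: "riemann_zeta \<rho> = 0" "0 < Re \<rho>" "Re \<rho> < 1" "\<theta> < Re \<rho>"
      using \<theta> less_cSup_iff[OF Z] unfolding zeta_Theta_def Z_def[symmetric] by (auto simp: Z_def)
    \<comment> \<open>The given \<theta> may be zero or negative; the maximum is positive, still
      below Re \<rho>, and only weakens the bound for N >= 1.\<close>
    define d where "d = max \<theta> (Re \<rho> / 2)"
    have d: "0 < d" "d < Re \<rho>" "\<theta> \<le> d" using \<rho> by (auto simp: d_def)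
    have "eventually (\<lambda>N. norm (SigmaRtriv (real N) x) \<le> c * norm (complex_of_real (real N powr \<theta>))) sequentially"
      using c(2) filterlim_real_sequentially by (rule eventually_compose_filterlim)
    hence "eventually (\<lambda>N. norm (S N) \<le> c * real N powr d) sequentially"
      using eventually_ge_at_top[of 1]
    proof eventually_elim
      case (elim N)
      have "{k. 1 \<le> k \<and> real k \<le> real N} = {1..N}" by auto
      hence "norm (S N) \<le> c * real N powr \<theta>" using elim by (simp add: SigmaRtriv_def S_def)
      also have "\<dots> \<le> c * real N powr d" using c elim d by (intro mult_left_mono powr_mono) auto
      finally show ?case .
    qed
    thus False
      using ERi_partial_sums_not_eventually_bounded[OF assms \<rho>(1,3) d(1,2)] by (simp add: S_def)
  qed
  moreover have "limsup (\<lambda>N. ereal (norm (S N))) = \<infinity>"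
  proof (rule ccontr)
    assume "limsup (\<lambda>N. ereal (norm (S N))) \<noteq> \<infinity>"
    then obtain n :: nat where "limsup (\<lambda>N. ereal (norm (S N))) < ereal (real n)"
      using less_PInf_Ex_of_nat by blast
    hence "eventually (\<lambda>N. ereal (norm (S N)) < ereal (real n)) sequentially" by (rule Limsup_lessD)
    hence "eventually (\<lambda>N. norm (S N) \<le> real n) sequentially" by (rule eventually_mono) simp
    thus False using unbounded by blast
  qed
  moreover have "\<not> summable (\<lambda>k::nat. ERi (complex_of_real (- 2 * real (Suc k) * ln x)))"
  proof
    assume "summable (\<lambda>k::nat. ERi (complex_of_real (- 2 * real (Suc k) * ln x)))"
    hence "convergent (\<lambda>n. \<Sum>k<n. ERi (complex_of_real (- 2 * real (Suc k) * ln x)))"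
      by (simp add: summable_iff_convergent)
    moreover have "(\<Sum>k<n. ERi (complex_of_real (- 2 * real (Suc k) * ln x))) = S n" for n
      unfolding S_def by (rule sum.reindex_bij_witness[of _ "\<lambda>k. k - 1" Suc]) auto
    ultimately have "Bseq S" by (simp add: convergent_imp_Bseq)
    then obtain c where "\<And>n. norm (S n) \<le> c" by (auto simp: Bseq_def)
    thus False using unbounded[of c] by simp
  qed
  ultimately show ?thesis unfolding S_def by blast
qed

end
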